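(* The category $\mathrm{Fund}(\mathrm{SO}_3\text{-}\mathrm{Crys})$ is isomorphic, as a $\Bbbk$-linear monoidal category, to the $\Bbbk$-linear monoidal category generated by a single object $B_1$ and generating morphisms (besides the identity $\mathrm{id}$ of $B_1$) $$c:B_1\otimes B_1\to\mathbb 1,\quad u:\mathbb 1\to B_1\otimes B_1,\quad m:B_1\otimes B_1\to B_1,\quad s:B_1\to B_1\otimes B_1,$$ subject to the following relations and their vertical reflections: (SO3.1) $c\,u=1$. (SO3.2) $m\,s=\mathrm{id}$. (SO3.3) $(\mathrm{id}\otimes m)(s\otimes\mathrm{id})=s\,m+u\,c=(m\otimes\mathrm{id})(\mathrm{id}\otimes s)$. (SO3.4) $(\mathrm{id}\otimes c)(s\otimes\mathrm{id})=0=(c\otimes\mathrm{id})(\mathrm{id}\otimes s)$. (SO3.5) $c\,s=0$. (SO3.6) $m(m\otimes\mathrm{id})=m(\mathrm{id}\otimes m)$. (SO3.7) $c(\mathrm{id}\otimes m)=c(m\otimes\mathrm{id})$.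
   Context: $\Bbbk$ is a field. $\mathfrak{sl}_2$-Crys is the (strictified) $\Bbbk$-linear monoidal category whose objects are finite direct sums (disjoint unions) of the highest weight crystals $B(k\omega_1)$, $k\ge0$, of $\mathfrak{sl}_2$ ($B(k\omega_1)$ has $k+1$ elements), with morphisms $\Bbbk$-linear combinations of strict crystal morphisms (maps $B\sqcup\{0\}\to C\sqcup\{0\}$ with $0\mapsto0$, preserving weights and commuting with the Kashiwara operators $e,f$), viewed as linear maps between $\Bbbk$-spans. Tensor product: $e(b\otimes c)=eb\otimes c$ if $\varphi(b)\ge\varepsilon(c)$, else $b\otimes ec$; $f(b\otimes c)=fb\otimes c$ if $\varphi(b)>\varepsilon(c)$, else $b\otimes fc$, where $\varepsilon(b)=\max\{m:e^mb\ne0\}$, $\varphi(b)=\max\{m:f^mb\ne0\}$. $\mathrm{SO}_3$-Crys is the subcategory of $\mathfrak{sl}_2$-Crys generated by the highest weight crystals of odd cardinality, and $\mathrm{Fund}(\mathrm{SO}_3\text{-Crys})$ is its full monoidal subcategory on the tensor powers (including $\mathbb 1$) of the three-element crystal $B_1:=B(2\omega_1)$. Juxtaposition denotes composition. Vertical reflection reverses composition and exchanges domain and codomain, keeping the left-right order of tensor factors: $c\leftrightarrow u$, $m\leftrightarrow s$. *)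

theory Defs
  imports Main
begin

section \<open>Strict linear monoidal categories\<close>

record ('o, 'm, 'k) monoidal_data =
  Obj :: "'o set"
  Hom :: "'o \<Rightarrow> 'o \<Rightarrow> 'm set"
  Ident :: "'o \<Rightarrow> 'm"
  Compose :: "'m \<Rightarrow> 'm \<Rightarrow> 'm"  \<comment> \<open>\<open>Compose C g f\<close> is \<open>g\<close> after \<open>f\<close>\<close>
  Unit :: "'o"
  TensorObj :: "'o \<Rightarrow> 'o \<Rightarrow> 'o"
  TensorMor :: "'m \<Rightarrow> 'm \<Rightarrow> 'm"
  ZeroMor :: "'o \<Rightarrow> 'o \<Rightarrow> 'm"
  AddMor :: "'m \<Rightarrow> 'm \<Rightarrow> 'm"
  ScaleMor :: "'k \<Rightarrow> 'm \<Rightarrow> 'm"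

locale linear_monoidal_category =
  fixes C :: "('o, 'm, 'k::field) monoidal_data"
  assumes hom_disjoint:
      "\<lbrakk>X \<in> Obj C; Y \<in> Obj C; X' \<in> Obj C; Y' \<in> Obj C; f \<in> Hom C X Y; f \<in> Hom C X' Y'\<rbrakk>
        \<Longrightarrow> X = X' \<and> Y = Y'"
    and ident_hom: "X \<in> Obj C \<Longrightarrow> Ident C X \<in> Hom C X X"
    and compose_hom:
      "\<lbrakk>X \<in> Obj C; Y \<in> Obj C; Z \<in> Obj C; f \<in> Hom C X Y; g \<in> Hom C Y Z\<rbrakk>
        \<Longrightarrow> Compose C g f \<in> Hom C X Z"
    and compose_assoc:
      "\<lbrakk>X \<in> Obj C; Y \<in> Obj C; Z \<in> Obj C; W \<in> Obj C;
        f \<in> Hom C X Y; g \<in> Hom C Y Z; h \<in> Hom C Z W\<rbrakk>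
        \<Longrightarrow> Compose C (Compose C h g) f = Compose C h (Compose C g f)"
    and compose_ident:
      "\<lbrakk>X \<in> Obj C; Y \<in> Obj C; f \<in> Hom C X Y\<rbrakk>
        \<Longrightarrow> Compose C (Ident C Y) f = f \<and> Compose C f (Ident C X) = f"
    and unit_obj: "Unit C \<in> Obj C"
    and tensor_obj: "\<lbrakk>X \<in> Obj C; Y \<in> Obj C\<rbrakk> \<Longrightarrow> TensorObj C X Y \<in> Obj C"
    and tensor_obj_assoc:
      "\<lbrakk>X \<in> Obj C; Y \<in> Obj C; Z \<in> Obj C\<rbrakk>
        \<Longrightarrow> TensorObj C (TensorObj C X Y) Z = TensorObj C X (TensorObj C Y Z)"
    and tensor_obj_unit:
      "X \<in> Obj C \<Longrightarrow> TensorObj C (Unit C) X = X \<and> TensorObj C X (Unit C) = X"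
    and tensor_hom:
      "\<lbrakk>X \<in> Obj C; Y \<in> Obj C; X' \<in> Obj C; Y' \<in> Obj C; f \<in> Hom C X Y; f' \<in> Hom C X' Y'\<rbrakk>
        \<Longrightarrow> TensorMor C f f' \<in> Hom C (TensorObj C X X') (TensorObj C Y Y')"
    and tensor_mor_assoc:
      "\<lbrakk>X \<in> Obj C; Y \<in> Obj C; X' \<in> Obj C; Y' \<in> Obj C; X'' \<in> Obj C; Y'' \<in> Obj C;
        f \<in> Hom C X Y; f' \<in> Hom C X' Y'; f'' \<in> Hom C X'' Y''\<rbrakk>
        \<Longrightarrow> TensorMor C (TensorMor C f f') f'' = TensorMor C f (TensorMor C f' f'')"
    and tensor_mor_unit:
      "\<lbrakk>X \<in> Obj C; Y \<in> Obj C; f \<in> Hom C X Y\<rbrakk>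
        \<Longrightarrow> TensorMor C (Ident C (Unit C)) f = f \<and> TensorMor C f (Ident C (Unit C)) = f"
    and tensor_ident:
      "\<lbrakk>X \<in> Obj C; Y \<in> Obj C\<rbrakk>
        \<Longrightarrow> TensorMor C (Ident C X) (Ident C Y) = Ident C (TensorObj C X Y)"
    and interchange:
      "\<lbrakk>X \<in> Obj C; Y \<in> Obj C; Z \<in> Obj C; X' \<in> Obj C; Y' \<in> Obj C; Z' \<in> Obj C;
        f \<in> Hom C X Y; g \<in> Hom C Y Z; f' \<in> Hom C X' Y'; g' \<in> Hom C Y' Z'\<rbrakk>
        \<Longrightarrow> TensorMor C (Compose C g f) (Compose C g' f')
          = Compose C (TensorMor C g g') (TensorMor C f f')"
    and zero_hom: "\<lbrakk>X \<in> Obj C; Y \<in> Obj C\<rbrakk> \<Longrightarrow> ZeroMor C X Y \<in> Hom C X Y"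
    and add_hom:
      "\<lbrakk>X \<in> Obj C; Y \<in> Obj C; f \<in> Hom C X Y; g \<in> Hom C X Y\<rbrakk> \<Longrightarrow> AddMor C f g \<in> Hom C X Y"
    and scale_hom:
      "\<lbrakk>X \<in> Obj C; Y \<in> Obj C; f \<in> Hom C X Y\<rbrakk> \<Longrightarrow> ScaleMor C a f \<in> Hom C X Y"
    and add_assoc:
      "\<lbrakk>X \<in> Obj C; Y \<in> Obj C; f \<in> Hom C X Y; g \<in> Hom C X Y; h \<in> Hom C X Y\<rbrakk>
        \<Longrightarrow> AddMor C (AddMor C f g) h = AddMor C f (AddMor C g h)"
    and add_commute:
      "\<lbrakk>X \<in> Obj C; Y \<in> Obj C; f \<in> Hom C X Y; g \<in> Hom C X Y\<rbrakk> \<Longrightarrow> AddMor C f g = AddMor C g f"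
    and add_zero:
      "\<lbrakk>X \<in> Obj C; Y \<in> Obj C; f \<in> Hom C X Y\<rbrakk> \<Longrightarrow> AddMor C (ZeroMor C X Y) f = f"
    and add_inverse:
      "\<lbrakk>X \<in> Obj C; Y \<in> Obj C; f \<in> Hom C X Y\<rbrakk>
        \<Longrightarrow> AddMor C (ScaleMor C (- 1) f) f = ZeroMor C X Y"
    and scale_add:
      "\<lbrakk>X \<in> Obj C; Y \<in> Obj C; f \<in> Hom C X Y; g \<in> Hom C X Y\<rbrakk>
        \<Longrightarrow> ScaleMor C a (AddMor C f g) = AddMor C (ScaleMor C a f) (ScaleMor C a g)"
    and add_scale:
      "\<lbrakk>X \<in> Obj C; Y \<in> Obj C; f \<in> Hom C X Y\<rbrakk>
        \<Longrightarrow> ScaleMor C (a + b) f = AddMor C (ScaleMor C a f) (ScaleMor C b f)"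
    and scale_scale:
      "\<lbrakk>X \<in> Obj C; Y \<in> Obj C; f \<in> Hom C X Y\<rbrakk>
        \<Longrightarrow> ScaleMor C a (ScaleMor C b f) = ScaleMor C (a * b) f"
    and scale_one: "\<lbrakk>X \<in> Obj C; Y \<in> Obj C; f \<in> Hom C X Y\<rbrakk> \<Longrightarrow> ScaleMor C 1 f = f"
    and compose_add_left:
      "\<lbrakk>X \<in> Obj C; Y \<in> Obj C; Z \<in> Obj C; f \<in> Hom C X Y; g \<in> Hom C Y Z; h \<in> Hom C Y Z\<rbrakk>
        \<Longrightarrow> Compose C (AddMor C g h) f = AddMor C (Compose C g f) (Compose C h f)"
    and compose_add_right:
      "\<lbrakk>X \<in> Obj C; Y \<in> Obj C; Z \<in> Obj C; f \<in> Hom C X Y; g \<in> Hom C X Y; h \<in> Hom C Y Z\<rbrakk>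
        \<Longrightarrow> Compose C h (AddMor C f g) = AddMor C (Compose C h f) (Compose C h g)"
    and compose_scale:
      "\<lbrakk>X \<in> Obj C; Y \<in> Obj C; Z \<in> Obj C; f \<in> Hom C X Y; g \<in> Hom C Y Z\<rbrakk>
        \<Longrightarrow> Compose C (ScaleMor C a g) f = ScaleMor C a (Compose C g f)
          \<and> Compose C g (ScaleMor C a f) = ScaleMor C a (Compose C g f)"
    and tensor_add_left:
      "\<lbrakk>X \<in> Obj C; Y \<in> Obj C; X' \<in> Obj C; Y' \<in> Obj C;
        f \<in> Hom C X Y; g \<in> Hom C X Y; h \<in> Hom C X' Y'\<rbrakk>
        \<Longrightarrow> TensorMor C (AddMor C f g) h = AddMor C (TensorMor C f h) (TensorMor C g h)"
    and tensor_add_right: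
      "\<lbrakk>X \<in> Obj C; Y \<in> Obj C; X' \<in> Obj C; Y' \<in> Obj C;
        f \<in> Hom C X Y; g \<in> Hom C X' Y'; h \<in> Hom C X' Y'\<rbrakk>
        \<Longrightarrow> TensorMor C f (AddMor C g h) = AddMor C (TensorMor C f g) (TensorMor C f h)"
    and tensor_scale:
      "\<lbrakk>X \<in> Obj C; Y \<in> Obj C; X' \<in> Obj C; Y' \<in> Obj C; f \<in> Hom C X Y; g \<in> Hom C X' Y'\<rbrakk>
        \<Longrightarrow> TensorMor C (ScaleMor C a f) g = ScaleMor C a (TensorMor C f g)
          \<and> TensorMor C f (ScaleMor C a g) = ScaleMor C a (TensorMor C f g)"

text \<open>
  Isomorphism: a strict monoidal linear functor, given by \<open>\<Phi>\<close> on objects and \<open>F\<close> on morphisms,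
  that is bijective on objects and on all Hom-spaces.
\<close>

definition linear_monoidal_isomorphism ::
  "('o, 'm, 'k::field) monoidal_data \<Rightarrow> ('p, 'n, 'k) monoidal_data
    \<Rightarrow> ('o \<Rightarrow> 'p) \<Rightarrow> ('m \<Rightarrow> 'n) \<Rightarrow> bool" where
  "linear_monoidal_isomorphism C D \<Phi> F \<longleftrightarrow>
     bij_betw \<Phi> (Obj C) (Obj D) \<and>
     (\<forall>X\<in>Obj C. \<forall>Y\<in>Obj C. bij_betw F (Hom C X Y) (Hom D (\<Phi> X) (\<Phi> Y))) \<and>
     (\<forall>X\<in>Obj C. F (Ident C X) = Ident D (\<Phi> X)) \<and>
     (\<forall>X\<in>Obj C. \<forall>Y\<in>Obj C. \<forall>Z\<in>Obj C. \<forall>f\<in>Hom C X Y. \<forall>g\<in>Hom C Y Z.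
        F (Compose C g f) = Compose D (F g) (F f)) \<and>
     \<Phi> (Unit C) = Unit D \<and>
     (\<forall>X\<in>Obj C. \<forall>Y\<in>Obj C. \<Phi> (TensorObj C X Y) = TensorObj D (\<Phi> X) (\<Phi> Y)) \<and>
     (\<forall>X\<in>Obj C. \<forall>Y\<in>Obj C. \<forall>X'\<in>Obj C. \<forall>Y'\<in>Obj C. \<forall>f\<in>Hom C X Y. \<forall>f'\<in>Hom C X' Y'.
        F (TensorMor C f f') = TensorMor D (F f) (F f')) \<and>
     (\<forall>X\<in>Obj C. \<forall>Y\<in>Obj C. F (ZeroMor C X Y) = ZeroMor D (\<Phi> X) (\<Phi> Y)) \<and>
     (\<forall>X\<in>Obj C. \<forall>Y\<in>Obj C. \<forall>f\<in>Hom C X Y. \<forall>g\<in>Hom C X Y.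
        F (AddMor C f g) = AddMor D (F f) (F g)) \<and>
     (\<forall>X\<in>Obj C. \<forall>Y\<in>Obj C. \<forall>f\<in>Hom C X Y. \<forall>a. F (ScaleMor C a f) = ScaleMor D a (F f))"

definition linear_monoidal_isomorphic ::
  "('o, 'm, 'k::field) monoidal_data \<Rightarrow> ('p, 'n, 'k) monoidal_data \<Rightarrow> bool" where
  "linear_monoidal_isomorphic C D \<longleftrightarrow>
     linear_monoidal_category C \<and> linear_monoidal_category D \<and>
     (\<exists>\<Phi> F. linear_monoidal_isomorphism C D \<Phi> F)"

definition full_subcategory ::
  "('o, 'm, 'k) monoidal_data \<Rightarrow> 'o set \<Rightarrow> ('o, 'm, 'k) monoidal_data" where
  "full_subcategory C S = C\<lparr>Obj := Obj C \<inter> S\<rparr>"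

fun tensor_power :: "('o, 'm, 'k) monoidal_data \<Rightarrow> 'o \<Rightarrow> nat \<Rightarrow> 'o" where
  "tensor_power C X 0 = Unit C"
| "tensor_power C X (Suc n) = TensorObj C X (tensor_power C X n)"


section \<open>Crystals of $\mathfrak{sl}_2$\<close>

text \<open>
  The formal zero element \<open>0\<close> is \<open>None\<close>. The weight \<open>w \<omega>\<^sub>1\<close> is recorded as the integer \<open>w\<close>.
\<close>

record 'b crystal =
  elems :: "'b set"
  wt :: "'b \<Rightarrow> int"
  e_op :: "'b \<Rightarrow> 'b option"
  f_op :: "'b \<Rightarrow> 'b option"

definition iter_op :: "('b \<Rightarrow> 'b option) \<Rightarrow> nat \<Rightarrow> 'b \<Rightarrow> 'b option" where
  "iter_op h m b = ((\<lambda>x. Option.bind x h) ^^ m) (Some b)"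

definition eps :: "'b crystal \<Rightarrow> 'b \<Rightarrow> nat" where
  "eps B b = Max {m. iter_op (e_op B) m b \<noteq> None}"

definition phi :: "'b crystal \<Rightarrow> 'b \<Rightarrow> nat" where
  "phi B b = Max {m. iter_op (f_op B) m b \<noteq> None}"

text \<open>
  \<open>B(k \<omega>\<^sub>1)\<close>: the element \<open>j\<close> stands for \<open>f\<^sup>j\<close> applied to the highest weight element.
\<close>

definition hw_crystal :: "nat \<Rightarrow> nat crystal" where
  "hw_crystal k =
     \<lparr>elems = {0..k},
      wt = (\<lambda>j. int k - 2 * int j),
      e_op = (\<lambda>j. if 0 < j \<and> j \<le> k then Some (j - 1) else None),
      f_op = (\<lambda>j. if j < k then Some (j + 1) else None)\<rparr>"

definition sum_crystal :: "'b crystal list \<Rightarrow> (nat \<times> 'b) crystal" where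
  "sum_crystal Bs =
     \<lparr>elems = {(i, b). i < length Bs \<and> b \<in> elems (Bs ! i)},
      wt = (\<lambda>(i, b). wt (Bs ! i) b),
      e_op = (\<lambda>(i, b). map_option (Pair i) (e_op (Bs ! i) b)),
      f_op = (\<lambda>(i, b). map_option (Pair i) (f_op (Bs ! i) b))\<rparr>"

definition tensor_crystal :: "'b crystal \<Rightarrow> 'c crystal \<Rightarrow> ('b \<times> 'c) crystal" where
  "tensor_crystal B C =
     \<lparr>elems = elems B \<times> elems C,
      wt = (\<lambda>(b, c). wt B b + wt C c),
      e_op = (\<lambda>(b, c). if phi B b \<ge> eps C c
                       then map_option (\<lambda>b'. (b', c)) (e_op B b)
                       else map_option (\<lambda>c'. (b, c')) (e_op C c)),
      f_op = (\<lambda>(b, c). if phi B b > eps C c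
                       then map_option (\<lambda>b'. (b', c)) (f_op B b)
                       else map_option (\<lambda>c'. (b, c')) (f_op C c))\<rparr>"

text \<open>
  Tensor product of a word of crystals. An iterated tensor
  \<open>b\<^sub>1 \<otimes> (b\<^sub>2 \<otimes> \<dots>)\<close> is written as the list \<open>[b\<^sub>1, b\<^sub>2, \<dots>]\<close>, so that the associativity
  isomorphisms become identities. The empty word gives the one-element crystal, a copy of \<open>B(0)\<close>.
\<close>

fun word_crystal :: "'b crystal list \<Rightarrow> 'b list crystal" where
  "word_crystal [] =
     \<lparr>elems = {[]}, wt = (\<lambda>_. 0), e_op = (\<lambda>_. None), f_op = (\<lambda>_. None)\<rparr>"
| "word_crystal (B # Bs) =
     (let T = tensor_crystal B (word_crystal Bs) in
      \<lparr>elems = (\<lambda>(b, bs). b # bs) ` elems T,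
       wt = (\<lambda>bs. wt T (hd bs, tl bs)),
       e_op = (\<lambda>bs. map_option (\<lambda>(b, bs). b # bs) (e_op T (hd bs, tl bs))),
       f_op = (\<lambda>bs. map_option (\<lambda>(b, bs). b # bs) (f_op T (hd bs, tl bs)))\<rparr>)"

definition strict_morphism :: "'b crystal \<Rightarrow> 'c crystal \<Rightarrow> ('b \<Rightarrow> 'c option) \<Rightarrow> bool" where
  "strict_morphism B C \<psi> \<longleftrightarrow>
     (\<forall>b\<in>elems B.
        (\<forall>c. \<psi> b = Some c \<longrightarrow> c \<in> elems C \<and> wt C c = wt B b) \<and>
        Option.bind (e_op B b) \<psi> = Option.bind (\<psi> b) (e_op C) \<and>
        Option.bind (f_op B b) \<psi> = Option.bind (\<psi> b) (f_op C))"

text \<open>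
  A linear map between the spans of two (finite) crystals is represented by its matrix:
  \<open>M b c\<close> is the coefficient of \<open>c\<close> in the image of \<open>b\<close>, and it is \<open>0\<close> off the crystals.
\<close>

definition crystal_matrix :: "'b crystal \<Rightarrow> ('b \<Rightarrow> 'c option) \<Rightarrow> 'b \<Rightarrow> 'c \<Rightarrow> 'k::field" where
  "crystal_matrix B \<psi> = (\<lambda>b c. if b \<in> elems B \<and> \<psi> b = Some c then 1 else 0)"

definition linear_crystal_maps :: "'b crystal \<Rightarrow> 'c crystal \<Rightarrow> ('b \<Rightarrow> 'c \<Rightarrow> 'k::field) set" where
  "linear_crystal_maps B C =
     {\<lambda>b c. \<Sum>\<psi>\<in>S. a \<psi> * crystal_matrix B \<psi> b c | S a.
        finite S \<and> S \<subseteq> {\<psi>. strict_morphism B C \<psi>}}"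


section \<open>The categories $\mathfrak{sl}_2$-Crys and $\mathrm{SO}_3$-Crys\<close>

text \<open>
  The list \<open>[k\<^sub>1, \<dots>, k\<^sub>r]\<close> stands for the direct sum of the \<open>B(k\<^sub>i \<omega>\<^sub>1)\<close>. Objects of the
  strictification are words of such direct sums; the tensor product is concatenation, and the
  morphisms are those between the tensor products of the words. A morphism carries its domain and
  codomain.
\<close>

type_synonym crys_obj = "nat list list"
type_synonym crys_elem = "(nat \<times> nat) list"
type_synonym 'k crys_mor = "crys_obj \<times> crys_obj \<times> (crys_elem \<Rightarrow> crys_elem \<Rightarrow> 'k)"

definition obj_crystal :: "crys_obj \<Rightarrow> crys_elem crystal" where
  "obj_crystal X = word_crystal (map (\<lambda>ks. sum_crystal (map hw_crystal ks)) X)"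

definition sl2_Crys :: "(crys_obj, 'k::field crys_mor, 'k) monoidal_data" where
  "sl2_Crys =
     \<lparr>Obj = UNIV,
      Hom = (\<lambda>X Y. {(X, Y, M) | M. M \<in> linear_crystal_maps (obj_crystal X) (obj_crystal Y)}),
      Ident = (\<lambda>X. (X, X, \<lambda>b c. if b \<in> elems (obj_crystal X) \<and> c = b then 1 else 0)),
      Compose = (\<lambda>(Y, Z, N) (X, Y', M).
        (X, Z, \<lambda>b d. \<Sum>c\<in>elems (obj_crystal Y). M b c * N c d)),
      Unit = [],
      TensorObj = (@),
      TensorMor = (\<lambda>(X, Y, M) (X', Y', M').
        (X @ X', Y @ Y', \<lambda>b c.
           M (take (length X) b) (take (length Y) c) *
           M' (drop (length X) b) (drop (length Y) c))),
      ZeroMor = (\<lambda>X Y. (X, Y, \<lambda>b c. 0)),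
      AddMor = (\<lambda>(X, Y, M) (X', Y', M'). (X, Y, \<lambda>b c. M b c + M' b c)),
      ScaleMor = (\<lambda>a (X, Y, M). (X, Y, \<lambda>b c. a * M b c))\<rparr>"

definition SO3_Crys :: "(crys_obj, 'k::field crys_mor, 'k) monoidal_data" where
  "SO3_Crys = full_subcategory sl2_Crys
     {X. \<forall>ks\<in>set X. \<forall>k\<in>set ks. odd (card (elems (hw_crystal k)))}"

definition B1 :: crys_obj where
  "B1 = [[2]]"

definition Fund_SO3_Crys :: "(crys_obj, 'k::field crys_mor, 'k) monoidal_data" where
  "Fund_SO3_Crys = full_subcategory SO3_Crys
     (range (tensor_power (SO3_Crys :: (crys_obj, 'k crys_mor, 'k) monoidal_data) B1))"


section \<open>Linear monoidal categories presented by generators and relations\<close>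

text \<open>
  With a single generating object, the objects are the natural numbers (\<open>n\<close> is the \<open>n\<close>-th
  tensor power of the generator). Morphisms are formal expressions in generators of type \<open>'g\<close>,
  whose domains and codomains are given by \<open>gs\<close> and \<open>gt\<close>, modulo the congruence generated by
  the axioms of a strict linear monoidal category and the given relations \<open>R\<close>.
\<close>

datatype ('k, 'g) expr =
  EId nat
| EGen 'g
| EComp "('k, 'g) expr" "('k, 'g) expr" (infixr \<open>\<bullet>\<close> 75)  \<comment> \<open>\<open>g \<bullet> f\<close> is \<open>g\<close> after \<open>f\<close>\<close>
| ETensor "('k, 'g) expr" "('k, 'g) expr" (infixr \<open>\<otimes>\<close> 80)
| EZero nat nat
| EAdd "('k, 'g) expr" "('k, 'g) expr" (infixr \<open>\<oplus>\<close> 65)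
| EScale 'k "('k, 'g) expr"

fun src :: "('g \<Rightarrow> nat) \<Rightarrow> ('k, 'g) expr \<Rightarrow> nat" where
  "src gs (EId n) = n"
| "src gs (EGen x) = gs x"
| "src gs (g \<bullet> f) = src gs f"
| "src gs (f \<otimes> g) = src gs f + src gs g"
| "src gs (EZero m n) = m"
| "src gs (f \<oplus> g) = src gs f"
| "src gs (EScale a f) = src gs f"

fun tgt :: "('g \<Rightarrow> nat) \<Rightarrow> ('k, 'g) expr \<Rightarrow> nat" where
  "tgt gt (EId n) = n"
| "tgt gt (EGen x) = gt x"
| "tgt gt (g \<bullet> f) = tgt gt g"
| "tgt gt (f \<otimes> g) = tgt gt f + tgt gt g"
| "tgt gt (EZero m n) = n"
| "tgt gt (f \<oplus> g) = tgt gt f"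
| "tgt gt (EScale a f) = tgt gt f"

fun wf_expr :: "('g \<Rightarrow> nat) \<Rightarrow> ('g \<Rightarrow> nat) \<Rightarrow> ('k, 'g) expr \<Rightarrow> bool" where
  "wf_expr gs gt (EId n) = True"
| "wf_expr gs gt (EGen x) = True"
| "wf_expr gs gt (g \<bullet> f) = (wf_expr gs gt g \<and> wf_expr gs gt f \<and> src gs g = tgt gt f)"
| "wf_expr gs gt (f \<otimes> g) = (wf_expr gs gt f \<and> wf_expr gs gt g)"
| "wf_expr gs gt (EZero m n) = True"
| "wf_expr gs gt (f \<oplus> g) =
     (wf_expr gs gt f \<and> wf_expr gs gt g \<and> src gs f = src gs g \<and> tgt gt f = tgt gt g)"
| "wf_expr gs gt (EScale a f) = wf_expr gs gt f"

inductive expr_eq ::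
  "('g \<Rightarrow> nat) \<Rightarrow> ('g \<Rightarrow> nat) \<Rightarrow> (('k::field, 'g) expr \<times> ('k, 'g) expr) set
    \<Rightarrow> ('k, 'g) expr \<Rightarrow> ('k, 'g) expr \<Rightarrow> bool"
  for gs gt R where
  relation: "\<lbrakk>(f, g) \<in> R; wf_expr gs gt f; wf_expr gs gt g; src gs f = src gs g; tgt gt f = tgt gt g\<rbrakk>
    \<Longrightarrow> expr_eq gs gt R f g"
| refl: "wf_expr gs gt f \<Longrightarrow> expr_eq gs gt R f f"
| sym: "expr_eq gs gt R f g \<Longrightarrow> expr_eq gs gt R g f"
| trans: "\<lbrakk>expr_eq gs gt R f g; expr_eq gs gt R g h\<rbrakk> \<Longrightarrow> expr_eq gs gt R f h"
| cong_comp: "\<lbrakk>expr_eq gs gt R g g'; expr_eq gs gt R f f'; wf_expr gs gt (g \<bullet> f)\<rbrakk>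
    \<Longrightarrow> expr_eq gs gt R (g \<bullet> f) (g' \<bullet> f')"
| cong_tensor: "\<lbrakk>expr_eq gs gt R f f'; expr_eq gs gt R g g'\<rbrakk>
    \<Longrightarrow> expr_eq gs gt R (f \<otimes> g) (f' \<otimes> g')"
| cong_add: "\<lbrakk>expr_eq gs gt R f f'; expr_eq gs gt R g g'; wf_expr gs gt (f \<oplus> g)\<rbrakk>
    \<Longrightarrow> expr_eq gs gt R (f \<oplus> g) (f' \<oplus> g')"
| cong_scale: "expr_eq gs gt R f f' \<Longrightarrow> expr_eq gs gt R (EScale a f) (EScale a f')"
| comp_assoc: "wf_expr gs gt (h \<bullet> (g \<bullet> f)) \<Longrightarrow> expr_eq gs gt R ((h \<bullet> g) \<bullet> f) (h \<bullet> (g \<bullet> f))"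
| comp_id_left: "wf_expr gs gt f \<Longrightarrow> expr_eq gs gt R (EId (tgt gt f) \<bullet> f) f"
| comp_id_right: "wf_expr gs gt f \<Longrightarrow> expr_eq gs gt R (f \<bullet> EId (src gs f)) f"
| tensor_assoc: "wf_expr gs gt (f \<otimes> (g \<otimes> h))
    \<Longrightarrow> expr_eq gs gt R ((f \<otimes> g) \<otimes> h) (f \<otimes> (g \<otimes> h))"
| tensor_unit_left: "wf_expr gs gt f \<Longrightarrow> expr_eq gs gt R (EId 0 \<otimes> f) f"
| tensor_unit_right: "wf_expr gs gt f \<Longrightarrow> expr_eq gs gt R (f \<otimes> EId 0) f"
| tensor_id: "expr_eq gs gt R (EId m \<otimes> EId n) (EId (m + n))"
| interchange: "\<lbrakk>wf_expr gs gt (g \<bullet> f); wf_expr gs gt (g' \<bullet> f')\<rbrakk>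
    \<Longrightarrow> expr_eq gs gt R ((g \<bullet> f) \<otimes> (g' \<bullet> f')) ((g \<otimes> g') \<bullet> (f \<otimes> f'))"
| add_assoc: "wf_expr gs gt (f \<oplus> (g \<oplus> h)) \<Longrightarrow> expr_eq gs gt R ((f \<oplus> g) \<oplus> h) (f \<oplus> (g \<oplus> h))"
| add_commute: "wf_expr gs gt (f \<oplus> g) \<Longrightarrow> expr_eq gs gt R (f \<oplus> g) (g \<oplus> f)"
| add_zero: "wf_expr gs gt f \<Longrightarrow> expr_eq gs gt R (EZero (src gs f) (tgt gt f) \<oplus> f) f"
| add_inverse: "wf_expr gs gt f
    \<Longrightarrow> expr_eq gs gt R (EScale (- 1) f \<oplus> f) (EZero (src gs f) (tgt gt f))"
| scale_add: "wf_expr gs gt (f \<oplus> g)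
    \<Longrightarrow> expr_eq gs gt R (EScale a (f \<oplus> g)) (EScale a f \<oplus> EScale a g)"
| add_scale: "wf_expr gs gt f
    \<Longrightarrow> expr_eq gs gt R (EScale (a + b) f) (EScale a f \<oplus> EScale b f)"
| scale_scale: "wf_expr gs gt f \<Longrightarrow> expr_eq gs gt R (EScale a (EScale b f)) (EScale (a * b) f)"
| scale_one: "wf_expr gs gt f \<Longrightarrow> expr_eq gs gt R (EScale 1 f) f"
| comp_add_left: "wf_expr gs gt ((g \<oplus> h) \<bullet> f)
    \<Longrightarrow> expr_eq gs gt R ((g \<oplus> h) \<bullet> f) ((g \<bullet> f) \<oplus> (h \<bullet> f))"
| comp_add_right: "wf_expr gs gt (h \<bullet> (f \<oplus> g))
    \<Longrightarrow> expr_eq gs gt R (h \<bullet> (f \<oplus> g)) ((h \<bullet> f) \<oplus> (h \<bullet> g))"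
| comp_scale_left: "wf_expr gs gt (g \<bullet> f)
    \<Longrightarrow> expr_eq gs gt R (EScale a g \<bullet> f) (EScale a (g \<bullet> f))"
| comp_scale_right: "wf_expr gs gt (g \<bullet> f)
    \<Longrightarrow> expr_eq gs gt R (g \<bullet> EScale a f) (EScale a (g \<bullet> f))"
| tensor_add_left: "wf_expr gs gt ((f \<oplus> g) \<otimes> h)
    \<Longrightarrow> expr_eq gs gt R ((f \<oplus> g) \<otimes> h) ((f \<otimes> h) \<oplus> (g \<otimes> h))"
| tensor_add_right: "wf_expr gs gt (f \<otimes> (g \<oplus> h))
    \<Longrightarrow> expr_eq gs gt R (f \<otimes> (g \<oplus> h)) ((f \<otimes> g) \<oplus> (f \<otimes> h))"
| tensor_scale_left: "wf_expr gs gt (f \<otimes> g)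
    \<Longrightarrow> expr_eq gs gt R (EScale a f \<otimes> g) (EScale a (f \<otimes> g))"
| tensor_scale_right: "wf_expr gs gt (f \<otimes> g)
    \<Longrightarrow> expr_eq gs gt R (f \<otimes> EScale a g) (EScale a (f \<otimes> g))"

definition expr_class ::
  "('g \<Rightarrow> nat) \<Rightarrow> ('g \<Rightarrow> nat) \<Rightarrow> (('k::field, 'g) expr \<times> ('k, 'g) expr) set
    \<Rightarrow> ('k, 'g) expr \<Rightarrow> ('k, 'g) expr set" where
  "expr_class gs gt R f = {g. expr_eq gs gt R f g}"

text \<open>
  Operations on classes are unions over all representatives, as usual for quotients; all
  representatives contribute the same class.
\<close>

definition presented_category ::
  "('g \<Rightarrow> nat) \<Rightarrow> ('g \<Rightarrow> nat) \<Rightarrow> (('k::field, 'g) expr \<times> ('k, 'g) expr) set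
    \<Rightarrow> (nat, ('k, 'g) expr set, 'k) monoidal_data" where
  "presented_category gs gt R =
     \<lparr>Obj = UNIV,
      Hom = (\<lambda>m n. {expr_class gs gt R f | f. wf_expr gs gt f \<and> src gs f = m \<and> tgt gt f = n}),
      Ident = (\<lambda>n. expr_class gs gt R (EId n)),
      Compose = (\<lambda>G F. \<Union>g\<in>G. \<Union>f\<in>F. expr_class gs gt R (g \<bullet> f)),
      Unit = 0,
      TensorObj = (+),
      TensorMor = (\<lambda>F G. \<Union>f\<in>F. \<Union>g\<in>G. expr_class gs gt R (f \<otimes> g)),
      ZeroMor = (\<lambda>m n. expr_class gs gt R (EZero m n)),
      AddMor = (\<lambda>F G. \<Union>f\<in>F. \<Union>g\<in>G. expr_class gs gt R (f \<oplus> g)),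
      ScaleMor = (\<lambda>a F. \<Union>f\<in>F. expr_class gs gt R (EScale a f))\<rparr>"


section \<open>The presentation of the fundamental $\mathrm{SO}_3$ category\<close>

datatype so3_gen = Cap | Cup | Merge | Split

fun so3_src :: "so3_gen \<Rightarrow> nat" where
  "so3_src Cap = 2"
| "so3_src Cup = 0"
| "so3_src Merge = 2"
| "so3_src Split = 1"

fun so3_tgt :: "so3_gen \<Rightarrow> nat" where
  "so3_tgt Cap = 0"
| "so3_tgt Cup = 2"
| "so3_tgt Merge = 1"
| "so3_tgt Split = 2"

fun gen_reflect :: "so3_gen \<Rightarrow> so3_gen" where
  "gen_reflect Cap = Cup"
| "gen_reflect Cup = Cap"
| "gen_reflect Merge = Split"
| "gen_reflect Split = Merge"

fun reflect :: "('k, so3_gen) expr \<Rightarrow> ('k, so3_gen) expr" where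
  "reflect (EId n) = EId n"
| "reflect (EGen x) = EGen (gen_reflect x)"
| "reflect (g \<bullet> f) = reflect f \<bullet> reflect g"
| "reflect (f \<otimes> g) = reflect f \<otimes> reflect g"
| "reflect (EZero m n) = EZero n m"
| "reflect (f \<oplus> g) = reflect f \<oplus> reflect g"
| "reflect (EScale a f) = EScale a (reflect f)"

definition so3_base_relations :: "(('k::field, so3_gen) expr \<times> ('k, so3_gen) expr) set" where
  "so3_base_relations =
     (let i = EId 1; c = EGen Cap; u = EGen Cup; m = EGen Merge; s = EGen Split in
      {(c \<bullet> u, EId 0),
       (m \<bullet> s, i),
       ((i \<otimes> m) \<bullet> (s \<otimes> i), (s \<bullet> m) \<oplus> (u \<bullet> c)),
       ((s \<bullet> m) \<oplus> (u \<bullet> c), (m \<otimes> i) \<bullet> (i \<otimes> s)),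
       ((i \<otimes> c) \<bullet> (s \<otimes> i), EZero 2 1),
       (EZero 2 1, (c \<otimes> i) \<bullet> (i \<otimes> s)),
       (c \<bullet> s, EZero 1 0),
       (m \<bullet> (m \<otimes> i), m \<bullet> (i \<otimes> m)),
       (c \<bullet> (i \<otimes> m), c \<bullet> (m \<otimes> i))})"

definition so3_relations :: "(('k::field, so3_gen) expr \<times> ('k, so3_gen) expr) set" where
  "so3_relations =
     so3_base_relations \<union> {(reflect f, reflect g) | f g. (f, g) \<in> so3_base_relations}"

definition SO3_presented :: "(nat, ('k::field, so3_gen) expr set, 'k) monoidal_data" where
  "SO3_presented = presented_category so3_src so3_tgt so3_relations"

end

theory Submission
  imports Defs
begin

text \<open>
  Let \<open>p = id - s m - u c\<close>. The relations imply \<open>m p = 0\<close>, \<open>c p = 0\<close>, \<open>p s = 0\<close>, \<open>p u = 0\<close>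
  and enough commutation to show that the product \<open>P\<^sub>n\<close> of the copies of \<open>p\<close> on adjacent strands
  is killed by every merge and cap from the left and by every split and cup from the right. Moving
  merges and caps past splits and cups then gives \<open>P\<^sub>l f P\<^sub>k = 0\<close> for \<open>k \<noteq> l\<close> and
  \<open>P\<^sub>k f P\<^sub>k = a P\<^sub>k P\<^sub>k\<close> with a scalar \<open>a\<close>, while every identity is a sum of morphisms
  \<open>g P\<^sub>k h\<close>. In crystals \<open>P\<^sub>k\<close> is the projection of \<open>B\<^sub>1\<close> to the power \<open>k\<close> onto its top component
  \<open>B(2k \<omega>\<^sub>1)\<close>. It is nonzero, so the scalars \<open>a\<close>, hence all morphisms, are detected by
  the functor to crystals. As the top components are simple and pairwise nonisomorphic, every
  crystal morphism \<open>P\<^sub>l M P\<^sub>k\<close> is a multiple of some \<open>P\<^sub>k\<close>, hence in the image, and decomposing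
  the identities makes the functor full.
\<close>

section \<open>Strict linear monoidal categories\<close>

text \<open>No basis or dimension count of Hom-spaces occurs: everything reduces to morphisms
  squeezed between two top projections, where a scalar decides. The reduction runs because each
  overlap of a merge or cap with the split or cup just before it is an identity, zero, or
  \<open>lower\<close>, that is \<open>split\<close> after \<open>merge\<close> plus
  \<open>cup\<close> after \<open>cap\<close>; in \<open>lower\<close> the merge and the cap act
  first again. In particular both zigzags of cap and cup vanish, which is a consequence of the
  relations and not one of them, so cap and cup do not form a duality. The factors of
  \<open>proj k\<close> are composed in one fixed order; neither their commutation nor the
  idempotence of \<open>proj k\<close> is derived from the relations, which is why the scalars
  multiply the square of \<open>proj k\<close>. Idempotence is visible only for the matrices, which
  are diagonal with entries 0 and 1. The decomposition of the identities serves twice: expanded on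
  both sides of a morphism it gives injectivity on Hom-spaces, expanded on both sides of a matrix it
  gives surjectivity.\<close>

lemma full_subcategory_simps [simp]:
  "Obj (full_subcategory C S) = Obj C \<inter> S"
  "Hom (full_subcategory C S) = Hom C"
  "Ident (full_subcategory C S) = Ident C"
  "Compose (full_subcategory C S) = Compose C"
  "Unit (full_subcategory C S) = Unit C"
  "TensorObj (full_subcategory C S) = TensorObj C"
  "TensorMor (full_subcategory C S) = TensorMor C"
  "ZeroMor (full_subcategory C S) = ZeroMor C"
  "AddMor (full_subcategory C S) = AddMor C"
  "ScaleMor (full_subcategory C S) = ScaleMor C"
  by (simp_all add: full_subcategory_def)

context linear_monoidal_category
begin

lemma full_subcategory_linear_monoidal:
  assumes "Unit C \<in> S" "\<And>X Y. X \<in> S \<Longrightarrow> Y \<in> S \<Longrightarrow> TensorObj C X Y \<in> S"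
  shows "linear_monoidal_category (full_subcategory C S)"
proof (unfold_locales, goal_cases)
  case 1 then show ?case using hom_disjoint by (simp; metis)
next
  case 4 then show ?case by - (simp, elim conjE, (rule compose_assoc[rotated 4]; assumption))
next
  case 11 then show ?case by - (simp, elim conjE, (rule tensor_mor_assoc[rotated 6]; assumption))
next
  case 14 then show ?case by - (simp, elim conjE, (rule interchange[rotated 6]; assumption))
next
  case 27 then show ?case by - (simp, elim conjE, (rule compose_add_right[rotated 3]; assumption))
qed (auto simp: assms ident_hom compose_hom compose_ident unit_obj tensor_obj tensor_obj_assoc
    tensor_obj_unit tensor_hom tensor_mor_unit tensor_ident zero_hom add_hom scale_hom add_zero
    add_inverse scale_add add_scale scale_scale scale_one compose_add_left compose_scale
    tensor_add_left tensor_add_right tensor_scale intro: add_assoc add_commute)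

end

section \<open>Inverting a strict monoidal linear isomorphism\<close>

lemma linear_monoidal_isomorphismD:
  assumes "linear_monoidal_isomorphism C D \<Phi> F"
  shows "bij_betw \<Phi> (Obj C) (Obj D)"
    and "\<lbrakk>X \<in> Obj C; Y \<in> Obj C\<rbrakk> \<Longrightarrow> bij_betw F (Hom C X Y) (Hom D (\<Phi> X) (\<Phi> Y))"
    and "X \<in> Obj C \<Longrightarrow> F (Ident C X) = Ident D (\<Phi> X)"
    and "\<lbrakk>X \<in> Obj C; Y \<in> Obj C; Z \<in> Obj C; f \<in> Hom C X Y; g \<in> Hom C Y Z\<rbrakk>
      \<Longrightarrow> F (Compose C g f) = Compose D (F g) (F f)"
    and "\<Phi> (Unit C) = Unit D"
    and "\<lbrakk>X \<in> Obj C; Y \<in> Obj C\<rbrakk> \<Longrightarrow> \<Phi> (TensorObj C X Y) = TensorObj D (\<Phi> X) (\<Phi> Y)"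
    and "\<lbrakk>X \<in> Obj C; Y \<in> Obj C; X' \<in> Obj C; Y' \<in> Obj C; f \<in> Hom C X Y; f' \<in> Hom C X' Y'\<rbrakk>
      \<Longrightarrow> F (TensorMor C f f') = TensorMor D (F f) (F f')"
    and "\<lbrakk>X \<in> Obj C; Y \<in> Obj C\<rbrakk> \<Longrightarrow> F (ZeroMor C X Y) = ZeroMor D (\<Phi> X) (\<Phi> Y)"
    and "\<lbrakk>X \<in> Obj C; Y \<in> Obj C; f \<in> Hom C X Y; g \<in> Hom C X Y\<rbrakk>
      \<Longrightarrow> F (AddMor C f g) = AddMor D (F f) (F g)"
    and "\<lbrakk>X \<in> Obj C; Y \<in> Obj C; f \<in> Hom C X Y\<rbrakk>
      \<Longrightarrow> F (ScaleMor C a f) = ScaleMor D a (F f)"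
  using assms by (simp_all add: linear_monoidal_isomorphism_def)

text \<open>The functor is built by evaluating expressions, hence starts at the presented category,
  while the theorem names the crystals first.\<close>

lemma linear_monoidal_isomorphic_sym:
  assumes "linear_monoidal_isomorphic C D"
  shows "linear_monoidal_isomorphic D C"
proof -
  from assms obtain \<Phi> F where lmC: "linear_monoidal_category C" and lmD: "linear_monoidal_category D"
    and iso: "linear_monoidal_isomorphism C D \<Phi> F"
    unfolding linear_monoidal_isomorphic_def by blast
  interpret C: linear_monoidal_category C by (rule lmC)
  interpret D: linear_monoidal_category D by (rule lmD)
  note iso = linear_monoidal_isomorphismD[OF iso]
  define \<Psi> where "\<Psi> = inv_into (Obj C) \<Phi>"
  \<comment> \<open>The choice sees neither domain nor codomain. It is unambiguous because
    Hom-spaces of \<open>D\<close> are disjoint and \<open>\<Phi>\<close> is injective, so all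
    preimages lie in one Hom-space, where \<open>F\<close> is injective.\<close>
  define G where "G g = (SOME f. \<exists>X\<in>Obj C. \<exists>Y\<in>Obj C. f \<in> Hom C X Y \<and> F f = g)" for g
  have \<Psi>: "\<Psi> (\<Phi> X) = X" if "X \<in> Obj C" for X
    using that iso(1) unfolding \<Psi>_def by (simp add: bij_betw_def)
  have F_hom: "F f \<in> Hom D (\<Phi> X) (\<Phi> Y)" if "X \<in> Obj C" "Y \<in> Obj C" "f \<in> Hom C X Y" for X Y f
    using iso(2)[OF that(1,2)] that(3) by (auto simp: bij_betw_def)
  have \<Phi>_Obj: "\<Phi> X \<in> Obj D" if "X \<in> Obj C" for X
    using iso(1) that by (auto simp: bij_betw_def)
  have G: "G (F f) = f" if "X \<in> Obj C" "Y \<in> Obj C" "f \<in> Hom C X Y" for X Y f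
    unfolding G_def
  proof (rule some_equality)
    show "\<exists>X\<in>Obj C. \<exists>Y\<in>Obj C. f \<in> Hom C X Y \<and> F f = F f" using that by blast
    fix f' assume "\<exists>X\<in>Obj C. \<exists>Y\<in>Obj C. f' \<in> Hom C X Y \<and> F f' = F f"
    then obtain X' Y' where X': "X' \<in> Obj C" "Y' \<in> Obj C" "f' \<in> Hom C X' Y'" "F f' = F f" by blast
    have "F f \<in> Hom D (\<Phi> X) (\<Phi> Y)" "F f \<in> Hom D (\<Phi> X') (\<Phi> Y')"
      using F_hom that X' by metis+
    then have "\<Phi> X = \<Phi> X'" "\<Phi> Y = \<Phi> Y'"
      using D.hom_disjoint \<Phi>_Obj that X' by metis+
    then have "X = X'" "Y = Y'"
      using \<Psi> that X' by metis+
    then show "f' = f"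
      using iso(2)[OF that(1,2)] X' that by (auto simp: bij_betw_def inj_on_def)
  qed
  have surj: "\<exists>f\<in>Hom C X Y. F f = g" if "X \<in> Obj C" "Y \<in> Obj C" "g \<in> Hom D (\<Phi> X) (\<Phi> Y)" for X Y g
    using iso(2)[OF that(1,2)] that(3) unfolding bij_betw_def by (metis imageE)
  have \<Psi>_obj: "\<Psi> Y \<in> Obj C" and \<Phi>\<Psi>: "\<Phi> (\<Psi> Y) = Y" if "Y \<in> Obj D" for Y
    using iso(1) that unfolding \<Psi>_def bij_betw_def by (auto intro: inv_into_into f_inv_into_f)
  have G_hom: "G g \<in> Hom C (\<Psi> X) (\<Psi> Y)" and FG: "F (G g) = g"
    if g: "X \<in> Obj D" "Y \<in> Obj D" "g \<in> Hom D X Y" for X Y g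
  proof -
    obtain f where "f \<in> Hom C (\<Psi> X) (\<Psi> Y)" "F f = g"
      using surj[of "\<Psi> X" "\<Psi> Y" g] g \<Psi>_obj \<Phi>\<Psi> by auto
    then show "G g \<in> Hom C (\<Psi> X) (\<Psi> Y)" "F (G g) = g"
      using G[of "\<Psi> X" "\<Psi> Y" f] \<Psi>_obj g by auto
  qed
  have GI: "G g = f" if "f \<in> Hom C (\<Psi> X) (\<Psi> Y)" "F f = g" "X \<in> Obj D" "Y \<in> Obj D" for f g X Y
    using G[of "\<Psi> X" "\<Psi> Y" f] \<Psi>_obj that by auto
  have \<Psi>_tensor: "\<Psi> (TensorObj D X Y) = TensorObj C (\<Psi> X) (\<Psi> Y)" if "X \<in> Obj D" "Y \<in> Obj D" for X Y
    using that iso(6)[of "\<Psi> X" "\<Psi> Y"] \<Psi>[of "TensorObj C (\<Psi> X) (\<Psi> Y)"] \<Psi>_obj \<Phi>\<Psi> C.tensor_obj by simp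
  have "linear_monoidal_isomorphism D C \<Psi> G"
    unfolding linear_monoidal_isomorphism_def
  proof (intro conjI ballI allI, goal_cases)
    case 1 then show ?case unfolding \<Psi>_def by (rule bij_betw_inv_into[OF iso(1)])
  next
    case (2 X Y)
    show ?case
    proof (rule bij_betw_byWitness[where f' = F])
      show "\<forall>f\<in>Hom C (\<Psi> X) (\<Psi> Y). G (F f) = f" using 2 G \<Psi>_obj by blast
      show "F ` Hom C (\<Psi> X) (\<Psi> Y) \<subseteq> Hom D X Y"
        using 2 F_hom[of "\<Psi> X" "\<Psi> Y"] \<Psi>_obj \<Phi>\<Psi> by auto
    qed (use 2 FG G_hom in auto)
  next
    case (3 X) then show ?case
      by (intro GI[of _ X X]) (simp_all add: \<Psi>_obj \<Phi>\<Psi> iso(3) C.ident_hom)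
  next
    case (4 X Y Z f g)
    note h = G_hom[OF 4(1,2,4)] G_hom[OF 4(2,3,5)] \<Psi>_obj[OF 4(1)] \<Psi>_obj[OF 4(2)] \<Psi>_obj[OF 4(3)]
    show ?case
      by (rule GI[OF C.compose_hom[OF h(3-5,1,2)] _ 4(1,3)])
        (simp add: iso(4)[OF h(3-5,1,2)] FG[OF 4(1,2,4)] FG[OF 4(2,3,5)])
  next
    case 5 then show ?case using \<Psi> iso(5) C.unit_obj by metis
  next
    case 6 then show ?case by (rule \<Psi>_tensor)
  next
    case (7 X Y V W f g)
    note h = \<Psi>_obj[OF 7(1)] \<Psi>_obj[OF 7(2)] \<Psi>_obj[OF 7(3)] \<Psi>_obj[OF 7(4)]
      G_hom[OF 7(1,2,5)] G_hom[OF 7(3,4,6)]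
    show ?case
      by (rule GI[of _ "TensorObj D X V" "TensorObj D Y W"])
        (use C.tensor_hom[OF h] 7 in
          \<open>simp_all add: iso(7)[OF h] FG[OF 7(1,2,5)] FG[OF 7(3,4,6)] D.tensor_obj \<Psi>_tensor\<close>)
  next
    case (8 X Y) then show ?case
      by (intro GI[of _ X Y]) (simp_all add: \<Psi>_obj \<Phi>\<Psi> iso(8) C.zero_hom)
  next
    case (9 X Y f g)
    note h = \<Psi>_obj[OF 9(1)] \<Psi>_obj[OF 9(2)] G_hom[OF 9(1,2,3)] G_hom[OF 9(1,2,4)]
    show ?case
      by (rule GI[OF C.add_hom[OF h] _ 9(1,2)]) (simp add: iso(9)[OF h] FG[OF 9(1,2,3)] FG[OF 9(1,2,4)])
  next
    case (10 X Y f a)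
    note h = \<Psi>_obj[OF 10(1)] \<Psi>_obj[OF 10(2)] G_hom[OF 10(1,2,3)]
    show ?case
      by (rule GI[OF C.scale_hom[OF h] _ 10(1,2)]) (simp add: iso(10)[OF h] FG[OF 10(1,2,3)])
  qed
  then show ?thesis using lmC lmD unfolding linear_monoidal_isomorphic_def by blast
qed

section \<open>Presented linear monoidal categories\<close>

lemma expr_eq_typed:
  "expr_eq gs gt R f g \<Longrightarrow> wf_expr gs gt f \<and> wf_expr gs gt g \<and> src gs f = src gs g \<and> tgt gt f = tgt gt g"
  by (induction rule: expr_eq.induct) auto

text \<open>Well-formedness supplies reflexivity: an ill-formed expression is related to nothing,
  itself included, so all of these share the empty class.\<close>

lemma expr_class_eq_iff:
  assumes "wf_expr gs gt f"
  shows "expr_class gs gt R f = expr_class gs gt R g \<longleftrightarrow> expr_eq gs gt R f g"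
  using assms unfolding expr_class_def
  by (auto intro: expr_eq.refl expr_eq.sym expr_eq.trans)

lemma expr_class_eqI: "expr_eq gs gt R f g \<Longrightarrow> expr_class gs gt R f = expr_class gs gt R g"
  unfolding expr_class_def by (auto intro: expr_eq.sym expr_eq.trans)

lemma presented_category_simps [simp]:
  "Obj (presented_category gs gt R) = UNIV"
  "Ident (presented_category gs gt R) n = expr_class gs gt R (EId n)"
  "Unit (presented_category gs gt R) = 0"
  "TensorObj (presented_category gs gt R) m n = m + n"
  "ZeroMor (presented_category gs gt R) m n = expr_class gs gt R (EZero m n)"
  by (simp_all add: presented_category_def)

lemma UN_expr_class:
  assumes "wf_expr gs gt f"
    and "\<And>f'. expr_eq gs gt R f f' \<Longrightarrow> expr_eq gs gt R (h f) (h f')"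
  shows "(\<Union>f'\<in>expr_class gs gt R f. expr_class gs gt R (h f')) = expr_class gs gt R (h f)"
  using assms expr_class_eqI[OF assms(2)] by (auto simp: expr_class_def intro: expr_eq.refl)

lemma presented_category_ops [simp]:
  "wf_expr gs gt (g \<bullet> f) \<Longrightarrow>
    Compose (presented_category gs gt R) (expr_class gs gt R g) (expr_class gs gt R f)
      = expr_class gs gt R (g \<bullet> f)"
  "wf_expr gs gt (f \<otimes> g) \<Longrightarrow>
    TensorMor (presented_category gs gt R) (expr_class gs gt R f) (expr_class gs gt R g)
      = expr_class gs gt R (f \<otimes> g)"
  "wf_expr gs gt (f \<oplus> g) \<Longrightarrow>
    AddMor (presented_category gs gt R) (expr_class gs gt R f) (expr_class gs gt R g)
      = expr_class gs gt R (f \<oplus> g)"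
  "wf_expr gs gt f \<Longrightarrow>
    ScaleMor (presented_category gs gt R) a (expr_class gs gt R f)
      = expr_class gs gt R (EScale a f)"
proof -
  have two: "(\<Union>f'\<in>expr_class gs gt R f. \<Union>g'\<in>expr_class gs gt R g. expr_class gs gt R (h f' g'))
      = expr_class gs gt R (h f g)"
    if "wf_expr gs gt f" "wf_expr gs gt g"
      "\<And>f' g'. expr_eq gs gt R f f' \<Longrightarrow> expr_eq gs gt R g g' \<Longrightarrow> expr_eq gs gt R (h f g) (h f' g')"
    for f g and h :: "('b, 'a) expr \<Rightarrow> ('b, 'a) expr \<Rightarrow> ('b, 'a) expr"
    using that expr_class_eqI[OF that(3)] by (fastforce simp: expr_class_def intro: expr_eq.refl)
  show "wf_expr gs gt (g \<bullet> f) \<Longrightarrow>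
    Compose (presented_category gs gt R) (expr_class gs gt R g) (expr_class gs gt R f)
      = expr_class gs gt R (g \<bullet> f)"
    by (simp add: presented_category_def two expr_eq.cong_comp)
  show "wf_expr gs gt (f \<otimes> g) \<Longrightarrow>
    TensorMor (presented_category gs gt R) (expr_class gs gt R f) (expr_class gs gt R g)
      = expr_class gs gt R (f \<otimes> g)"
    by (simp add: presented_category_def two expr_eq.cong_tensor)
  show "wf_expr gs gt (f \<oplus> g) \<Longrightarrow>
    AddMor (presented_category gs gt R) (expr_class gs gt R f) (expr_class gs gt R g)
      = expr_class gs gt R (f \<oplus> g)"
    by (simp add: presented_category_def two expr_eq.cong_add)
  show "wf_expr gs gt f \<Longrightarrow>
    ScaleMor (presented_category gs gt R) a (expr_class gs gt R f)
      = expr_class gs gt R (EScale a f)"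
    by (simp add: presented_category_def UN_expr_class expr_eq.cong_scale)
qed

lemma presented_category_Hom:
  "Hom (presented_category gs gt R) m n =
     {expr_class gs gt R f | f. wf_expr gs gt f \<and> src gs f = m \<and> tgt gt f = n}"
  by (simp add: presented_category_def)

lemmas expr_eq_axioms = expr_eq.comp_assoc expr_eq.comp_id_left expr_eq.comp_id_right
  expr_eq.tensor_assoc expr_eq.tensor_unit_left expr_eq.tensor_unit_right expr_eq.tensor_id
  expr_eq.interchange expr_eq.add_assoc expr_eq.add_commute expr_eq.add_zero expr_eq.add_inverse
  expr_eq.scale_add expr_eq.add_scale expr_eq.scale_scale expr_eq.scale_one
  expr_eq.comp_add_left expr_eq.comp_add_right expr_eq.comp_scale_left expr_eq.comp_scale_right
  expr_eq.tensor_add_left expr_eq.tensor_add_right expr_eq.tensor_scale_left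
  expr_eq.tensor_scale_right

text \<open>The equational axioms are rules of the congruence; disjointness of Hom-spaces holds
  because the congruence preserves source and target.\<close>

lemma presented_category_linear_monoidal:
  "linear_monoidal_category (presented_category gs gt R)"
proof (unfold_locales, goal_cases)
  case 1 then show ?case
    by (auto simp: presented_category_Hom expr_class_eq_iff dest: expr_eq_typed)
next
  case 2 then show ?case unfolding presented_category_Hom by force
next
  case 3 then show ?case unfolding presented_category_Hom by force
next
  case 10 then show ?case unfolding presented_category_Hom by force
next
  case 15 then show ?case unfolding presented_category_Hom by force
next
  case 16 then show ?case unfolding presented_category_Hom by force
next
  case 17 then show ?case unfolding presented_category_Hom by force
qed (auto simp: presented_category_Hom intro!: expr_class_eqI del: equalityI,
    (rule expr_eq_axioms; simp)+)

section \<open>Evaluating expressions in a linear monoidal category\<close>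

primrec interp ::
  "('o, 'm, 'k::field) monoidal_data \<Rightarrow> 'o \<Rightarrow> ('g \<Rightarrow> 'm) \<Rightarrow> ('g \<Rightarrow> nat) \<Rightarrow> ('g \<Rightarrow> nat)
    \<Rightarrow> ('k, 'g) expr \<Rightarrow> 'm" where
  "interp C X \<gamma> gs gt (EId n) = Ident C (tensor_power C X n)"
| "interp C X \<gamma> gs gt (EGen x) = \<gamma> x"
| "interp C X \<gamma> gs gt (g \<bullet> f) = Compose C (interp C X \<gamma> gs gt g) (interp C X \<gamma> gs gt f)"
| "interp C X \<gamma> gs gt (f \<otimes> g) = TensorMor C (interp C X \<gamma> gs gt f) (interp C X \<gamma> gs gt g)"
| "interp C X \<gamma> gs gt (EZero m n) = ZeroMor C (tensor_power C X m) (tensor_power C X n)"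
| "interp C X \<gamma> gs gt (f \<oplus> g) = AddMor C (interp C X \<gamma> gs gt f) (interp C X \<gamma> gs gt g)"
| "interp C X \<gamma> gs gt (EScale a f) = ScaleMor C a (interp C X \<gamma> gs gt f)"

context linear_monoidal_category
begin

lemma tensor_power_obj: "X \<in> Obj C \<Longrightarrow> tensor_power C X n \<in> Obj C"
  by (induction n) (auto simp: unit_obj tensor_obj)

lemma tensor_power_add:
  "X \<in> Obj C \<Longrightarrow> tensor_power C X (m + n) = TensorObj C (tensor_power C X m) (tensor_power C X n)"
  by (induction m) (auto simp: tensor_obj_unit tensor_obj_assoc tensor_power_obj)

lemma interp_hom:
  assumes X: "X \<in> Obj C"
    and \<gamma>: "\<And>x. \<gamma> x \<in> Hom C (tensor_power C X (gs x)) (tensor_power C X (gt x))"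
  shows "wf_expr gs gt f \<Longrightarrow>
    interp C X \<gamma> gs gt f \<in> Hom C (tensor_power C X (src gs f)) (tensor_power C X (tgt gt f))"
proof (induction f)
  case (EComp g f)
  then show ?case by (auto intro: compose_hom tensor_power_obj X)
qed (auto simp: assms tensor_power_obj tensor_power_add ident_hom tensor_hom zero_hom add_hom
    scale_hom)

text \<open>The universal property of the presentation: images of the generators that satisfy
  \<open>R\<close> induce a map on classes, since all other rules of the congruence hold in any
  strict linear monoidal category.\<close>

lemma interp_cong:
  assumes X: "X \<in> Obj C"
    and \<gamma>: "\<And>x. \<gamma> x \<in> Hom C (tensor_power C X (gs x)) (tensor_power C X (gt x))"
    and R: "\<And>f g. (f, g) \<in> R \<Longrightarrow> interp C X \<gamma> gs gt f = interp C X \<gamma> gs gt g"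
  shows "expr_eq gs gt R f g \<Longrightarrow> interp C X \<gamma> gs gt f = interp C X \<gamma> gs gt g"
  supply obj = tensor_power_obj[OF X]
  supply rules = compose_assoc[OF obj obj obj obj] compose_ident[OF obj obj, THEN conjunct1]
    compose_ident[OF obj obj, THEN conjunct2] tensor_mor_assoc[OF obj obj obj obj obj obj]
    tensor_mor_unit[OF obj obj, THEN conjunct1] tensor_mor_unit[OF obj obj, THEN conjunct2]
    interchange[OF obj obj obj obj obj obj] add_assoc[OF obj obj] add_commute[OF obj obj]
    add_zero[OF obj obj] add_inverse[OF obj obj] scale_add[OF obj obj] add_scale[OF obj obj]
    scale_scale[OF obj obj] scale_one[OF obj obj] compose_add_left[OF obj obj obj]
    compose_add_right[OF obj obj obj] compose_scale[OF obj obj obj, THEN conjunct1]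
    compose_scale[OF obj obj obj, THEN conjunct2] tensor_add_left[OF obj obj obj obj]
    tensor_add_right[OF obj obj obj obj] tensor_scale[OF obj obj obj obj, THEN conjunct1]
    tensor_scale[OF obj obj obj obj, THEN conjunct2]
proof (induction rule: expr_eq.induct)
  case (relation f g) then show ?case using R by blast
qed (auto simp: X tensor_power_add tensor_ident tensor_power_obj dest!: interp_hom[OF X \<gamma>] simp del: tensor_power.simps(2),
    (rule rules, assumption+)+)

end

section \<open>Finite crystals and linear crystal maps\<close>

lemma iter_op_0 [simp]: "iter_op h 0 b = Some b"
  by (simp add: iter_op_def)

lemma iter_op_Suc: "iter_op h (Suc m) b = Option.bind (h b) (iter_op h m)"
proof (cases "h b")
  case None
  have "((\<lambda>x. Option.bind x h) ^^ m) None = None" by (induction m) auto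
  with None show ?thesis by (simp add: iter_op_def funpow_Suc_right del: funpow.simps)
qed (simp add: iter_op_def funpow_Suc_right del: funpow.simps)

lemma iter_op_Suc2: "iter_op h (Suc m) b = Option.bind (iter_op h m b) h"
  by (simp add: iter_op_def)

text \<open>The weight shift of \<open>f\<close> follows from that of \<open>e\<close>, as the two
  are partial inverses. Finiteness and the weight shift together bound all strings, which makes the
  maxima in \<open>eps\<close> and \<open>phi\<close> meaningful.\<close>

locale sl2_crystal =
  fixes B :: "'b crystal"
  assumes finite_elems: "finite (elems B)"
    and e_op_Some: "\<lbrakk>b \<in> elems B; e_op B b = Some b'\<rbrakk>
      \<Longrightarrow> b' \<in> elems B \<and> f_op B b' = Some b \<and> wt B b' = wt B b + 2"
    and f_op_Some: "\<lbrakk>b \<in> elems B; f_op B b = Some b'\<rbrakk> \<Longrightarrow> b' \<in> elems B \<and> e_op B b' = Some b"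

text \<open>Reversing the arrows and negating weights preserves the axioms, so each fact about
  \<open>e\<close> and \<open>eps\<close> yields one about \<open>f\<close> and
  \<open>phi\<close>.\<close>

definition dual_crystal :: "'b crystal \<Rightarrow> 'b crystal" where
  "dual_crystal B = \<lparr>elems = elems B, wt = (\<lambda>b. - wt B b), e_op = f_op B, f_op = e_op B\<rparr>"

lemma dual_crystal_simps [simp]:
  "elems (dual_crystal B) = elems B" "wt (dual_crystal B) = (\<lambda>b. - wt B b)"
  "e_op (dual_crystal B) = f_op B" "f_op (dual_crystal B) = e_op B"
  "eps (dual_crystal B) = phi B" "phi (dual_crystal B) = eps B"
  by (simp_all add: dual_crystal_def eps_def phi_def fun_eq_iff)

context sl2_crystal
begin

lemma sl2_crystal_dual: "sl2_crystal (dual_crystal B)"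
proof
  fix b b' assume "b \<in> elems (dual_crystal B)" "e_op (dual_crystal B) b = Some b'"
  then show "b' \<in> elems (dual_crystal B) \<and> f_op (dual_crystal B) b' = Some b \<and>
      wt (dual_crystal B) b' = wt (dual_crystal B) b + 2"
    using f_op_Some[of b b'] e_op_Some[of b' b] by simp
qed (use finite_elems e_op_Some in auto)

lemma e_op_eq_Some_iff:
  "\<lbrakk>b \<in> elems B; b' \<in> elems B\<rbrakk> \<Longrightarrow> e_op B b = Some b' \<longleftrightarrow> f_op B b' = Some b"
  using e_op_Some f_op_Some by blast

lemma iter_e_op:
  "b \<in> elems B \<Longrightarrow> iter_op (e_op B) m b = Some c \<Longrightarrow> c \<in> elems B \<and> wt B c = wt B b + 2 * int m"
  by (induction m arbitrary: b) (fastforce simp: iter_op_Suc bind_eq_Some_conv dest: e_op_Some)+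

lemma finite_iter_e_op: "b \<in> elems B \<Longrightarrow> finite {m. iter_op (e_op B) m b \<noteq> None}"
proof (rule finite_imageD)
  assume b: "b \<in> elems B"
  show "finite ((\<lambda>m. wt B b + 2 * int m) ` {m. iter_op (e_op B) m b \<noteq> None})"
    by (rule finite_subset[OF _ finite_imageI[OF finite_elems, of "wt B"]])
      (use iter_e_op[OF b] in force)
qed (simp add: inj_on_def)

lemma eps_None:
  assumes "e_op B b = None"
  shows "eps B b = 0"
proof -
  have "iter_op (e_op B) m b \<noteq> None \<longleftrightarrow> m = 0" for m
    using assms by (cases m) (auto simp: iter_op_Suc)
  then show ?thesis by (simp add: eps_def)
qed

lemma eps_Some:
  assumes "b \<in> elems B" "e_op B b = Some b'"
  shows "eps B b = Suc (eps B b')"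
proof -
  let ?M = "\<lambda>b. {m. iter_op (e_op B) m b \<noteq> None}"
  have "iter_op (e_op B) m b \<noteq> None \<longleftrightarrow> m = 0 \<or> m \<in> Suc ` ?M b'" for m
    using assms by (cases m) (auto simp: iter_op_Suc)
  then have "?M b = insert 0 (Suc ` ?M b')" by blast
  moreover have "finite (?M b')" "0 \<in> ?M b'"
    using finite_iter_e_op e_op_Some[OF assms] by auto
  moreover from this have "Max (Suc ` ?M b') = Suc (Max (?M b'))"
    using mono_Max_commute[of Suc "?M b'"] by (fastforce simp: mono_def)
  ultimately have "Max (?M b) = Suc (Max (?M b'))"
    by (metis (no_types, lifting) Max_insert empty_iff finite_imageI image_is_empty max_0L)
  then show ?thesis by (simp add: eps_def)
qed

lemma eps_eq_0_iff: "b \<in> elems B \<Longrightarrow> eps B b = 0 \<longleftrightarrow> e_op B b = None"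
  using eps_None[of b] eps_Some[of b] by (cases "e_op B b") auto

text \<open>This turns a guessed closed formula into \<open>eps\<close> without iterating
  \<open>e\<close>: it only has to vanish at the tops of strings and drop by one along
  \<open>e\<close>.\<close>

lemma eps_unique:
  assumes "\<And>b. \<lbrakk>b \<in> elems B; e_op B b = None\<rbrakk> \<Longrightarrow> \<epsilon> b = 0"
    and "\<And>b b'. \<lbrakk>b \<in> elems B; e_op B b = Some b'\<rbrakk> \<Longrightarrow> \<epsilon> b = Suc (\<epsilon> b')"
    and "b \<in> elems B"
  shows "eps B b = \<epsilon> b"
  using assms(3)
proof (induction "eps B b" arbitrary: b)
  case 0 then show ?case using eps_eq_0_iff assms(1) by metis
next
  case (Suc n)
  then obtain b' where b': "e_op B b = Some b'" using eps_eq_0_iff[of b] by fastforce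
  then show ?case
    using Suc eps_Some[of b b'] assms(2)[of b b'] e_op_Some[of b b'] by auto
qed

lemma iter_e_op_None_iff: "b \<in> elems B \<Longrightarrow> iter_op (e_op B) m b = None \<longleftrightarrow> eps B b < m"
proof (induction m arbitrary: b)
  case (Suc m) then show ?case
    using eps_None[of b] eps_Some[of b] e_op_Some[of b]
    by (cases "e_op B b") (auto simp: iter_op_Suc)
qed simp

end

context sl2_crystal
begin

lemmas phi_None = sl2_crystal.eps_None[OF sl2_crystal_dual, simplified]
  and phi_Some = sl2_crystal.eps_Some[OF sl2_crystal_dual, simplified]
  and phi_unique = sl2_crystal.eps_unique[OF sl2_crystal_dual, simplified]
  and iter_f_op_None_iff = sl2_crystal.iter_e_op_None_iff[OF sl2_crystal_dual, simplified]

lemma phi_e_op: "\<lbrakk>b \<in> elems B; e_op B b = Some b'\<rbrakk> \<Longrightarrow> phi B b' = Suc (phi B b)"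
  using e_op_Some phi_Some by blast

lemma eps_f_op: "\<lbrakk>b \<in> elems B; f_op B b = Some b'\<rbrakk> \<Longrightarrow> eps B b' = Suc (eps B b)"
  using f_op_Some eps_Some by blast

lemma iter_f_op:
  "\<lbrakk>b \<in> elems B; iter_op (f_op B) m b = Some c\<rbrakk> \<Longrightarrow> c \<in> elems B \<and> wt B c = wt B b - 2 * int m"
  using sl2_crystal.iter_e_op[OF sl2_crystal_dual, of b m c] by simp

end

section \<open>Matrices commuting with the Kashiwara operators\<close>

definition opt_entry :: "('b \<Rightarrow> 'c \<Rightarrow> 'k::zero) \<Rightarrow> 'b option \<Rightarrow> 'c option \<Rightarrow> 'k" where
  "opt_entry M x y = (case x of None \<Rightarrow> 0 | Some b \<Rightarrow> (case y of None \<Rightarrow> 0 | Some c \<Rightarrow> M b c))"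

lemma opt_entry_simps [simp]:
  "opt_entry M None y = 0" "opt_entry M x None = 0" "opt_entry M (Some b) (Some c) = M b c"
  by (simp_all add: opt_entry_def split: option.splits)

text \<open>
  Commutation of a matrix with \<open>e\<close> and \<open>f\<close>, read off entrywise: since \<open>e\<close> and \<open>f\<close> are mutually
  inverse partial bijections, the entry of \<open>e M\<close> at \<open>c\<close> is the entry of \<open>M\<close> at \<open>f c\<close>.
\<close>

definition intertwiner :: "'b crystal \<Rightarrow> 'c crystal \<Rightarrow> ('b \<Rightarrow> 'c \<Rightarrow> 'k::field) \<Rightarrow> bool" where
  "intertwiner B C M \<longleftrightarrow>
     (\<forall>b c. M b c \<noteq> 0 \<longrightarrow> b \<in> elems B \<and> c \<in> elems C \<and> wt C c = wt B b) \<and>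
     (\<forall>b\<in>elems B. \<forall>c\<in>elems C.
        opt_entry M (e_op B b) (Some c) = opt_entry M (Some b) (f_op C c) \<and>
        opt_entry M (f_op B b) (Some c) = opt_entry M (Some b) (e_op C c))"

lemma intertwinerD:
  assumes "intertwiner B C M"
  shows "M b c \<noteq> 0 \<Longrightarrow> b \<in> elems B" "M b c \<noteq> 0 \<Longrightarrow> c \<in> elems C" "M b c \<noteq> 0 \<Longrightarrow> wt C c = wt B b"
    "\<lbrakk>b \<in> elems B; c \<in> elems C\<rbrakk> \<Longrightarrow> opt_entry M (e_op B b) (Some c) = opt_entry M (Some b) (f_op C c)"
    "\<lbrakk>b \<in> elems B; c \<in> elems C\<rbrakk> \<Longrightarrow> opt_entry M (f_op B b) (Some c) = opt_entry M (Some b) (e_op C c)"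
  using assms unfolding intertwiner_def by blast+

lemma intertwiner_supp:
  assumes "intertwiner B C M"
  shows "b \<notin> elems B \<Longrightarrow> M b c = 0" "c \<notin> elems C \<Longrightarrow> M b c = 0"
  using intertwinerD[OF assms] by blast+

lemma intertwiner_dual:
  "intertwiner (dual_crystal B) (dual_crystal C) M \<longleftrightarrow> intertwiner B C M"
  unfolding intertwiner_def by auto

text \<open>Transposition exchanges the two commutation conditions. It is the matrix counterpart of
  vertical reflection and yields the cup and the split from the cap and the merge.\<close>

lemma intertwiner_transpose:
  assumes "intertwiner B C M"
  shows "intertwiner C B (\<lambda>c b. M b c)"
proof -
  have "opt_entry (\<lambda>c b. M b c) x y = opt_entry M y x" for x y
    by (simp add: opt_entry_def split: option.splits)
  then show ?thesis using assms unfolding intertwiner_def by auto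
qed

lemma intertwiner_zero: "intertwiner B C (\<lambda>b c. 0)"
  by (simp add: intertwiner_def opt_entry_def split: option.splits)

lemma intertwiner_add:
  assumes "intertwiner B C M" "intertwiner B C N"
  shows "intertwiner B C (\<lambda>b c. M b c + N b c)"
proof -
  have "opt_entry (\<lambda>b c. M b c + N b c) x y = opt_entry M x y + opt_entry N x y" for x y
    by (simp add: opt_entry_def split: option.splits)
  moreover have "M b c \<noteq> 0 \<or> N b c \<noteq> 0" if "M b c + N b c \<noteq> 0" for b c
    using that by auto
  ultimately show ?thesis
    using assms unfolding intertwiner_def by (intro conjI allI ballI) (blast | simp)+
qed

lemma intertwiner_scale:
  assumes "intertwiner B C M"
  shows "intertwiner B C (\<lambda>b c. a * M b c)"
proof -
  have "opt_entry (\<lambda>b c. a * M b c) x y = a * opt_entry M x y" for x y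
    by (simp add: opt_entry_def split: option.splits)
  then show ?thesis using assms unfolding intertwiner_def by auto
qed

lemma intertwiner_sum:
  "(\<And>i. i \<in> I \<Longrightarrow> intertwiner B C (M i)) \<Longrightarrow> intertwiner B C (\<lambda>b c. \<Sum>i\<in>I. M i b c)"
  by (induction I rule: infinite_finite_induct) (auto intro: intertwiner_zero intertwiner_add)

lemma intertwiner_crystal_matrix:
  assumes B: "sl2_crystal B" and C: "sl2_crystal C" and \<psi>: "strict_morphism B C \<psi>"
  shows "intertwiner B C (crystal_matrix B \<psi> :: 'b \<Rightarrow> 'c \<Rightarrow> 'k::field)"
proof -
  let ?M = "crystal_matrix B \<psi> :: 'b \<Rightarrow> 'c \<Rightarrow> 'k"
  interpret B: sl2_crystal B by (rule B)
  interpret C: sl2_crystal C by (rule C)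
  have entry: "opt_entry ?M x y
      = (case y of None \<Rightarrow> 0 | Some c \<Rightarrow> if Option.bind x \<psi> = Some c then 1 else (0::'k))"
    if "\<And>b. x = Some b \<Longrightarrow> b \<in> elems B" for x y
    using that by (auto simp: opt_entry_def crystal_matrix_def split: option.splits)
  have \<psi>_e: "Option.bind (e_op B b) \<psi> = Option.bind (\<psi> b) (e_op C)"
    and \<psi>_f: "Option.bind (f_op B b) \<psi> = Option.bind (\<psi> b) (f_op C)"
    and \<psi>_elems: "\<And>c. \<psi> b = Some c \<Longrightarrow> c \<in> elems C \<and> wt C c = wt B b"
    if "b \<in> elems B" for b
    using \<psi> that unfolding strict_morphism_def by blast+
  show ?thesis
    unfolding intertwiner_def
  proof (intro conjI allI impI ballI)
    fix b c assume "b \<in> elems B" "c \<in> elems C"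
    note bc = this
    have "Option.bind (\<psi> b) (e_op C) = Some c \<longleftrightarrow> (\<exists>c'. f_op C c = Some c' \<and> \<psi> b = Some c')"
      "Option.bind (\<psi> b) (f_op C) = Some c \<longleftrightarrow> (\<exists>c'. e_op C c = Some c' \<and> \<psi> b = Some c')"
      using \<psi>_elems[OF bc(1)] bc(2) C.e_op_Some C.f_op_Some unfolding bind_eq_Some_conv by blast+
    moreover have "opt_entry ?M (e_op B b) (Some c)
        = (if Option.bind (\<psi> b) (e_op C) = Some c then 1 else (0::'k))"
      "opt_entry ?M (f_op B b) (Some c)
        = (if Option.bind (\<psi> b) (f_op C) = Some c then 1 else (0::'k))"
      using B.e_op_Some[OF bc(1)] B.f_op_Some[OF bc(1)] \<psi>_e[OF bc(1)] \<psi>_f[OF bc(1)]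
      by (simp_all add: entry)
    moreover have "opt_entry ?M (Some b) y
        = (case y of None \<Rightarrow> 0 | Some c \<Rightarrow> if \<psi> b = Some c then 1 else (0::'k))" for y
      using bc entry[of "Some b" y] by (simp split: option.splits)
    ultimately show "opt_entry ?M (e_op B b) (Some c)
        = opt_entry ?M (Some b) (f_op C c)"
      "opt_entry ?M (f_op B b) (Some c)
        = opt_entry ?M (Some b) (e_op C c)"
      by (simp_all split: option.splits)
  qed (auto simp: crystal_matrix_def \<psi>_elems split: if_splits)
qed

lemma linear_crystal_maps_intertwiner:
  assumes "sl2_crystal B" "sl2_crystal C" "M \<in> linear_crystal_maps B C"
  shows "intertwiner B C M"
proof -
  obtain S a where M: "M = (\<lambda>b c. \<Sum>\<psi>\<in>S. a \<psi> * crystal_matrix B \<psi> b c)"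
    and S: "S \<subseteq> {\<psi>. strict_morphism B C \<psi>}"
    using assms(3) unfolding linear_crystal_maps_def by blast
  show ?thesis
    unfolding M using S assms
    by (intro intertwiner_sum intertwiner_scale intertwiner_crystal_matrix) auto
qed

text \<open>A nonzero entry is unchanged when both indices are raised by \<open>e\<close>; if only
  one of them could be raised, the entry would have to be zero. Hence the strings above
  \<open>b\<close> and \<open>c\<close> have equal length.\<close>

lemma intertwiner_eps:
  assumes B: "sl2_crystal B" and C: "sl2_crystal C" and M: "intertwiner B C M"
  shows "M b c \<noteq> 0 \<Longrightarrow> eps B b = eps C c"
proof (induction "eps B b" arbitrary: b c)
  interpret B: sl2_crystal B by (rule B)
  interpret C: sl2_crystal C by (rule C)
  note M = intertwinerD[OF M]
  case 0
  note bc = M(1,2)[OF 0(2)]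
  have "e_op C c = None"
  proof (rule ccontr)
    assume "e_op C c \<noteq> None"
    then obtain c' where c': "e_op C c = Some c'" by blast
    then have "opt_entry M (e_op B b) (Some c') = M b c"
      using M(4)[OF bc(1), of c'] C.e_op_Some[OF bc(2) c'] by simp
    then show False using 0 B.eps_eq_0_iff[OF bc(1)] by simp
  qed
  then show ?case using 0 C.eps_None by simp
next
  interpret B: sl2_crystal B by (rule B)
  interpret C: sl2_crystal C by (rule C)
  note M = intertwinerD[OF M]
  case (Suc n)
  note bc = M(1,2)[OF Suc(3)]
  obtain b' where b': "e_op B b = Some b'" using Suc B.eps_None[of b] by fastforce
  have b'2: "b' \<in> elems B" "f_op B b' = Some b" using B.e_op_Some[OF bc(1) b'] by auto
  have "opt_entry M (Some b') (e_op C c) = M b c"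
    using M(5)[OF b'2(1) bc(2)] b'2(2) by simp
  with Suc(3) obtain c' where c': "e_op C c = Some c'" "M b' c' \<noteq> 0"
    by (cases "e_op C c") auto
  then show ?case
    using Suc B.eps_Some[OF bc(1) b'] C.eps_Some[OF bc(2) c'(1)] by auto
qed

lemma intertwiner_phi:
  assumes "sl2_crystal B" "sl2_crystal C" "intertwiner B C M" "M b c \<noteq> 0"
  shows "phi B b = phi C c"
  using intertwiner_eps[of "dual_crystal B" "dual_crystal C" M b c] assms
  by (simp add: intertwiner_dual sl2_crystal.sl2_crystal_dual)

text \<open>The row at \<open>f b'\<close> is the row at \<open>b'\<close> shifted by
  \<open>e\<close>, so the rows at the tops of strings determine the others.\<close>

lemma intertwiner_eqI:
  assumes B: "sl2_crystal B" and M: "intertwiner B C M" and N: "intertwiner B C N"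
    and eq: "\<And>b c. \<lbrakk>b \<in> elems B; c \<in> elems C; e_op B b = None\<rbrakk> \<Longrightarrow> M b c = N b c"
  shows "M = N"
proof -
  interpret B: sl2_crystal B by (rule B)
  have "M b c = N b c" if "b \<in> elems B" for b c
    using that
  proof (induction "eps B b" arbitrary: b c)
    case 0 then show ?case
      using eq[of b c] B.eps_eq_0_iff intertwiner_supp[OF M] intertwiner_supp[OF N] by metis
  next
    case (Suc n)
    then obtain b' where b': "e_op B b = Some b'" using B.eps_None[of b] by fastforce
    then have b'2: "b' \<in> elems B" "f_op B b' = Some b" "n = eps B b'"
      using B.e_op_Some B.eps_Some Suc by fastforce+
    show ?case
    proof (cases "c \<in> elems C")
      case True
      have "M b c = opt_entry M (Some b') (e_op C c)" "N b c = opt_entry N (Some b') (e_op C c)"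
        using intertwinerD(5)[OF M b'2(1) True] intertwinerD(5)[OF N b'2(1) True] b'2 by auto
      then show ?thesis using Suc(1)[OF b'2(3,1)] by (cases "e_op C c") auto
    next
      case False
      then show ?thesis using intertwiner_supp[OF M] intertwiner_supp[OF N] by metis
    qed
  qed
  then have "M b c = N b c" for b c
    using intertwiner_supp[OF M] intertwiner_supp[OF N] by metis
  then show ?thesis by blast
qed

section \<open>Strict morphisms from highest weight elements\<close>

lemma (in sl2_crystal) iter_e_op_top:
  assumes "b \<in> elems B" "iter_op (e_op B) (eps B b) b = Some h"
  shows "h \<in> elems B \<and> e_op B h = None \<and> phi B h = eps B b + phi B b"
  using assms
proof (induction "eps B b" arbitrary: b)
  case 0
  then have "e_op B b = None" "iter_op (e_op B) 0 b = Some h" using eps_eq_0_iff by metis+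
  then show ?case using 0 by simp
next
  case (Suc n)
  then obtain b' where b': "e_op B b = Some b'" using eps_None[of b] by fastforce
  then have "b' \<in> elems B" "f_op B b' = Some b" "n = eps B b'" "eps B b = Suc (eps B b')"
    using e_op_Some eps_Some Suc by fastforce+
  then show ?case
    using Suc b' phi_Some[of b' b] by (auto simp: iter_op_Suc)
qed

text \<open>For a highest weight \<open>h\<close>, the element \<open>f^m h\<close> goes to
  \<open>f^m h'\<close>, and everything outside the component of \<open>h\<close> goes to 0.
  Equality of \<open>phi\<close> makes the two strings end together, so that \<open>f\<close> is
  respected at the bottom as well.\<close>

lemma strict_morphism_highest_weight:
  assumes B: "sl2_crystal B" and C: "sl2_crystal C"
    and h: "h \<in> elems B" and h': "h' \<in> elems C" "e_op C h' = None"
    and phi: "phi C h' = phi B h" and wt: "wt C h' = wt B h"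
  defines "\<psi> \<equiv> \<lambda>b. if iter_op (e_op B) (eps B b) b = Some h then iter_op (f_op C) (eps B b) h' else None"
  shows "strict_morphism B C \<psi>"
proof -
  interpret B: sl2_crystal B by (rule B)
  interpret C: sl2_crystal C by (rule C)
  have top_e: "iter_op (e_op B) (eps B b) b = iter_op (e_op B) (eps B b') b'"
    if "b \<in> elems B" "e_op B b = Some b'" for b b'
    using that B.eps_Some[OF that] by (simp add: iter_op_Suc)
  show ?thesis
    unfolding strict_morphism_def
  proof (intro ballI conjI)
    fix b assume b: "b \<in> elems B"
    show "\<forall>c. \<psi> b = Some c \<longrightarrow> c \<in> elems C \<and> wt C c = wt B b"
      using C.iter_f_op[OF h'(1)] B.iter_e_op[OF b] wt
      by (force simp: \<psi>_def split: if_splits)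
    show "Option.bind (e_op B b) \<psi> = Option.bind (\<psi> b) (e_op C)"
    proof (cases "e_op B b")
      case None
      then show ?thesis using h' B.eps_None[OF None] by (auto simp: \<psi>_def)
    next
      case (Some b')
      note eb = B.eps_Some[OF b Some] top_e[OF b Some]
      show ?thesis
      proof (cases "iter_op (e_op B) (eps B b) b = Some h")
        case True
        have "phi C h' \<ge> eps B b" using B.iter_e_op_top[OF b True] phi by simp
        then have "iter_op (f_op C) (eps B b) h' \<noteq> None"
          using C.iter_f_op_None_iff[OF h'(1)] by auto
        then obtain c c' where c: "iter_op (f_op C) (eps B b') h' = Some c'" "f_op C c' = Some c"
          unfolding eb iter_op_Suc2 by (auto simp: bind_eq_None_conv)
        moreover have "c' \<in> elems C" using C.iter_f_op[OF h'(1) c(1)] by simp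
        ultimately show ?thesis
          using Some True eb C.f_op_Some[of c' c] by (simp add: \<psi>_def iter_op_Suc2)
      qed (use Some eb in \<open>simp add: \<psi>_def\<close>)
    qed
    show "Option.bind (f_op B b) \<psi> = Option.bind (\<psi> b) (f_op C)"
    proof (cases "f_op B b")
      case None
      show ?thesis
      proof (cases "iter_op (e_op B) (eps B b) b = Some h")
        case True
        then have "phi C h' = eps B b"
          using B.iter_e_op_top[OF b True] phi B.phi_None[OF None] by simp
        then have "iter_op (f_op C) (Suc (eps B b)) h' = None"
          using C.iter_f_op_None_iff[OF h'(1)] by auto
        then show ?thesis using None True by (simp add: \<psi>_def iter_op_Suc2)
      qed (use None in \<open>simp add: \<psi>_def\<close>)
    next
      case (Some b')
      note b' = B.f_op_Some[OF b Some]
      have "eps B b' = Suc (eps B b)" "iter_op (e_op B) (eps B b') b' = iter_op (e_op B) (eps B b) b"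
        using B.eps_Some top_e b' by auto
      then show ?thesis using Some by (simp add: \<psi>_def iter_op_Suc2)
    qed
  qed
qed

lemma linear_crystal_maps_zero: "(\<lambda>b c. 0) \<in> linear_crystal_maps B C"
  unfolding linear_crystal_maps_def by (force intro: exI[of _ "{}"])

lemma linear_crystal_maps_add_scaled:
  assumes "M \<in> linear_crystal_maps B C" "strict_morphism B C \<psi>"
  shows "(\<lambda>b c. x * crystal_matrix B \<psi> b c + M b c) \<in> linear_crystal_maps B C"
proof -
  obtain S a where M: "M = (\<lambda>b c. \<Sum>\<psi>\<in>S. a \<psi> * crystal_matrix B \<psi> b c)"
    and S: "finite S" "S \<subseteq> {\<psi>. strict_morphism B C \<psi>}"
    using assms(1) unfolding linear_crystal_maps_def by blast
  \<comment> \<open>\<open>\<psi>\<close> may already lie in \<open>S\<close>, so its new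
    coefficient is added to the old one instead of replacing it.\<close>
  define a' where "a' \<chi> = (if \<chi> = \<psi> then x else 0) + (if \<chi> \<in> S then a \<chi> else 0)" for \<chi>
  have "(\<Sum>\<chi>\<in>insert \<psi> S. a' \<chi> * crystal_matrix B \<chi> b c) = x * crystal_matrix B \<psi> b c + M b c" for b c
  proof -
    have "(\<Sum>\<chi>\<in>insert \<psi> S. a' \<chi> * crystal_matrix B \<chi> b c)
        = (\<Sum>\<chi>\<in>insert \<psi> S. if \<chi> = \<psi> then x * crystal_matrix B \<psi> b c else 0)
          + (\<Sum>\<chi>\<in>insert \<psi> S. if \<chi> \<in> S then a \<chi> * crystal_matrix B \<chi> b c else 0)"
      unfolding sum.distrib[symmetric] a'_def by (intro sum.cong) (auto simp: algebra_simps)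
    also have "\<dots> = x * crystal_matrix B \<psi> b c + (\<Sum>\<chi>\<in>insert \<psi> S \<inter> S. a \<chi> * crystal_matrix B \<chi> b c)"
      using S(1) by (simp add: sum.inter_restrict)
    also have "insert \<psi> S \<inter> S = S" by blast
    finally show ?thesis by (simp add: M)
  qed
  then show ?thesis
    unfolding linear_crystal_maps_def using S assms(2)
    by (intro CollectI exI[of _ "insert \<psi> S"] exI[of _ a']) auto
qed

lemma linear_crystal_maps_sum:
  assumes "finite I" "\<And>i. i \<in> I \<Longrightarrow> strict_morphism B C (\<psi> i)"
  shows "(\<lambda>b c. \<Sum>i\<in>I. x i * crystal_matrix B (\<psi> i) b c) \<in> linear_crystal_maps B C"
  using assms by (induction I) (auto intro: linear_crystal_maps_zero linear_crystal_maps_add_scaled)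

text \<open>
  An intertwiner is determined by its rows at highest weight elements, and each of these rows is
  supported on highest weight elements generating isomorphic components.
\<close>

lemma intertwiner_linear_crystal_maps:
  assumes B: "sl2_crystal B" and C: "sl2_crystal C" and M: "intertwiner B C M"
  shows "M \<in> linear_crystal_maps B C"
proof -
  interpret B: sl2_crystal B by (rule B)
  interpret C: sl2_crystal C by (rule C)
  define I where "I = {(h, h') \<in> elems B \<times> elems C. e_op B h = None \<and> M h h' \<noteq> 0}"
  define \<psi> where "\<psi> = (\<lambda>(h, h') b. if iter_op (e_op B) (eps B b) b = Some h
    then iter_op (f_op C) (eps B b) h' else None)"
  define N where "N b c = (\<Sum>i\<in>I. M (fst i) (snd i) * crystal_matrix B (\<psi> i) b c)" for b c
  have fin: "finite I"
    by (rule finite_subset[of _ "elems B \<times> elems C"]) (auto simp: I_def B.finite_elems C.finite_elems)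
  have strict: "strict_morphism B C (\<psi> i)" if i: "i \<in> I" for i
  proof -
    obtain h h' where i: "i = (h, h')" "h \<in> elems B" "h' \<in> elems C" "e_op B h = None" "M h h' \<noteq> 0"
      using i unfolding I_def by blast
    then have "eps C h' = 0"
      using intertwiner_eps[OF B C M, of h h'] B.eps_None by simp
    then have "e_op C h' = None" using C.eps_eq_0_iff i by blast
    then show ?thesis
      using strict_morphism_highest_weight[OF B C, of h h'] i
        intertwiner_phi[OF B C M, of h h'] intertwinerD(3)[OF M, of h h']
      by (simp add: \<psi>_def)
  qed
  have "N \<in> linear_crystal_maps B C"
    using linear_crystal_maps_sum[OF fin strict, where x = "\<lambda>i. M (fst i) (snd i)"] by (simp add: N_def[abs_def])
  moreover have "M = N"
  proof (rule intertwiner_eqI[OF B M])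
    show "intertwiner B C N"
      by (rule linear_crystal_maps_intertwiner) fact+
    fix b c assume b: "b \<in> elems B" "c \<in> elems C" "e_op B b = None"
    \<comment> \<open>Since \<open>eps B b = 0\<close>, the partial map attached to the pair
      \<open>(h, h')\<close> is defined at \<open>b\<close> only for \<open>h = b\<close>, and then
      its value is \<open>h'\<close>.\<close>
    have "N b c = (\<Sum>i\<in>I. if i = (b, c) then M b c else 0)"
      unfolding N_def using b B.eps_None[of b]
      by (intro sum.cong) (auto simp: crystal_matrix_def \<psi>_def split: if_splits)
    also have "\<dots> = M b c"
      using fin b by (simp add: I_def)
    finally show "M b c = N b c" by simp
  qed
  ultimately show ?thesis by simp
qed

lemma linear_crystal_maps_eq:
  assumes "sl2_crystal B" "sl2_crystal C"
  shows "linear_crystal_maps B C = {M. intertwiner B C M}"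
  using assms intertwiner_linear_crystal_maps linear_crystal_maps_intertwiner by blast

section \<open>Words of crystals\<close>

lemma hw_crystal_sl2: "sl2_crystal (hw_crystal k)"
  by unfold_locales (auto simp: hw_crystal_def split: if_splits)

lemma sum_crystal_sl2:
  assumes "\<And>B. B \<in> set Bs \<Longrightarrow> sl2_crystal B"
  shows "sl2_crystal (sum_crystal Bs)"
proof
  have "elems (sum_crystal Bs) = (\<Union>i<length Bs. Pair i ` elems (Bs ! i))"
    by (auto simp: sum_crystal_def)
  then show "finite (elems (sum_crystal Bs))"
    using sl2_crystal.finite_elems[OF assms[OF nth_mem]] by simp
next
  fix b b' assume "b \<in> elems (sum_crystal Bs)" "e_op (sum_crystal Bs) b = Some b'"
  then show "b' \<in> elems (sum_crystal Bs) \<and> f_op (sum_crystal Bs) b' = Some b \<and>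
      wt (sum_crystal Bs) b' = wt (sum_crystal Bs) b + 2"
    using sl2_crystal.e_op_Some[OF assms[OF nth_mem]] by (fastforce simp: sum_crystal_def)
next
  fix b b' assume "b \<in> elems (sum_crystal Bs)" "f_op (sum_crystal Bs) b = Some b'"
  then show "b' \<in> elems (sum_crystal Bs) \<and> e_op (sum_crystal Bs) b' = Some b"
    using sl2_crystal.f_op_Some[OF assms[OF nth_mem]] by (fastforce simp: sum_crystal_def)
qed

lemma word_crystal_Cons_simps:
  "elems (word_crystal (B # Bs)) = {b # bs | b bs. b \<in> elems B \<and> bs \<in> elems (word_crystal Bs)}"
  "wt (word_crystal (B # Bs)) (b # bs) = wt B b + wt (word_crystal Bs) bs"
  "e_op (word_crystal (B # Bs)) (b # bs) =
     (if phi B b \<ge> eps (word_crystal Bs) bs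
      then map_option (\<lambda>b'. b' # bs) (e_op B b) else map_option (Cons b) (e_op (word_crystal Bs) bs))"
  "f_op (word_crystal (B # Bs)) (b # bs) =
     (if phi B b > eps (word_crystal Bs) bs
      then map_option (\<lambda>b'. b' # bs) (f_op B b) else map_option (Cons b) (f_op (word_crystal Bs) bs))"
  by (auto simp: tensor_crystal_def option.map_comp Let_def o_def)

lemma word_crystal_Nil_simps [simp]:
  "elems (word_crystal []) = {[]}" "wt (word_crystal []) = (\<lambda>_. 0)"
  "e_op (word_crystal []) = (\<lambda>_. None)" "f_op (word_crystal []) = (\<lambda>_. None)"
  by simp_all

declare word_crystal.simps [simp del]
declare word_crystal_Cons_simps(2-4) [simp]

lemma Cons_in_word_crystal [simp]:
  "b # bs \<in> elems (word_crystal (B # Bs)) \<longleftrightarrow> b \<in> elems B \<and> bs \<in> elems (word_crystal Bs)"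
  by (auto simp: word_crystal_Cons_simps)

lemma in_word_crystal_ConsE:
  assumes "x \<in> elems (word_crystal (B # Bs))"
  obtains b bs where "x = b # bs" "b \<in> elems B" "bs \<in> elems (word_crystal Bs)"
  using assms by (auto simp: word_crystal_Cons_simps)

lemma length_word_crystal: "x \<in> elems (word_crystal Bs) \<Longrightarrow> length x = length Bs"
  by (induction Bs arbitrary: x) (auto elim: in_word_crystal_ConsE)

text \<open>Applying \<open>e\<close> to the first factor raises its \<open>phi\<close>, applying it
  to the rest lowers the \<open>eps\<close> there. So the weak test for \<open>e\<close> becomes the
  strict test for \<open>f\<close> at the result, and both operators act on the same factor.\<close>

lemma word_crystal_sl2:
  assumes "\<And>B. B \<in> set Bs \<Longrightarrow> sl2_crystal B"
  shows "sl2_crystal (word_crystal Bs)"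
  using assms
proof (induction Bs)
  case Nil
  show ?case by unfold_locales auto
next
  case (Cons B Bs)
  interpret B: sl2_crystal B by (rule Cons) simp
  interpret W: sl2_crystal "word_crystal Bs" by (rule Cons) (simp add: Cons)
  show ?case
  proof
    have "elems (word_crystal (B # Bs)) = case_prod Cons ` (elems B \<times> elems (word_crystal Bs))"
      by (auto simp: word_crystal_Cons_simps)
    then show "finite (elems (word_crystal (B # Bs)))"
      using B.finite_elems W.finite_elems by simp
  next
    fix x y assume x: "x \<in> elems (word_crystal (B # Bs))" "e_op (word_crystal (B # Bs)) x = Some y"
    from x(1) obtain b bs where "x = b # bs" "b \<in> elems B" "bs \<in> elems (word_crystal Bs)"
      by (rule in_word_crystal_ConsE)
    then show "y \<in> elems (word_crystal (B # Bs)) \<and> f_op (word_crystal (B # Bs)) y = Some x \<and>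
        wt (word_crystal (B # Bs)) y = wt (word_crystal (B # Bs)) x + 2"
      using x(2) B.e_op_Some[of b] W.e_op_Some[of bs] B.phi_Some[of _ b] W.eps_Some[of bs]
      by (fastforce split: if_splits)
  next
    fix x y assume x: "x \<in> elems (word_crystal (B # Bs))" "f_op (word_crystal (B # Bs)) x = Some y"
    from x(1) obtain b bs where "x = b # bs" "b \<in> elems B" "bs \<in> elems (word_crystal Bs)"
      by (rule in_word_crystal_ConsE)
    then show "y \<in> elems (word_crystal (B # Bs)) \<and> e_op (word_crystal (B # Bs)) y = Some x"
      using x(2) B.f_op_Some[of b] W.f_op_Some[of bs] B.phi_Some[of b] W.eps_Some[of _ bs]
      by (fastforce split: if_splits)
  qed
qed

text \<open>The truncated subtraction is the cancellation of the signature rule, where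
  \<open>phi\<close> of the first factor cancels against \<open>eps\<close> of the rest.\<close>

lemma word_crystal_eps_phi_Cons:
  assumes "\<And>B'. B' \<in> set (B # Bs) \<Longrightarrow> sl2_crystal B'"
    and "b \<in> elems B" "bs \<in> elems (word_crystal Bs)"
  shows "eps (word_crystal (B # Bs)) (b # bs) = eps B b + (eps (word_crystal Bs) bs - phi B b)"
    and "phi (word_crystal (B # Bs)) (b # bs)
      = phi (word_crystal Bs) bs + (phi B b - eps (word_crystal Bs) bs)"
proof -
  interpret B: sl2_crystal B by (rule assms) simp
  interpret W: sl2_crystal "word_crystal Bs" by (rule word_crystal_sl2) (simp add: assms)
  interpret BW: sl2_crystal "word_crystal (B # Bs)" by (rule word_crystal_sl2) (rule assms)
  define \<epsilon> where "\<epsilon> x = eps B (hd x) + (eps (word_crystal Bs) (tl x) - phi B (hd x))" for x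
  define \<phi> where "\<phi> x = phi (word_crystal Bs) (tl x) + (phi B (hd x) - eps (word_crystal Bs) (tl x))" for x
  have "eps (word_crystal (B # Bs)) (b # bs) = \<epsilon> (b # bs)"
  proof (rule BW.eps_unique)
    fix x assume "x \<in> elems (word_crystal (B # Bs))" "e_op (word_crystal (B # Bs)) x = None"
    then show "\<epsilon> x = 0"
      by (elim in_word_crystal_ConsE)
        (auto simp: \<epsilon>_def B.eps_None W.eps_None dest: W.eps_None split: if_splits)
  next
    fix x y assume "x \<in> elems (word_crystal (B # Bs))" "e_op (word_crystal (B # Bs)) x = Some y"
    then show "\<epsilon> x = Suc (\<epsilon> y)"
      by (elim in_word_crystal_ConsE)
        (auto simp: \<epsilon>_def B.eps_Some W.eps_Some B.phi_e_op split: if_splits)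
  qed (use assms in simp)
  moreover have "phi (word_crystal (B # Bs)) (b # bs) = \<phi> (b # bs)"
  proof (rule BW.phi_unique)
    fix x assume "x \<in> elems (word_crystal (B # Bs))" "f_op (word_crystal (B # Bs)) x = None"
    then show "\<phi> x = 0"
      by (elim in_word_crystal_ConsE)
        (auto simp: \<phi>_def B.phi_None W.phi_None dest: B.phi_None split: if_splits)
  next
    fix x y assume "x \<in> elems (word_crystal (B # Bs))" "f_op (word_crystal (B # Bs)) x = Some y"
    then show "\<phi> x = Suc (\<phi> y)"
      by (elim in_word_crystal_ConsE)
        (auto simp: \<phi>_def B.phi_Some W.phi_Some W.eps_f_op split: if_splits)
  qed (use assms in simp)
  ultimately show "eps (word_crystal (B # Bs)) (b # bs) = eps B b + (eps (word_crystal Bs) bs - phi B b)"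
    and "phi (word_crystal (B # Bs)) (b # bs)
      = phi (word_crystal Bs) bs + (phi B b - eps (word_crystal Bs) bs)"
    by (simp_all add: \<epsilon>_def \<phi>_def)
qed

lemma elems_word_crystal_append:
  "elems (word_crystal (Bs @ Cs)) =
     {x @ y | x y. x \<in> elems (word_crystal Bs) \<and> y \<in> elems (word_crystal Cs)}"
proof (induction Bs)
  case (Cons B Bs)
  show ?case
    unfolding append_Cons word_crystal_Cons_simps(1)[of B] Cons
    by (auto, metis append_Cons) (metis append_Cons)
qed simp

lemma append_in_word_crystal:
  "length x = length Bs \<Longrightarrow>
    x @ y \<in> elems (word_crystal (Bs @ Cs)) \<longleftrightarrow>
      x \<in> elems (word_crystal Bs) \<and> y \<in> elems (word_crystal Cs)"
  using length_word_crystal[of _ Bs] by (fastforce simp: elems_word_crystal_append)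

text \<open>Associativity of the tensor product of crystals. The five values are proved together
  because the rules for \<open>e\<close> and \<open>f\<close> consult \<open>eps\<close> and
  \<open>phi\<close> of the tail.\<close>

lemma word_crystal_append_ops:
  assumes "\<And>B. B \<in> set Bs \<Longrightarrow> sl2_crystal B" "\<And>C. C \<in> set Cs \<Longrightarrow> sl2_crystal C"
    and "x \<in> elems (word_crystal Bs)" "y \<in> elems (word_crystal Cs)"
  shows "eps (word_crystal (Bs @ Cs)) (x @ y)
      = eps (word_crystal Bs) x + (eps (word_crystal Cs) y - phi (word_crystal Bs) x) \<and>
    phi (word_crystal (Bs @ Cs)) (x @ y)
      = phi (word_crystal Cs) y + (phi (word_crystal Bs) x - eps (word_crystal Cs) y) \<and>
    wt (word_crystal (Bs @ Cs)) (x @ y) = wt (word_crystal Bs) x + wt (word_crystal Cs) y \<and>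
    e_op (word_crystal (Bs @ Cs)) (x @ y) =
     (if phi (word_crystal Bs) x \<ge> eps (word_crystal Cs) y
      then map_option (\<lambda>x'. x' @ y) (e_op (word_crystal Bs) x)
      else map_option ((@) x) (e_op (word_crystal Cs) y)) \<and>
    f_op (word_crystal (Bs @ Cs)) (x @ y) =
     (if phi (word_crystal Bs) x > eps (word_crystal Cs) y
      then map_option (\<lambda>x'. x' @ y) (f_op (word_crystal Bs) x)
      else map_option ((@) x) (f_op (word_crystal Cs) y))"
  using assms(1,3)
proof (induction Bs arbitrary: x)
  case Nil
  interpret N: sl2_crystal "word_crystal [] :: 'a list crystal" by (rule word_crystal_sl2) simp
  interpret C: sl2_crystal "word_crystal Cs" by (rule word_crystal_sl2) (rule assms)
  have *: "map_option ((@) []) z = z" for z :: "'a list option"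
    by (cases z) auto
  show ?case
    using Nil C.eps_None[of y] C.eps_eq_0_iff[OF assms(4)] C.phi_None[of y] * by (auto simp: N.eps_None N.phi_None)
next
  case (Cons B Bs)
  from Cons.prems(2) obtain b bs where x: "x = b # bs" "b \<in> elems B" "bs \<in> elems (word_crystal Bs)"
    by (rule in_word_crystal_ConsE)
  have IH: "eps (word_crystal (Bs @ Cs)) (bs @ y)
      = eps (word_crystal Bs) bs + (eps (word_crystal Cs) y - phi (word_crystal Bs) bs)"
    "phi (word_crystal (Bs @ Cs)) (bs @ y)
      = phi (word_crystal Cs) y + (phi (word_crystal Bs) bs - eps (word_crystal Cs) y)"
    "wt (word_crystal (Bs @ Cs)) (bs @ y) = wt (word_crystal Bs) bs + wt (word_crystal Cs) y"
    "e_op (word_crystal (Bs @ Cs)) (bs @ y) =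
     (if phi (word_crystal Bs) bs \<ge> eps (word_crystal Cs) y
      then map_option (\<lambda>x'. x' @ y) (e_op (word_crystal Bs) bs)
      else map_option ((@) bs) (e_op (word_crystal Cs) y))"
    "f_op (word_crystal (Bs @ Cs)) (bs @ y) =
     (if phi (word_crystal Bs) bs > eps (word_crystal Cs) y
      then map_option (\<lambda>x'. x' @ y) (f_op (word_crystal Bs) bs)
      else map_option ((@) bs) (f_op (word_crystal Cs) y))"
    using Cons.IH[of bs] Cons.prems(1) x(3) by auto
  have mem: "bs @ y \<in> elems (word_crystal (Bs @ Cs))"
    using x assms(4) by (auto simp: elems_word_crystal_append)
  have sl2: "sl2_crystal B'" if "B' \<in> set (B # Bs @ Cs)" for B'
    using that Cons.prems(1) assms(2) by auto
  have eps_phi: "eps (word_crystal (B # Bs)) (b # bs) = eps B b + (eps (word_crystal Bs) bs - phi B b)"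
    "phi (word_crystal (B # Bs)) (b # bs) = phi (word_crystal Bs) bs + (phi B b - eps (word_crystal Bs) bs)"
    by (rule word_crystal_eps_phi_Cons; use x Cons.prems(1) in simp)+
  have eps_phi': "eps (word_crystal (B # Bs @ Cs)) (b # bs @ y)
      = eps B b + (eps (word_crystal (Bs @ Cs)) (bs @ y) - phi B b)"
    "phi (word_crystal (B # Bs @ Cs)) (b # bs @ y)
      = phi (word_crystal (Bs @ Cs)) (bs @ y) + (phi B b - eps (word_crystal (Bs @ Cs)) (bs @ y))"
    by (rule word_crystal_eps_phi_Cons; use x mem sl2 in simp)+
  have append: "(@) (b # bs) = (\<lambda>z. b # bs @ z)" by (simp add: fun_eq_iff)
  have e: "e_op (word_crystal ((B # Bs) @ Cs)) (x @ y) =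
     (if phi (word_crystal (B # Bs)) x \<ge> eps (word_crystal Cs) y
      then map_option (\<lambda>x'. x' @ y) (e_op (word_crystal (B # Bs)) x)
      else map_option ((@) x) (e_op (word_crystal Cs) y))"
    by (cases "eps (word_crystal Cs) y \<le> phi (word_crystal Bs) bs";
        cases "eps (word_crystal Bs) bs \<le> phi B b")
      (simp_all add: x(1) eps_phi eps_phi' IH option.map_comp o_def append,
        (intro conjI impI; rule ccontr; linarith)+)
  have f: "f_op (word_crystal ((B # Bs) @ Cs)) (x @ y) =
     (if phi (word_crystal (B # Bs)) x > eps (word_crystal Cs) y
      then map_option (\<lambda>x'. x' @ y) (f_op (word_crystal (B # Bs)) x)
      else map_option ((@) x) (f_op (word_crystal Cs) y))"
    by (cases "eps (word_crystal Cs) y < phi (word_crystal Bs) bs";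
        cases "eps (word_crystal Bs) bs < phi B b")
      (simp_all add: x(1) eps_phi eps_phi' IH option.map_comp o_def append,
        (intro conjI impI; rule ccontr; linarith)+)
  show ?case
    by (intro conjI e f) (simp_all add: x(1) eps_phi eps_phi' IH)
qed

text \<open>
  The case distinctions of the tensor product rule agree on the two sides because a nonzero entry
  of an intertwiner forces equal values of \<open>eps\<close> and of \<open>phi\<close>.
\<close>

lemma intertwiner_append:
  assumes sl2: "\<And>B. B \<in> set Bs \<union> set Bs' \<union> set Cs \<union> set Cs' \<Longrightarrow> sl2_crystal B"
    and M: "intertwiner (word_crystal Bs) (word_crystal Cs) M"
    and M': "intertwiner (word_crystal Bs') (word_crystal Cs') M'"
  defines "K \<equiv> \<lambda>b c. M (take (length Bs) b) (take (length Cs) c) * M' (drop (length Bs) b) (drop (length Cs) c)"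
  shows "intertwiner (word_crystal (Bs @ Bs')) (word_crystal (Cs @ Cs')) K"
proof -
  let ?B = "word_crystal Bs" and ?B' = "word_crystal Bs'"
    and ?C = "word_crystal Cs" and ?C' = "word_crystal Cs'"
  interpret B: sl2_crystal ?B by (rule word_crystal_sl2) (simp add: sl2)
  interpret B': sl2_crystal ?B' by (rule word_crystal_sl2) (simp add: sl2)
  interpret C: sl2_crystal ?C by (rule word_crystal_sl2) (simp add: sl2)
  interpret C': sl2_crystal ?C' by (rule word_crystal_sl2) (simp add: sl2)
  note eps = intertwiner_eps[OF B.sl2_crystal_axioms C.sl2_crystal_axioms M]
    intertwiner_eps[OF B'.sl2_crystal_axioms C'.sl2_crystal_axioms M']
  note phi = intertwiner_phi[OF B.sl2_crystal_axioms C.sl2_crystal_axioms M]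
    intertwiner_phi[OF B'.sl2_crystal_axioms C'.sl2_crystal_axioms M']
  have K: "K (b @ b') (c @ c') = M b c * M' b' c'" if "b \<in> elems ?B" "c \<in> elems ?C" for b b' c c'
    using that[THEN length_word_crystal] by (simp add: K_def)
  have opsB: "e_op (word_crystal (Bs @ Bs')) (b @ b') = (if phi ?B b \<ge> eps ?B' b'
      then map_option (\<lambda>x'. x' @ b') (e_op ?B b) else map_option ((@) b) (e_op ?B' b'))"
    "f_op (word_crystal (Bs @ Bs')) (b @ b') = (if phi ?B b > eps ?B' b'
      then map_option (\<lambda>x'. x' @ b') (f_op ?B b) else map_option ((@) b) (f_op ?B' b'))"
    "wt (word_crystal (Bs @ Bs')) (b @ b') = wt ?B b + wt ?B' b'"
    if "b \<in> elems ?B" "b' \<in> elems ?B'" for b b'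
    using word_crystal_append_ops[OF _ _ that] sl2 by auto
  have opsC: "e_op (word_crystal (Cs @ Cs')) (c @ c') = (if phi ?C c \<ge> eps ?C' c'
      then map_option (\<lambda>x'. x' @ c') (e_op ?C c) else map_option ((@) c) (e_op ?C' c'))"
    "f_op (word_crystal (Cs @ Cs')) (c @ c') = (if phi ?C c > eps ?C' c'
      then map_option (\<lambda>x'. x' @ c') (f_op ?C c) else map_option ((@) c) (f_op ?C' c'))"
    "wt (word_crystal (Cs @ Cs')) (c @ c') = wt ?C c + wt ?C' c'"
    if "c \<in> elems ?C" "c' \<in> elems ?C'" for c c'
    using word_crystal_append_ops[OF _ _ that] sl2 by auto
  show ?thesis
    unfolding intertwiner_def
  proof (intro conjI allI impI ballI)
    fix b c assume "K b c \<noteq> 0"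
    then have nz: "M (take (length Bs) b) (take (length Cs) c) \<noteq> 0"
      "M' (drop (length Bs) b) (drop (length Cs) c) \<noteq> 0" by (auto simp: K_def)
    note mem = intertwinerD(1-3)[OF M nz(1)] intertwinerD(1-3)[OF M' nz(2)]
    show "b \<in> elems (word_crystal (Bs @ Bs'))" "c \<in> elems (word_crystal (Cs @ Cs'))"
      using append_in_word_crystal[of "take (length Bs) b" Bs "drop (length Bs) b" Bs']
        append_in_word_crystal[of "take (length Cs) c" Cs "drop (length Cs) c" Cs']
        mem mem(1,2)[THEN length_word_crystal] by simp_all
    show "wt (word_crystal (Cs @ Cs')) c = wt (word_crystal (Bs @ Bs')) b"
      using opsB(3)[OF mem(1,4)] opsC(3)[OF mem(2,5)] mem by simp
  next
    fix x y assume "x \<in> elems (word_crystal (Bs @ Bs'))" "y \<in> elems (word_crystal (Cs @ Cs'))"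
    then obtain b b' c c' where x: "x = b @ b'" "b \<in> elems ?B" "b' \<in> elems ?B'"
      and y: "y = c @ c'" "c \<in> elems ?C" "c' \<in> elems ?C'"
      by (auto simp: elems_word_crystal_append)
    note ops = opsB[OF x(2,3)] opsC[OF y(2,3)]
    have entries_b: "opt_entry K (map_option (\<lambda>x'. x' @ b') v) (Some y) = opt_entry M v (Some c) * M' b' c'"
      "opt_entry K (map_option ((@) b) w) (Some y) = M b c * opt_entry M' w (Some c')"
      if "\<And>z. v = Some z \<Longrightarrow> z \<in> elems ?B" for v w
      using x y that by (cases v; cases w; simp add: K)+
    have entries_c: "opt_entry K (Some x) (map_option (\<lambda>x'. x' @ c') v) = opt_entry M (Some b) v * M' b' c'"
      "opt_entry K (Some x) (map_option ((@) c) w) = M b c * opt_entry M' (Some b') w"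
      if "\<And>z. v = Some z \<Longrightarrow> z \<in> elems ?C" for v w
      using x y that by (cases v; cases w; simp add: K)+
    have closed: "e_op ?B b = Some z \<Longrightarrow> z \<in> elems ?B" "f_op ?B b = Some z \<Longrightarrow> z \<in> elems ?B"
      "e_op ?C c = Some v \<Longrightarrow> v \<in> elems ?C" "f_op ?C c = Some v \<Longrightarrow> v \<in> elems ?C" for z v
      using B.e_op_Some[OF x(2)] B.f_op_Some[OF x(2)] C.e_op_Some[OF y(2)] C.f_op_Some[OF y(2)] by blast+
    note entries = entries_b(1)[OF closed(1)] entries_b(1)[OF closed(2)] entries_b(2)[of None, simplified]
      entries_c(1)[OF closed(3)] entries_c(1)[OF closed(4)] entries_c(2)[of None, simplified]
    note eq = intertwinerD(4,5)[OF M x(2) y(2)] intertwinerD(4,5)[OF M' x(3) y(3)]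
    \<comment> \<open>On the source \<open>e\<close> uses the weak test, on the target
      \<open>f\<close> uses the strict one. The shift by one across a nonzero entry reconciles the
      two tests.\<close>
    have shift_e: "phi ?C c = Suc (phi ?B b)" if nz: "opt_entry M (e_op ?B b) (Some c) \<noteq> 0"
    proof -
      obtain z where "e_op ?B b = Some z" "M z c \<noteq> 0"
        using nz by (cases "e_op ?B b") auto
      then show ?thesis using phi(1)[of z c] B.phi_e_op[of b z] x by simp
    qed
    have shift_f: "phi ?B b = Suc (phi ?C c)" if nz: "opt_entry M (f_op ?B b) (Some c) \<noteq> 0"
    proof -
      obtain z where "f_op ?B b = Some z" "M z c \<noteq> 0"
        using nz by (cases "f_op ?B b") auto
      then show ?thesis using phi(1)[of z c] B.phi_Some[of b z] x by simp
    qed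
    have shift_e': "eps ?B' b' = Suc (eps ?C' c')" if nz: "opt_entry M' (e_op ?B' b') (Some c') \<noteq> 0"
    proof -
      obtain z where "e_op ?B' b' = Some z" "M' z c' \<noteq> 0"
        using nz by (cases "e_op ?B' b'") auto
      then show ?thesis using eps(2)[of z c'] B'.eps_Some[of b' z] x by simp
    qed
    have shift_f': "eps ?C' c' = Suc (eps ?B' b')" if nz: "opt_entry M' (f_op ?B' b') (Some c') \<noteq> 0"
    proof -
      obtain z where "f_op ?B' b' = Some z" "M' z c' \<noteq> 0"
        using nz by (cases "f_op ?B' b'") auto
      then show ?thesis using eps(2)[of z c'] B'.eps_f_op[of b' z] x by simp
    qed
    have same: "M b c \<noteq> 0 \<Longrightarrow> phi ?B b = phi ?C c" "M' b' c' \<noteq> 0 \<Longrightarrow> eps ?B' b' = eps ?C' c'"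
      by (fact phi eps)+
    show "opt_entry K (e_op (word_crystal (Bs @ Bs')) x) (Some y)
        = opt_entry K (Some x) (f_op (word_crystal (Cs @ Cs')) y)"
    proof (cases "opt_entry M (e_op ?B b) (Some c) * M' b' c' = 0
        \<and> M b c * opt_entry M' (e_op ?B' b') (Some c') = 0")
      case False
      then have "phi ?B b \<ge> eps ?B' b' \<longleftrightarrow> phi ?C c > eps ?C' c'"
        using shift_e shift_e' same by (metis less_Suc_eq_le mult_eq_0_iff Suc_le_eq)
      then show ?thesis unfolding x(1) y(1) ops
        unfolding x(1)[symmetric] y(1)[symmetric] by (simp add: entries eq)
    next
      \<comment> \<open>Here the tests on the two sides may disagree, but every branch gives
        zero.\<close>
      case True
      then show ?thesis unfolding x(1) y(1) ops
        unfolding x(1)[symmetric] y(1)[symmetric] by (auto simp: entries eq)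
    qed
    show "opt_entry K (f_op (word_crystal (Bs @ Bs')) x) (Some y)
        = opt_entry K (Some x) (e_op (word_crystal (Cs @ Cs')) y)"
    proof (cases "opt_entry M (f_op ?B b) (Some c) * M' b' c' = 0
        \<and> M b c * opt_entry M' (f_op ?B' b') (Some c') = 0")
      case False
      then have "phi ?B b > eps ?B' b' \<longleftrightarrow> phi ?C c \<ge> eps ?C' c'"
        using shift_f shift_f' same by (metis less_Suc_eq_le mult_eq_0_iff Suc_le_eq)
      then show ?thesis unfolding x(1) y(1) ops
        unfolding x(1)[symmetric] y(1)[symmetric] by (simp add: entries eq)
    next
      case True
      then show ?thesis unfolding x(1) y(1) ops
        unfolding x(1)[symmetric] y(1)[symmetric] by (auto simp: entries eq)
    qed
  qed
qed

lemma opt_entry_sum: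
  fixes M :: "'b \<Rightarrow> 'c \<Rightarrow> 'k::semiring_0"
  shows "opt_entry (\<lambda>b d. \<Sum>c\<in>A. M b c * N c d) x y = (\<Sum>c\<in>A. opt_entry M x (Some c) * opt_entry N (Some c) y)"
  by (auto simp: opt_entry_def split: option.splits)

text \<open>Commuting \<open>e\<close> past \<open>M\<close> puts \<open>f c\<close> at the middle
  index. Substituting along the partial bijection \<open>f\<close> turns this into
  \<open>e c\<close> on the side of \<open>N\<close>, where the condition on \<open>N\<close>
  applies.\<close>

lemma intertwiner_compose:
  assumes C: "sl2_crystal C" and M: "intertwiner B C M" and N: "intertwiner C D N"
  shows "intertwiner B D (\<lambda>b d. \<Sum>c\<in>elems C. M b c * N c d)"
proof -
  interpret C: sl2_crystal C by (rule C)
  have reindex: "(\<Sum>c\<in>elems C. opt_entry M x (g c) * opt_entry N (Some c) y)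
      = (\<Sum>c\<in>elems C. opt_entry M x (Some c) * opt_entry N (h c) y)"
    if inv: "\<And>c c'. \<lbrakk>c \<in> elems C; c' \<in> elems C\<rbrakk> \<Longrightarrow> g c = Some c' \<longleftrightarrow> h c' = Some c"
      and closed: "\<And>c c'. c \<in> elems C \<Longrightarrow> g c = Some c' \<Longrightarrow> c' \<in> elems C"
        "\<And>c c'. c \<in> elems C \<Longrightarrow> h c = Some c' \<Longrightarrow> c' \<in> elems C"
    for x y g h
  proof -
    have 1: "opt_entry M x (g c) * opt_entry N (Some c) y
        = (\<Sum>c'\<in>elems C. if g c = Some c' then opt_entry M x (Some c') * opt_entry N (Some c) y else 0)"
      if "c \<in> elems C" for c
      using closed(1)[OF that] by (cases "g c") (auto simp: C.finite_elems)
    have 2: "opt_entry M x (Some c') * opt_entry N (h c') y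
        = (\<Sum>c\<in>elems C. if h c' = Some c then opt_entry M x (Some c') * opt_entry N (Some c) y else 0)"
      if "c' \<in> elems C" for c'
      using closed(2)[OF that] by (cases "h c'") (auto simp: C.finite_elems)
    have "(\<Sum>c\<in>elems C. opt_entry M x (g c) * opt_entry N (Some c) y)
      = (\<Sum>c\<in>elems C. \<Sum>c'\<in>elems C. if g c = Some c' then opt_entry M x (Some c') * opt_entry N (Some c) y else 0)"
      by (rule sum.cong[OF HOL.refl 1])
    also have "\<dots> = (\<Sum>c'\<in>elems C. \<Sum>c\<in>elems C. if g c = Some c' then opt_entry M x (Some c') * opt_entry N (Some c) y else 0)"
      by (rule sum.swap)
    also have "\<dots> = (\<Sum>c'\<in>elems C. \<Sum>c\<in>elems C. if h c' = Some c then opt_entry M x (Some c') * opt_entry N (Some c) y else 0)"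
      by (intro sum.cong HOL.refl if_cong) (simp_all add: inv)
    also have "\<dots> = (\<Sum>c\<in>elems C. opt_entry M x (Some c) * opt_entry N (h c) y)"
      by (rule sum.cong[OF HOL.refl 2[symmetric]])
    finally show ?thesis .
  qed
  note Ms = intertwinerD[OF M] and Ns = intertwinerD[OF N]
  show ?thesis
    unfolding intertwiner_def
  proof (intro conjI allI impI ballI)
    fix b d assume "(\<Sum>c\<in>elems C. M b c * N c d) \<noteq> 0"
    then obtain c where "M b c \<noteq> 0" "N c d \<noteq> 0"
      by (elim sum.not_neutral_contains_not_neutral) auto
    then show "b \<in> elems B" "d \<in> elems D" "wt D d = wt B b"
      using Ms(1-3)[of b c] Ns(1-3)[of c d] by auto
  next
    fix b d assume b: "b \<in> elems B" and d: "d \<in> elems D"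
    have "opt_entry (\<lambda>b d. \<Sum>c\<in>elems C. M b c * N c d) (e_op B b) (Some d)
        = (\<Sum>c\<in>elems C. opt_entry M (Some b) (f_op C c) * opt_entry N (Some c) (Some d))"
      unfolding opt_entry_sum by (intro sum.cong HOL.refl arg_cong2[where f = "(*)"] Ms(4)[OF b])
    also have "\<dots> = (\<Sum>c\<in>elems C. opt_entry M (Some b) (Some c) * opt_entry N (e_op C c) (Some d))"
      by (rule reindex) (use C.e_op_eq_Some_iff C.e_op_Some C.f_op_Some in blast)+
    also have "\<dots> = opt_entry (\<lambda>b d. \<Sum>c\<in>elems C. M b c * N c d) (Some b) (f_op D d)"
      unfolding opt_entry_sum by (intro sum.cong HOL.refl arg_cong2[where f = "(*)"] Ns(4)[OF _ d])
    finally show "opt_entry (\<lambda>b d. \<Sum>c\<in>elems C. M b c * N c d) (e_op B b) (Some d)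
        = opt_entry (\<lambda>b d. \<Sum>c\<in>elems C. M b c * N c d) (Some b) (f_op D d)" .
    have "opt_entry (\<lambda>b d. \<Sum>c\<in>elems C. M b c * N c d) (f_op B b) (Some d)
        = (\<Sum>c\<in>elems C. opt_entry M (Some b) (e_op C c) * opt_entry N (Some c) (Some d))"
      unfolding opt_entry_sum by (intro sum.cong HOL.refl arg_cong2[where f = "(*)"] Ms(5)[OF b])
    also have "\<dots> = (\<Sum>c\<in>elems C. opt_entry M (Some b) (Some c) * opt_entry N (f_op C c) (Some d))"
      by (rule reindex) (use C.e_op_eq_Some_iff C.e_op_Some C.f_op_Some in blast)+
    also have "\<dots> = opt_entry (\<lambda>b d. \<Sum>c\<in>elems C. M b c * N c d) (Some b) (e_op D d)"
      unfolding opt_entry_sum by (intro sum.cong HOL.refl arg_cong2[where f = "(*)"] Ns(5)[OF _ d])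
    finally show "opt_entry (\<lambda>b d. \<Sum>c\<in>elems C. M b c * N c d) (f_op B b) (Some d)
        = opt_entry (\<lambda>b d. \<Sum>c\<in>elems C. M b c * N c d) (Some b) (e_op D d)" .
  qed
qed

lemma intertwiner_ident:
  assumes "sl2_crystal B"
  shows "intertwiner B B (\<lambda>b c. if b \<in> elems B \<and> c = b then 1 else (0::'k::field))"
proof -
  have "crystal_matrix B Some = (\<lambda>b c. if b \<in> elems B \<and> c = b then 1 else (0::'k))"
    by (auto simp: crystal_matrix_def fun_eq_iff)
  moreover have "strict_morphism B B Some"
    by (auto simp: strict_morphism_def)
  then have "intertwiner B B (crystal_matrix B Some :: _ \<Rightarrow> _ \<Rightarrow> 'k)"
    by (intro intertwiner_crystal_matrix assms)
  ultimately show ?thesis by simp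
qed

section \<open>The category $\mathfrak{sl}_2$-Crys\<close>

lemma sl2_Crys_simps [simp]:
  "Obj sl2_Crys = UNIV"
  "Ident sl2_Crys X = (X, X, \<lambda>b c. if b \<in> elems (obj_crystal X) \<and> c = b then 1 else 0)"
  "Compose sl2_Crys (Y, Z, N) (X, Y', M)
    = (X, Z, \<lambda>b d. \<Sum>c\<in>elems (obj_crystal Y). M b c * N c d)"
  "Unit sl2_Crys = []"
  "TensorObj sl2_Crys X Y = X @ Y"
  "TensorMor sl2_Crys (X, Y, M) (X', Y', M') =
    (X @ X', Y @ Y', \<lambda>b c. M (take (length X) b) (take (length Y) c) *
      M' (drop (length X) b) (drop (length Y) c))"
  "ZeroMor sl2_Crys X Y = (X, Y, \<lambda>b c. 0)"
  "AddMor sl2_Crys (X, Y, M) (X', Y', M') = (X, Y, \<lambda>b c. M b c + M' b c)"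
  "ScaleMor sl2_Crys a (X, Y, M) = (X, Y, \<lambda>b c. a * M b c)"
  by (simp_all add: sl2_Crys_def)

lemma obj_crystal_words:
  "B \<in> set (map (\<lambda>ks. sum_crystal (map hw_crystal ks)) X) \<Longrightarrow> sl2_crystal B"
  by (auto intro!: sum_crystal_sl2 hw_crystal_sl2)

lemma obj_crystal_sl2: "sl2_crystal (obj_crystal X)"
  unfolding obj_crystal_def by (rule word_crystal_sl2) (rule obj_crystal_words)

lemma finite_obj_crystal [simp]: "finite (elems (obj_crystal X))"
  by (rule sl2_crystal.finite_elems[OF obj_crystal_sl2])

lemma sl2_Crys_Hom:
  "Hom sl2_Crys X Y = {(X, Y, M) | M. intertwiner (obj_crystal X) (obj_crystal Y) M}"
  by (simp add: sl2_Crys_def linear_crystal_maps_eq obj_crystal_sl2)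

lemma length_obj_crystal: "x \<in> elems (obj_crystal X) \<Longrightarrow> length x = length X"
  using length_word_crystal unfolding obj_crystal_def by fastforce

lemma elems_obj_crystal_append:
  "elems (obj_crystal (X @ Y)) = (\<lambda>(x, y). x @ y) ` (elems (obj_crystal X) \<times> elems (obj_crystal Y))"
  unfolding obj_crystal_def map_append elems_word_crystal_append by auto

lemma append_in_obj_crystal:
  "length x = length X \<Longrightarrow>
    x @ y \<in> elems (obj_crystal (X @ Y)) \<longleftrightarrow> x \<in> elems (obj_crystal X) \<and> y \<in> elems (obj_crystal Y)"
  unfolding obj_crystal_def map_append by (rule append_in_word_crystal) simp

lemma in_obj_crystal_append:
  "b \<in> elems (obj_crystal (X @ Y)) \<longleftrightarrow>
    take (length X) b \<in> elems (obj_crystal X) \<and> drop (length X) b \<in> elems (obj_crystal Y)"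
  by (cases "length b \<ge> length X")
    (use append_in_obj_crystal[of "take (length X) b" X "drop (length X) b" Y] length_obj_crystal in
      \<open>fastforce simp: elems_obj_crystal_append\<close>)+

lemma sum_obj_crystal_append:
  "(\<Sum>c\<in>elems (obj_crystal (X @ Y)). g (take (length X) c) * h (drop (length X) c))
    = (\<Sum>x\<in>elems (obj_crystal X). g x) * (\<Sum>y\<in>elems (obj_crystal Y). h y :: 'k::field)"
proof -
  have "inj_on (\<lambda>(x, y). x @ y) (elems (obj_crystal X) \<times> elems (obj_crystal Y))"
    by (auto simp: inj_on_def dest!: length_obj_crystal)
  then show ?thesis
    unfolding elems_obj_crystal_append
    by (auto simp: sum.reindex sum_product sum.cartesian_product split_def length_obj_crystal
        intro!: sum.cong)
qed

lemma intertwiner_tensor: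
  assumes "intertwiner (obj_crystal X) (obj_crystal Y) M" "intertwiner (obj_crystal X') (obj_crystal Y') M'"
  shows "intertwiner (obj_crystal (X @ X')) (obj_crystal (Y @ Y'))
    (\<lambda>b c. M (take (length X) b) (take (length Y) c) * M' (drop (length X) b) (drop (length Y) c))"
proof -
  let ?w = "map (\<lambda>ks. sum_crystal (map hw_crystal ks))"
  have "sl2_crystal B" if "B \<in> set (?w X) \<union> set (?w X') \<union> set (?w Y) \<union> set (?w Y')" for B
    using that obj_crystal_words by blast
  from intertwiner_append[OF this assms[unfolded obj_crystal_def]]
  show ?thesis by (simp add: obj_crystal_def)
qed

lemma sl2_Crys_linear_monoidal:
  "linear_monoidal_category (sl2_Crys :: (crys_obj, 'k::field crys_mor, 'k) monoidal_data)"
proof (unfold_locales, goal_cases)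
  case 3 then show ?case
    by (auto simp: sl2_Crys_Hom intro: intertwiner_compose[OF obj_crystal_sl2])
next
  case 4 then show ?case
    by (auto simp: sl2_Crys_Hom fun_eq_iff sum_distrib_left sum_distrib_right mult.assoc intro: sum.swap)
next
  case (5 X Y f)
  then obtain M where M: "f = (X, Y, M)" "intertwiner (obj_crystal X) (obj_crystal Y) M"
    by (auto simp: sl2_Crys_Hom)
  have "(\<Sum>c\<in>elems (obj_crystal Y). M b c * (if c \<in> elems (obj_crystal Y) \<and> d = c then 1 else 0)) = M b d" for b d
  proof -
    have "(\<Sum>c\<in>elems (obj_crystal Y). M b c * (if c \<in> elems (obj_crystal Y) \<and> d = c then 1 else 0))
        = (\<Sum>c\<in>elems (obj_crystal Y). if d = c then M b c else 0)"
      by (intro sum.cong) auto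
    then show ?thesis using intertwiner_supp(2)[OF M(2), of d b] by simp
  qed
  moreover have "(\<Sum>c\<in>elems (obj_crystal X). (if b \<in> elems (obj_crystal X) \<and> c = b then 1 else 0) * M c d) = M b d" for b d
  proof -
    have "(\<Sum>c\<in>elems (obj_crystal X). (if b \<in> elems (obj_crystal X) \<and> c = b then 1 else 0) * M c d)
        = (\<Sum>c\<in>elems (obj_crystal X). if c = b then M c d else 0)"
      by (intro sum.cong) auto
    then show ?thesis using intertwiner_supp(1)[OF M(2), of b d] by simp
  qed
  ultimately show ?case by (simp add: M)
next
  case 10 then show ?case
    by (auto simp: sl2_Crys_Hom intro: intertwiner_tensor)
next
  case 11 then show ?case
    by (auto simp: sl2_Crys_Hom fun_eq_iff min_def drop_take add.commute mult.assoc)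
next
  case (12 X Y f)
  then obtain M where M: "f = (X, Y, M)" "intertwiner (obj_crystal X) (obj_crystal Y) M"
    by (auto simp: sl2_Crys_Hom)
  have "M (take (length X) b) (take (length Y) c)
      * (if drop (length X) b \<in> elems (obj_crystal []) \<and> drop (length Y) c = drop (length X) b then 1 else 0)
      = M b c" for b c
  proof (cases "length b \<le> length X \<and> length c \<le> length Y")
    \<comment> \<open>A word is too long, so one of the remainders is nonempty and the unit factor
      is zero; \<open>M\<close> agrees because it vanishes off the crystals.\<close>
    case False
    then have "M b c = 0"
      using intertwiner_supp[OF M(2)] length_obj_crystal by (metis order_refl)
    then show ?thesis using False by (auto simp: obj_crystal_def)
  qed (simp add: obj_crystal_def)
  then show ?case by (simp add: M fun_eq_iff) (simp add: obj_crystal_def)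
next
  case (13 X Y)
  have "(take (length X) c = take (length X) b \<and> drop (length X) c = drop (length X) b) \<longleftrightarrow> c = b"
    for b c :: crys_elem
    by (metis append_take_drop_id)
  then show ?case by (auto simp: fun_eq_iff in_obj_crystal_append)
next
  case (14 X Y Z X' Y' Z' f g f' g')
  then obtain M N M' N' where "f = (X, Y, M)" "g = (Y, Z, N)" "f' = (X', Y', M')" "g' = (Y', Z', N')"
    by (auto simp: sl2_Crys_Hom)
  then show ?case
    by (simp add: fun_eq_iff sum_obj_crystal_append[symmetric] mult.assoc mult.left_commute)
next
  case 18 then show ?case by (auto simp: sl2_Crys_Hom add.assoc)
next
  case 19 then show ?case by (auto simp: sl2_Crys_Hom add.commute)
next
  case 22 then show ?case by (auto simp: sl2_Crys_Hom distrib_left)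
next
  case 23 then show ?case by (auto simp: sl2_Crys_Hom distrib_right)
next
  case 24 then show ?case by (auto simp: sl2_Crys_Hom mult.assoc)
next
  case 26 then show ?case by (auto simp: sl2_Crys_Hom distrib_left sum.distrib)
next
  case 27 then show ?case by (auto simp: sl2_Crys_Hom distrib_right sum.distrib)
next
  case 28 then show ?case by (auto simp: sl2_Crys_Hom sum_distrib_left mult.assoc mult.left_commute)
next
  case 29 then show ?case by (auto simp: sl2_Crys_Hom distrib_right)
next
  case 30 then show ?case by (auto simp: sl2_Crys_Hom distrib_left)
next
  case 31 then show ?case by (auto simp: sl2_Crys_Hom mult.assoc mult.left_commute)
qed (auto simp: sl2_Crys_Hom intertwiner_ident obj_crystal_sl2 intertwiner_zero intertwiner_add
   intertwiner_scale)

section \<open>The morphisms of the presented category\<close>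

abbreviation so3_wf :: "('k, so3_gen) expr \<Rightarrow> bool" where
  "so3_wf \<equiv> wf_expr so3_src so3_tgt"

abbreviation so3_eq :: "('k::field, so3_gen) expr \<Rightarrow> ('k, so3_gen) expr \<Rightarrow> bool" where
  "so3_eq \<equiv> expr_eq so3_src so3_tgt so3_relations"

text \<open>
  Ill-formed expressions with the same source and target are identified with each other, so that
  the operations are total and most category axioms hold without side conditions.
\<close>

definition so3_equiv :: "('k::field, so3_gen) expr \<Rightarrow> ('k, so3_gen) expr \<Rightarrow> bool" where
  "so3_equiv f g \<longleftrightarrow> src so3_src f = src so3_src g \<and> tgt so3_tgt f = tgt so3_tgt g \<and>
     (so3_eq f g \<or> \<not> so3_wf f \<and> \<not> so3_wf g)"

lemma so3_equiv_wf: "so3_equiv f g \<Longrightarrow> so3_wf f \<longleftrightarrow> so3_wf g"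
  unfolding so3_equiv_def using expr_eq_typed by blast

lemma so3_equiv_iff: "so3_wf f \<Longrightarrow> so3_equiv f g \<longleftrightarrow> so3_eq f g"
  unfolding so3_equiv_def using expr_eq_typed by blast

lemma so3_equiv_alt:
  "so3_equiv f g \<longleftrightarrow> src so3_src f = src so3_src g \<and> tgt so3_tgt f = tgt so3_tgt g \<and>
     (so3_wf f \<longleftrightarrow> so3_wf g) \<and> (so3_wf f \<longrightarrow> so3_eq f g)"
  unfolding so3_equiv_def using expr_eq_typed by blast

lemma so3_equivI:
  "\<lbrakk>so3_wf f \<Longrightarrow> so3_wf g \<Longrightarrow> so3_eq f g; so3_wf f \<longleftrightarrow> so3_wf g;
    src so3_src f = src so3_src g; tgt so3_tgt f = tgt so3_tgt g\<rbrakk> \<Longrightarrow> so3_equiv f g"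
  unfolding so3_equiv_def by blast

quotient_type (overloaded) 'k mor = "('k::field, so3_gen) expr" / so3_equiv
proof (rule equivpI)
  show "reflp so3_equiv" by (auto simp: reflp_def intro: so3_equivI expr_eq.refl)
  show "symp so3_equiv" by (auto simp: symp_def so3_equiv_def intro: expr_eq.sym)
  show "transp so3_equiv"
    by (rule transpI) (unfold so3_equiv_def, metis expr_eq.trans expr_eq_typed)
qed

lift_definition Dom :: "'k::field mor \<Rightarrow> nat" is "src so3_src" by (simp add: so3_equiv_def)
lift_definition Cod :: "'k::field mor \<Rightarrow> nat" is "tgt so3_tgt" by (simp add: so3_equiv_def)
lift_definition ok :: "'k::field mor \<Rightarrow> bool" is "so3_wf" by (rule so3_equiv_wf)
lift_definition Idm :: "nat \<Rightarrow> 'k::field mor" is EId .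
lift_definition Gen :: "so3_gen \<Rightarrow> 'k::field mor" is EGen .
lift_definition mcomp :: "'k::field mor \<Rightarrow> 'k mor \<Rightarrow> 'k mor" (infixr "\<cdot>" 75) is EComp
  by (auto simp: so3_equiv_alt intro: expr_eq.cong_comp)
lift_definition mtens :: "'k::field mor \<Rightarrow> 'k mor \<Rightarrow> 'k mor" (infixr "\<odot>" 80) is ETensor
  by (auto simp: so3_equiv_alt intro: expr_eq.cong_tensor)
lift_definition Zero :: "nat \<Rightarrow> nat \<Rightarrow> 'k::field mor" is EZero .
lift_definition madd :: "'k::field mor \<Rightarrow> 'k mor \<Rightarrow> 'k mor" (infixr "\<boxplus>" 65) is EAdd
  by (auto simp: so3_equiv_alt intro: expr_eq.cong_add)
lift_definition mscale :: "'k::field \<Rightarrow> 'k mor \<Rightarrow> 'k mor" is EScale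
  by (auto simp: so3_equiv_alt intro: expr_eq.cong_scale)

lemma Dom_simps [simp]:
  "Dom (Idm n) = n" "Dom (Gen x) = so3_src x" "Dom (g \<cdot> f) = Dom f" "Dom (f \<odot> g) = Dom f + Dom g"
  "Dom (Zero m n) = m" "Dom (f \<boxplus> g) = Dom f" "Dom (mscale a f) = Dom f"
  by (transfer; simp)+

lemma Cod_simps [simp]:
  "Cod (Idm n) = n" "Cod (Gen x) = so3_tgt x" "Cod (g \<cdot> f) = Cod g" "Cod (f \<odot> g) = Cod f + Cod g"
  "Cod (Zero m n) = n" "Cod (f \<boxplus> g) = Cod f" "Cod (mscale a f) = Cod f"
  by (transfer; simp)+

lemma ok_simps [simp]:
  "ok (Idm n)" "ok (Gen x)" "ok (g \<cdot> f) \<longleftrightarrow> ok g \<and> ok f \<and> Dom g = Cod f"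
  "ok (f \<odot> g) \<longleftrightarrow> ok f \<and> ok g" "ok (Zero m n)"
  "ok (f \<boxplus> g) \<longleftrightarrow> ok f \<and> ok g \<and> Dom f = Dom g \<and> Cod f = Cod g" "ok (mscale a f) \<longleftrightarrow> ok f"
  by (transfer; simp)+

lemma comp_assoc: "(h \<cdot> g) \<cdot> f = h \<cdot> (g \<cdot> f)"
  by transfer (auto intro!: so3_equivI expr_eq.comp_assoc)
lemma comp_id_left [simp]: "Cod f = n \<Longrightarrow> Idm n \<cdot> f = f"
  by transfer (auto intro!: so3_equivI expr_eq.comp_id_left)
lemma comp_id_right [simp]: "Dom f = n \<Longrightarrow> f \<cdot> Idm n = f"
  by transfer (auto intro!: so3_equivI expr_eq.comp_id_right)
lemma tens_assoc: "(f \<odot> g) \<odot> h = f \<odot> (g \<odot> h)"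
  by transfer (auto intro!: so3_equivI expr_eq.tensor_assoc)
lemma tens_unit [simp]: "Idm 0 \<odot> f = f" "f \<odot> Idm 0 = f"
  by (transfer; auto intro!: so3_equivI expr_eq.tensor_unit_left expr_eq.tensor_unit_right)+
lemma tens_id [simp]: "Idm m \<odot> Idm n = Idm (m + n)"
  by transfer (auto intro!: so3_equivI expr_eq.tensor_id)
lemma interchange:
  "\<lbrakk>Dom g = Cod f; Dom g' = Cod f'\<rbrakk> \<Longrightarrow> (g \<odot> g') \<cdot> (f \<odot> f') = (g \<cdot> f) \<odot> (g' \<cdot> f')"
  by transfer (auto intro!: so3_equivI expr_eq.interchange[THEN expr_eq.sym])
lemma add_assoc: "(f \<boxplus> g) \<boxplus> h = f \<boxplus> (g \<boxplus> h)"
  by transfer (auto intro!: so3_equivI expr_eq.add_assoc)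
lemma add_commute: "\<lbrakk>Dom f = Dom g; Cod f = Cod g\<rbrakk> \<Longrightarrow> f \<boxplus> g = g \<boxplus> f"
  by transfer (auto intro!: so3_equivI expr_eq.add_commute)
lemma add_zero [simp]: "\<lbrakk>Dom f = m; Cod f = n\<rbrakk> \<Longrightarrow> Zero m n \<boxplus> f = f"
  by transfer (auto intro!: so3_equivI expr_eq.add_zero)
lemma add_inverse: "\<lbrakk>ok f; Dom f = m; Cod f = n\<rbrakk> \<Longrightarrow> mscale (- 1) f \<boxplus> f = Zero m n"
  by transfer (auto intro!: so3_equivI expr_eq.add_inverse)
lemma scale_add: "mscale a (f \<boxplus> g) = mscale a f \<boxplus> mscale a g"
  by transfer (auto intro!: so3_equivI expr_eq.scale_add)
lemma add_scale: "mscale (a + b) f = mscale a f \<boxplus> mscale b f"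
  by transfer (auto intro!: so3_equivI expr_eq.add_scale)
lemma scale_scale: "mscale a (mscale b f) = mscale (a * b) f"
  by transfer (auto intro!: so3_equivI expr_eq.scale_scale)
lemma scale_one [simp]: "mscale 1 f = f"
  by transfer (auto intro!: so3_equivI expr_eq.scale_one)
lemma comp_add_left: "(g \<boxplus> h) \<cdot> f = g \<cdot> f \<boxplus> h \<cdot> f"
  by transfer (auto intro!: so3_equivI expr_eq.comp_add_left)
lemma comp_add_right: "h \<cdot> (f \<boxplus> g) = h \<cdot> f \<boxplus> h \<cdot> g"
  by transfer (auto intro!: so3_equivI expr_eq.comp_add_right)
lemma comp_scale [simp]: "mscale a g \<cdot> f = mscale a (g \<cdot> f)" "g \<cdot> mscale a f = mscale a (g \<cdot> f)"
  by (transfer; auto intro!: so3_equivI expr_eq.comp_scale_left expr_eq.comp_scale_right)+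
lemma tens_add_left: "(f \<boxplus> g) \<odot> h = f \<odot> h \<boxplus> g \<odot> h"
  by transfer (auto intro!: so3_equivI expr_eq.tensor_add_left)
lemma tens_add_right: "h \<odot> (f \<boxplus> g) = h \<odot> f \<boxplus> h \<odot> g"
  by transfer (auto intro!: so3_equivI expr_eq.tensor_add_right)
lemma tens_scale [simp]: "mscale a g \<odot> f = mscale a (g \<odot> f)" "g \<odot> mscale a f = mscale a (g \<odot> f)"
  by (transfer; auto intro!: so3_equivI expr_eq.tensor_scale_left expr_eq.tensor_scale_right)+

lemma scale_zero: "ok f \<Longrightarrow> mscale 0 f = Zero (Dom f) (Cod f)"
  using add_scale[of "- 1" 1 f] add_inverse[of f "Dom f" "Cod f"] by simp

lemma scale_Zero [simp]: "mscale a (Zero m n) = Zero m n"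
  using scale_scale[of a 0 "Zero m n"] by (simp add: scale_zero)

lemma comp_Zero:
  "\<lbrakk>ok f; Cod f = m; Dom f = l\<rbrakk> \<Longrightarrow> Zero m n \<cdot> f = Zero l n"
  "\<lbrakk>ok g; Dom g = m; Cod g = n\<rbrakk> \<Longrightarrow> g \<cdot> Zero l m = Zero l n"
  using comp_scale(1)[of 0 "Zero m n" f] comp_scale(2)[of g 0 "Zero l m"]
  by (simp_all add: scale_zero)

lemma tens_Zero:
  "\<lbrakk>ok f; Dom f = a; Cod f = b\<rbrakk> \<Longrightarrow> Zero m n \<odot> f = Zero (m + a) (n + b)"
  "\<lbrakk>ok f; Dom f = a; Cod f = b\<rbrakk> \<Longrightarrow> f \<odot> Zero m n = Zero (a + m) (b + n)"
  using tens_scale(1)[of 0 "Zero m n" f] tens_scale(2)[of f 0 "Zero m n"]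
  by (simp_all add: scale_zero)

lemma add_Zero [simp]: "\<lbrakk>Dom f = m; Cod f = n\<rbrakk> \<Longrightarrow> f \<boxplus> Zero m n = f"
  by (subst add_commute) auto

lemma add_minus [simp]: "\<lbrakk>ok f; Dom f = m; Cod f = n\<rbrakk> \<Longrightarrow> f \<boxplus> mscale (- 1) f = Zero m n"
  by (subst add_commute) (auto simp: add_inverse)

lemma tens_id_comp: "Dom g = Cod f \<Longrightarrow> Idm a \<odot> (g \<cdot> f) = (Idm a \<odot> g) \<cdot> (Idm a \<odot> f)"
  "Dom g = Cod f \<Longrightarrow> (g \<cdot> f) \<odot> Idm a = (g \<odot> Idm a) \<cdot> (f \<odot> Idm a)"
  by (simp_all add: interchange)

lemma tens_id_id [simp]: "Idm a \<odot> (Idm b \<odot> f) = Idm (a + b) \<odot> f"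
  by (simp add: tens_assoc[symmetric])

lemma slide:
  "\<lbrakk>a = Cod g; b = Dom f\<rbrakk> \<Longrightarrow> (Idm a \<odot> f) \<cdot> (g \<odot> Idm b) = g \<odot> f"
  "\<lbrakk>a = Dom g; b = Cod f\<rbrakk> \<Longrightarrow> (g \<odot> Idm b) \<cdot> (Idm a \<odot> f) = g \<odot> f"
  by (simp_all add: interchange)

section \<open>Consequences of the relations\<close>

abbreviation cap :: "'k::field mor" where "cap \<equiv> Gen Cap"
abbreviation cup :: "'k::field mor" where "cup \<equiv> Gen Cup"
abbreviation merge :: "'k::field mor" where "merge \<equiv> Gen Merge"
abbreviation split :: "'k::field mor" where "split \<equiv> Gen Split"
text \<open>The tensor square of \<open>B\<^sub>1\<close> splits as
  \<open>B(4 \<omega>\<^sub>1)\<close>, \<open>B(2 \<omega>\<^sub>1)\<close> and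
  \<open>B(0)\<close>; \<open>lower\<close> becomes the projection onto the last two and
  \<open>upper\<close> the one onto the first. The relations also write \<open>lower\<close> in two
  ways as a merge after a split on neighbouring strands.\<close>

definition lower :: "'k::field mor" where "lower = split \<cdot> merge \<boxplus> cup \<cdot> cap"
definition upper :: "'k::field mor" where "upper = Idm 2 \<boxplus> mscale (- 1) lower"

lemma so3_relation:
  "(f, g) \<in> so3_relations \<Longrightarrow> so3_wf f \<Longrightarrow> so3_wf g \<Longrightarrow> src so3_src f = src so3_src g \<Longrightarrow>
    tgt so3_tgt f = tgt so3_tgt g \<Longrightarrow> so3_equiv f g"
  by (simp add: so3_equiv_iff expr_eq.relation)

lemma so3_equiv_base:
  "(f, g) \<in> so3_base_relations \<Longrightarrow> so3_wf f \<Longrightarrow> so3_wf g \<Longrightarrow> src so3_src f = src so3_src g \<Longrightarrow>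
    tgt so3_tgt f = tgt so3_tgt g \<Longrightarrow> so3_equiv f g"
  unfolding so3_relations_def by (rule so3_relation) (auto simp: so3_relations_def)

lemma so3_equiv_reflect:
  "(f, g) \<in> so3_base_relations \<Longrightarrow> so3_wf (reflect f) \<Longrightarrow> so3_wf (reflect g) \<Longrightarrow>
    src so3_src (reflect f) = src so3_src (reflect g) \<Longrightarrow>
    tgt so3_tgt (reflect f) = tgt so3_tgt (reflect g) \<Longrightarrow> so3_equiv (reflect f) (reflect g)"
  by (rule so3_relation) (auto simp: so3_relations_def)

lemma so3_equiv_sym: "so3_equiv f g \<Longrightarrow> so3_equiv g f"
  unfolding so3_equiv_def by (auto intro: expr_eq.sym)

lemma cup_cap: "cap \<cdot> cup = Idm 0"
  by transfer (rule so3_equiv_base; simp add: so3_base_relations_def Let_def)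
lemma split_merge: "merge \<cdot> split = Idm 1"
  by transfer (rule so3_equiv_base; simp add: so3_base_relations_def Let_def)
lemma split_merge_right: "Idm 1 \<odot> merge \<cdot> split \<odot> Idm 1 = lower"
  unfolding lower_def by transfer (rule so3_equiv_base; simp add: so3_base_relations_def Let_def)
lemma split_merge_left: "merge \<odot> Idm 1 \<cdot> Idm 1 \<odot> split = lower"
  unfolding lower_def by transfer (rule so3_equiv_sym, rule so3_equiv_base; simp add: so3_base_relations_def Let_def)
lemma split_cap_right: "Idm 1 \<odot> cap \<cdot> split \<odot> Idm 1 = Zero 2 1"
  by transfer (rule so3_equiv_base; simp add: so3_base_relations_def Let_def)
lemma split_cap_left: "cap \<odot> Idm 1 \<cdot> Idm 1 \<odot> split = Zero 2 1"
  by transfer (rule so3_equiv_sym, rule so3_equiv_base; simp add: so3_base_relations_def Let_def)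
lemma split_cap: "cap \<cdot> split = Zero 1 0"
  by transfer (rule so3_equiv_base; simp add: so3_base_relations_def Let_def)
lemma merge_merge: "merge \<cdot> Idm 1 \<odot> merge = merge \<cdot> merge \<odot> Idm 1"
  by transfer (rule so3_equiv_sym, rule so3_equiv_base; simp add: so3_base_relations_def Let_def)
lemma merge_cap: "cap \<cdot> Idm 1 \<odot> merge = cap \<cdot> merge \<odot> Idm 1"
  by transfer (rule so3_equiv_base; simp add: so3_base_relations_def Let_def)

section \<open>The vertically reflected relations\<close>

lemma cup_merge_left: "merge \<odot> Idm 1 \<cdot> Idm 1 \<odot> cup = Zero 1 2"
  by transfer (use so3_equiv_reflect[of "(EId 1 \<otimes> EGen Cap) \<bullet> (EGen Split \<otimes> EId 1)" "EZero 2 1"] in \<open>simp add: so3_base_relations_def Let_def\<close>)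
lemma cup_merge_right: "Idm 1 \<odot> merge \<cdot> cup \<odot> Idm 1 = Zero 1 2"
  by transfer (use so3_equiv_reflect[of "EZero 2 1" "(EGen Cap \<otimes> EId 1) \<bullet> (EId 1 \<otimes> EGen Split)", THEN so3_equiv_sym] in \<open>simp add: so3_base_relations_def Let_def\<close>)
lemma cup_merge: "merge \<cdot> cup = Zero 0 1"
  by transfer (use so3_equiv_reflect[of "EGen Cap \<bullet> EGen Split" "EZero 1 0"] in \<open>simp add: so3_base_relations_def Let_def\<close>)
lemma split_split: "Idm 1 \<odot> split \<cdot> split = split \<odot> Idm 1 \<cdot> split"
  by transfer (use so3_equiv_reflect[of "EGen Merge \<bullet> (EGen Merge \<otimes> EId 1)" "EGen Merge \<bullet> (EId 1 \<otimes> EGen Merge)", THEN so3_equiv_sym] in \<open>simp add: so3_base_relations_def Let_def\<close>)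
lemma cup_split: "Idm 1 \<odot> split \<cdot> cup = split \<odot> Idm 1 \<cdot> cup"
  by transfer (use so3_equiv_reflect[of "EGen Cap \<bullet> (EId 1 \<otimes> EGen Merge)" "EGen Cap \<bullet> (EGen Merge \<otimes> EId 1)"] in \<open>simp add: so3_base_relations_def Let_def\<close>)

declare One_nat_def [simp del]

lemma comp_extend: "g \<cdot> f = h \<Longrightarrow> g \<cdot> (f \<cdot> k) = h \<cdot> k"
  by (metis comp_assoc)

section \<open>Commutation of \<open>lower\<close> and \<open>upper\<close> with the
  generators\<close>

lemma Dom_lower [simp]: "Dom lower = 2" and Cod_lower [simp]: "Cod lower = 2" and ok_lower [simp]: "ok lower"
  by (simp_all add: lower_def)

lemma Dom_upper [simp]: "Dom upper = 2" and Cod_upper [simp]: "Cod upper = 2" and ok_upper [simp]: "ok upper"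
  by (simp_all add: upper_def)

lemma merge_lower: "merge \<cdot> lower = merge"
  by (simp add: lower_def comp_add_right cup_merge[THEN comp_extend] split_merge[THEN comp_extend] comp_Zero)

lemma cap_lower: "cap \<cdot> lower = cap"
  by (simp add: lower_def comp_add_right cup_cap[THEN comp_extend] split_cap[THEN comp_extend] comp_Zero)

lemma lower_split: "lower \<cdot> split = split"
  by (simp add: lower_def comp_add_left comp_assoc split_merge split_cap comp_Zero)

lemma lower_cup: "lower \<cdot> cup = cup"
  by (simp add: lower_def comp_add_left comp_assoc cup_merge cup_cap comp_Zero)

lemma merge_upper: "merge \<cdot> upper = Zero 2 1"
  by (simp add: upper_def comp_add_right merge_lower)

lemma cap_upper: "cap \<cdot> upper = Zero 2 0"
  by (simp add: upper_def comp_add_right cap_lower)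

lemma upper_split: "upper \<cdot> split = Zero 1 2"
  by (simp add: upper_def comp_add_left lower_split)

lemma upper_cup: "upper \<cdot> cup = Zero 0 2"
  by (simp add: upper_def comp_add_left lower_cup)

text \<open>Write \<open>lower\<close> as a merge after a split, the merge on the left.
  \<open>merge_cap\<close> carries the merge to the other leg of the cap; then it slides past the
  split, which meets the cap and vanishes.\<close>

lemma cap_lower_right: "cap \<odot> Idm 1 \<cdot> Idm 1 \<odot> lower = Zero 3 1"
proof -
  have "cap \<odot> Idm 1 \<cdot> Idm 1 \<odot> lower = (cap \<odot> Idm 1 \<cdot> (Idm 1 \<odot> merge) \<odot> Idm 1) \<cdot> Idm 2 \<odot> split"
    by (simp add: split_merge_left[symmetric] tens_id_comp comp_assoc tens_assoc)
  also have "cap \<odot> Idm 1 \<cdot> (Idm 1 \<odot> merge) \<odot> Idm 1 = (cap \<cdot> Idm 1 \<odot> merge) \<odot> Idm 1"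
    by (simp add: tens_id_comp)
  also have "\<dots> = cap \<odot> Idm 1 \<cdot> merge \<odot> Idm 2"
    by (simp add: merge_cap tens_id_comp tens_assoc)
  also have "(cap \<odot> Idm 1 \<cdot> merge \<odot> Idm 2) \<cdot> Idm 2 \<odot> split
      = cap \<odot> Idm 1 \<cdot> Idm 1 \<odot> split \<cdot> merge \<odot> Idm 1"
    by (simp add: comp_assoc slide)
  also have "\<dots> = Zero 3 1"
    by (simp add: split_cap_left[THEN comp_extend] comp_Zero)
  finally show ?thesis .
qed

text \<open>\<open>cup_split\<close> carries the split inside \<open>lower\<close> to the far leg of
  the cup; the merge can then slide below it, where it meets the cup and vanishes.\<close>

lemma lower_cup_left: "lower \<odot> Idm 1 \<cdot> Idm 1 \<odot> cup = Zero 1 3"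
proof -
  have "lower \<odot> Idm 1 \<cdot> Idm 1 \<odot> cup = merge \<odot> Idm 2 \<cdot> Idm 1 \<odot> (split \<odot> Idm 1 \<cdot> cup)"
    by (simp add: split_merge_left[symmetric] tens_id_comp comp_assoc tens_assoc)
  also have "\<dots> = (merge \<odot> Idm 2 \<cdot> Idm 2 \<odot> split) \<cdot> Idm 1 \<odot> cup"
    by (simp add: cup_split[symmetric] tens_id_comp comp_assoc)
  also have "merge \<odot> Idm 2 \<cdot> Idm 2 \<odot> split = Idm 1 \<odot> split \<cdot> merge \<odot> Idm 1"
    by (simp add: slide)
  also have "(Idm 1 \<odot> split \<cdot> merge \<odot> Idm 1) \<cdot> Idm 1 \<odot> cup = Zero 1 3"
    by (simp add: comp_assoc cup_merge_left comp_Zero)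
  finally show ?thesis .
qed

lemma lower_cup_right: "Idm 1 \<odot> lower \<cdot> cup \<odot> Idm 1 = Zero 1 3"
proof -
  have "Idm 1 \<odot> lower \<cdot> cup \<odot> Idm 1 = Idm 2 \<odot> merge \<cdot> (Idm 1 \<odot> split \<cdot> cup) \<odot> Idm 1"
    by (simp add: split_merge_right[symmetric] tens_id_comp comp_assoc tens_assoc)
  also have "\<dots> = (Idm 2 \<odot> merge \<cdot> split \<odot> Idm 2) \<cdot> cup \<odot> Idm 1"
    by (simp add: cup_split tens_id_comp comp_assoc tens_assoc)
  also have "Idm 2 \<odot> merge \<cdot> split \<odot> Idm 2 = split \<odot> Idm 1 \<cdot> Idm 1 \<odot> merge"
    by (simp add: slide)
  also have "(split \<odot> Idm 1 \<cdot> Idm 1 \<odot> merge) \<cdot> cup \<odot> Idm 1 = Zero 1 3"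
    by (simp add: comp_assoc cup_merge_right comp_Zero)
  finally show ?thesis .
qed

text \<open>The zigzag is zero, not the identity: the cup absorbs a copy of \<open>lower\<close>,
  which the cap kills by \<open>cap_lower_right\<close>.\<close>

lemma cup_cap_left: "cap \<odot> Idm 1 \<cdot> Idm 1 \<odot> cup = Zero 1 1"
proof -
  have "cap \<odot> Idm 1 \<cdot> Idm 1 \<odot> cup = cap \<odot> Idm 1 \<cdot> Idm 1 \<odot> (lower \<cdot> cup)"
    by (simp only: lower_cup)
  also have "\<dots> = Zero 1 1"
    by (simp add: tens_id_comp cap_lower_right[THEN comp_extend] comp_Zero)
  finally show ?thesis .
qed

lemma cup_cap_right: "Idm 1 \<odot> cap \<cdot> cup \<odot> Idm 1 = Zero 1 1"
proof -
  have "Idm 1 \<odot> cap \<cdot> cup \<odot> Idm 1 = Idm 1 \<odot> (cap \<cdot> lower) \<cdot> cup \<odot> Idm 1"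
    by (simp only: cap_lower)
  also have "\<dots> = Zero 1 1"
    by (simp add: tens_id_comp comp_assoc lower_cup_right comp_Zero)
  finally show ?thesis .
qed

text \<open>Against the merge the cup term of \<open>lower\<close> dies and the split term produces
  a new \<open>lower\<close> after a merge of the right pair. By \<open>merge_merge\<close> and
  \<open>merge_cap\<close>, below \<open>lower\<close> it does not matter which neighbouring pair is
  merged.\<close>

lemma merge_lower_right: "merge \<odot> Idm 1 \<cdot> Idm 1 \<odot> lower = lower \<cdot> merge \<odot> Idm 1"
proof -
  have "merge \<odot> Idm 1 \<cdot> Idm 1 \<odot> (split \<cdot> merge \<boxplus> cup \<cdot> cap) = lower \<cdot> Idm 1 \<odot> merge"
    by (simp add: tens_add_right comp_add_right tens_id_comp split_merge_left[THEN comp_extend]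
        cup_merge_left[THEN comp_extend] comp_Zero)
  then have "merge \<odot> Idm 1 \<cdot> Idm 1 \<odot> lower = lower \<cdot> Idm 1 \<odot> merge"
    by (simp only: lower_def[symmetric])
  also have "\<dots> = lower \<cdot> merge \<odot> Idm 1"
    by (simp add: lower_def comp_add_left comp_assoc merge_merge merge_cap)
  finally show ?thesis .
qed

text \<open>The counterpart of \<open>merge_lower_right\<close> under reflection in both directions.
  Both are needed since \<open>proj\<close> composes its factors in one order, so that what comes
  from above and from below has to pass different factors.\<close>

lemma lower_split_left: "lower \<odot> Idm 1 \<cdot> Idm 1 \<odot> split = Idm 1 \<odot> split \<cdot> lower"
proof -
  have "lower \<odot> Idm 1 \<cdot> Idm 1 \<odot> split = split \<odot> Idm 1 \<cdot> lower"
    by (subst lower_def)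
      (simp add: tens_add_left comp_add_left tens_id_comp comp_assoc split_merge_left split_cap_left comp_Zero)
  also have "\<dots> = Idm 1 \<odot> split \<cdot> lower"
    by (simp add: lower_def comp_add_right split_split[THEN comp_extend] cup_split[THEN comp_extend] comp_assoc)
  finally show ?thesis .
qed

lemma merge_upper_right: "merge \<odot> Idm 1 \<cdot> Idm 1 \<odot> upper = upper \<cdot> merge \<odot> Idm 1"
  by (simp add: upper_def tens_add_right comp_add_right comp_add_left merge_lower_right)

lemma cap_upper_right: "cap \<odot> Idm 1 \<cdot> Idm 1 \<odot> upper = cap \<odot> Idm 1"
  by (simp add: upper_def tens_add_right comp_add_right cap_lower_right)

lemma upper_split_left: "upper \<odot> Idm 1 \<cdot> Idm 1 \<odot> split = Idm 1 \<odot> split \<cdot> upper"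
  by (simp add: upper_def tens_add_left comp_add_right comp_add_left lower_split_left)

lemma upper_cup_left: "upper \<odot> Idm 1 \<cdot> Idm 1 \<odot> cup = Idm 1 \<odot> cup"
  by (simp add: upper_def tens_add_left comp_add_left lower_cup_left)

section \<open>Projections onto the top components\<close>

text \<open>The \<open>upper\<close> on the leftmost pair acts first and the pairs follow from left
  to right. Peeling off this first factor is the induction step of the lemmas below.\<close>

fun proj :: "nat \<Rightarrow> 'k::field mor" where
  "proj 0 = Idm 0"
| "proj (Suc 0) = Idm 1"
| "proj (Suc (Suc n)) = Idm 1 \<odot> proj (Suc n) \<cdot> upper \<odot> Idm n"

lemma proj_typed: "ok (proj n :: 'k::field mor) \<and> Dom (proj n :: 'k mor) = n \<and> Cod (proj n :: 'k mor) = n"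
  by (induction n rule: proj.induct) (auto simp: One_nat_def)

lemma ok_proj [simp]: "ok (proj n)" and Dom_proj [simp]: "Dom (proj n) = n" and Cod_proj [simp]: "Cod (proj n) = n"
  using proj_typed by blast+

section \<open>The projections are killed from above and below\<close>

definition layer :: "nat \<Rightarrow> so3_gen \<Rightarrow> nat \<Rightarrow> 'k::field mor" where
  "layer a g b = Idm a \<odot> Gen g \<odot> Idm b"

lemma layer_typed [simp]:
  "ok (layer a g b)" "Dom (layer a g b) = a + so3_src g + b" "Cod (layer a g b) = a + so3_tgt g + b"
  by (simp_all add: layer_def)

lemma layer_Suc: "layer (Suc a) g b = Idm 1 \<odot> layer a g b"
  by (simp add: layer_def One_nat_def)

text \<open>A cap absorbs the \<open>upper\<close> to its right and a merge passes it; either way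
  the generator then reaches the \<open>upper\<close> on its own pair and vanishes.\<close>

lemma down_upper_upper:
  assumes "d = Cap \<or> d = Merge"
  shows "Gen d \<odot> Idm 1 \<cdot> Idm 1 \<odot> upper \<cdot> upper \<odot> Idm 1 = Zero 3 (so3_tgt d + 1)"
  using assms
  by (auto simp: cap_upper_right[THEN comp_extend] merge_upper_right[THEN comp_extend] comp_assoc
      tens_id_comp(2)[symmetric] cap_upper merge_upper tens_Zero comp_Zero)

text \<open>Away from the left edge the layer meets only the tail of \<open>proj\<close>. At the
  left edge two factors of \<open>proj\<close> have to be exposed, because the \<open>upper\<close>
  on the next pair lies between the generator and the \<open>upper\<close> that kills it.\<close>

lemma proj_down:
  assumes d: "d = Cap \<or> d = Merge"
  shows "layer a d b \<cdot> (proj (a + 2 + b) :: 'k::field mor) = Zero (a + 2 + b) (a + so3_tgt d + b)"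
proof (induction a)
  case 0
  show ?case
  proof (cases b)
    case 0
    then show ?thesis using d by (auto simp: layer_def numeral_2_eq_2 cap_upper merge_upper One_nat_def)
  next
    case (Suc b')
    have dom: "so3_src d = 2" using d by auto
    \<comment> \<open>Two unfoldings of \<open>proj\<close>: the generator slides past the remaining
      \<open>proj b\<close> and then faces the two leftmost factors.\<close>
    have "layer 0 d b \<cdot> (proj (0 + 2 + b) :: 'k mor)
        = Gen d \<odot> Idm b \<cdot> Idm 2 \<odot> proj b \<cdot> Idm 1 \<odot> upper \<odot> Idm b' \<cdot> upper \<odot> Idm b"
      by (simp add: layer_def Suc numeral_2_eq_2 tens_id_comp comp_assoc One_nat_def tens_assoc)
    also have "\<dots> = Idm (so3_tgt d) \<odot> proj b \<cdot> Gen d \<odot> Idm b \<cdot> Idm 1 \<odot> upper \<odot> Idm b' \<cdot> upper \<odot> Idm b"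
    proof -
      have "Gen d \<odot> Idm b \<cdot> Idm 2 \<odot> proj b = Idm (so3_tgt d) \<odot> proj b \<cdot> (Gen d \<odot> Idm b :: 'k mor)"
        by (simp add: slide dom)
      from comp_extend[OF this] show ?thesis by (simp only: comp_assoc)
    qed
    also have "Gen d \<odot> Idm b \<cdot> Idm 1 \<odot> upper \<odot> Idm b' \<cdot> upper \<odot> Idm b
        = (Gen d \<odot> Idm 1 \<cdot> Idm 1 \<odot> upper \<cdot> upper \<odot> Idm 1) \<odot> Idm b'"
      using dom by (simp add: tens_id_comp tens_assoc Suc One_nat_def)
    also have "\<dots> = Zero (3 + b') (so3_tgt d + 1 + b')"
      by (simp add: down_upper_upper[OF d] tens_Zero)
    finally show ?thesis by (simp add: comp_Zero Suc One_nat_def eval_nat_numeral)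
  qed
next
  case (Suc a)
  have dom: "so3_src d = 2" using d by auto
  have "layer (Suc a) d b \<cdot> (proj (Suc a + 2 + b) :: 'k mor) = Idm 1 \<odot> (layer a d b \<cdot> proj (a + 2 + b)) \<cdot> upper \<odot> Idm (a + 1 + b)"
    by (simp add: layer_Suc tens_id_comp comp_assoc dom eval_nat_numeral One_nat_def)
  also have "\<dots> = Zero (Suc a + 2 + b) (Suc a + so3_tgt d + b)"
    unfolding Suc by (simp add: tens_Zero comp_Zero One_nat_def)
  finally show ?case .
qed

lemma proj_up_first:
  assumes g: "g = Cup \<or> g = Split"
  shows "proj (0 + 2 + b) \<cdot> layer 0 g b = Zero (0 + so3_src g + b) (0 + 2 + b)"
proof -
  have "proj (0 + 2 + b) \<cdot> layer 0 g b = Idm 1 \<odot> proj (Suc b) \<cdot> (upper \<cdot> Gen g) \<odot> Idm b"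
    using g by (auto simp: layer_def tens_id_comp comp_assoc eval_nat_numeral One_nat_def)
  then show ?thesis using g by (auto simp: upper_cup upper_split tens_Zero comp_Zero One_nat_def simp del: proj.simps)
qed

text \<open>At position 0 the generator meets its \<open>upper\<close> at once. At position 1 it
  first passes the leftmost \<open>upper\<close> and arrives at position 0 of the smaller
  projection; further right the leftmost factor simply slides past.\<close>

lemma proj_up:
  assumes g: "g = Cup \<or> g = Split"
  shows "(proj (a + 2 + b) :: 'k::field mor) \<cdot> layer a g b = Zero (a + so3_src g + b) (a + 2 + b)"
proof (induction a rule: proj.induct)
  case 1
  show ?case by (rule proj_up_first[OF g])
next
  case 2
  have cod: "so3_tgt g = 2" using g by auto
  \<comment> \<open>What remains below after the passage: \<open>Idm 1\<close> for the cup,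
    \<open>upper\<close> for the split.\<close>
  obtain h :: "'k mor" where h: "upper \<odot> Idm 1 \<cdot> Idm 1 \<odot> Gen g = Idm 1 \<odot> Gen g \<cdot> h"
    "ok h" "Dom h = so3_src g + 1" "Cod h = so3_src g + 1"
  proof -
    have "upper \<odot> Idm 1 \<cdot> Idm 1 \<odot> cup = Idm 1 \<odot> cup \<cdot> Idm 1"
      by (simp add: upper_cup_left)
    then show thesis using g upper_split_left that[of "Idm 1"] that[of upper] by auto
  qed
  have "proj (Suc 0 + 2 + b) \<cdot> layer (Suc 0) g b
      = Idm 1 \<odot> proj (2 + b) \<cdot> (upper \<odot> Idm 1 \<cdot> Idm 1 \<odot> Gen g) \<odot> Idm b"
    using cod by (simp add: layer_def tens_id_comp comp_assoc eval_nat_numeral One_nat_def tens_assoc)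
  also have "\<dots> = Idm 1 \<odot> (proj (0 + 2 + b) \<cdot> layer 0 g b) \<cdot> h \<odot> Idm b"
    unfolding h(1) using cod h(2-) by (simp add: layer_def tens_id_comp comp_assoc tens_assoc)
  finally show ?case
    unfolding proj_up_first[OF g] using h by (simp add: tens_Zero comp_Zero One_nat_def)
next
  case (3 a)
  have cod: "so3_tgt g = 2" using g by auto
  have "(proj (Suc (Suc a) + 2 + b) :: 'k mor) \<cdot> layer (Suc (Suc a)) g b
      = Idm 1 \<odot> proj (Suc a + 2 + b) \<cdot> upper \<odot> Idm (a + 2 + b) \<cdot> Idm 2 \<odot> layer a g b"
    by (simp add: layer_Suc comp_assoc eval_nat_numeral One_nat_def)
  also have "upper \<odot> Idm (a + 2 + b) \<cdot> Idm 2 \<odot> layer a g b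
      = Idm 2 \<odot> layer a g b \<cdot> upper \<odot> Idm (a + so3_src g + b)"
    using cod by (simp add: slide)
  also have "Idm 1 \<odot> proj (Suc a + 2 + b) \<cdot> Idm 2 \<odot> layer a g b \<cdot> upper \<odot> Idm (a + so3_src g + b)
      = Idm 1 \<odot> (proj (Suc a + 2 + b) \<cdot> layer (Suc a) g b) \<cdot> upper \<odot> Idm (a + so3_src g + b)"
    using cod by (simp add: layer_Suc tens_id_comp comp_assoc del: proj.simps)
  finally show ?case
    unfolding 3 by (simp add: tens_Zero comp_Zero One_nat_def)
qed

section \<open>Exchanging a merge or cap with a split or cup\<close>

lemma layer_exchange_far_left:
  assumes "so3_src d = 2" "so3_tgt g = 2"
  shows "(layer a d (t + 2 + b) :: 'k::field mor) \<cdot> layer (a + 2 + t) g b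
    = layer (a + so3_tgt d + t) g b \<cdot> layer a d (t + so3_src g + b)"
proof -
  define X :: "'k mor" where "X = layer t g b"
  have X: "Dom X = t + so3_src g + b" "Cod X = t + 2 + b"
    using assms by (simp_all add: X_def)
  have "(layer a d (t + 2 + b) :: 'k mor) \<cdot> layer (a + 2 + t) g b
      = Idm a \<odot> (Gen d \<odot> Idm (Cod X) \<cdot> Idm 2 \<odot> X)"
    unfolding X(2) using assms X by (simp add: tens_id_comp) (simp add: X_def layer_def add.assoc)
  also have "\<dots> = Idm a \<odot> (Idm (so3_tgt d) \<odot> X \<cdot> Gen d \<odot> Idm (Dom X))"
    using assms by (simp add: slide)
  also have "\<dots> = layer (a + so3_tgt d + t) g b \<cdot> layer a d (t + so3_src g + b)"
    unfolding X(1) using X by (simp add: tens_id_comp) (simp add: X_def layer_def add.assoc)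
  finally show ?thesis .
qed

lemma layer_exchange_far_right:
  assumes "so3_src d = 2" "so3_tgt g = 2"
  shows "(layer (a + 2 + t) d b :: 'k::field mor) \<cdot> layer a g (t + 2 + b)
    = layer a g (t + so3_tgt d + b) \<cdot> layer (a + so3_src g + t) d b"
proof -
  define X :: "'k mor" where "X = layer t d b"
  have X: "Dom X = t + 2 + b" "Cod X = t + so3_tgt d + b"
    using assms by (simp_all add: X_def)
  have "(layer (a + 2 + t) d b :: 'k mor) \<cdot> layer a g (t + 2 + b)
      = Idm a \<odot> (Idm 2 \<odot> X \<cdot> Gen g \<odot> Idm (Dom X))"
    unfolding X(1) using assms X by (simp add: tens_id_comp) (simp add: X_def layer_def add.assoc)
  also have "\<dots> = Idm a \<odot> (Gen g \<odot> Idm (Cod X) \<cdot> Idm (so3_src g) \<odot> X)"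
    using assms by (simp add: slide)
  also have "\<dots> = layer a g (t + so3_tgt d + b) \<cdot> layer (a + so3_src g + t) d b"
    unfolding X(2) using X by (simp add: tens_id_comp) (simp add: X_def layer_def add.assoc)
  finally show ?thesis .
qed

text \<open>The twelve overlaps are covered by the relations, their reflections and the vanishing
  zigzags. The last alternative spells out \<open>lower\<close> so that a merge or a cap is the next
  thing to act on a word below.\<close>

lemma layer_exchange_near:
  assumes d: "d = Cap \<or> d = Merge" and g: "g = Cup \<or> g = Split"
    and R: "R = layer a d b \<cdot> layer a g b \<or> R = layer (Suc a) d b \<cdot> layer a g (Suc b)
      \<or> R = layer a d (Suc b) \<cdot> layer (Suc a) g b"
  shows "R = Idm (Dom R) \<or> R = Zero (Dom R) (Cod R) \<or>
    (\<exists>a b. R = layer a Split b \<cdot> layer a Merge b \<boxplus> layer a Cup b \<cdot> layer a Cap b)"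
proof -
  have 1: "layer a d b \<cdot> layer a g b = Idm a \<odot> (Gen d \<cdot> Gen g) \<odot> Idm b"
    using d g by (auto simp: layer_def tens_id_comp)
  have 2: "layer (Suc a) d b \<cdot> layer a g (Suc b) = Idm a \<odot> (Idm 1 \<odot> Gen d \<cdot> Gen g \<odot> Idm 1) \<odot> Idm b"
    using d g by (auto simp: layer_def tens_id_comp tens_assoc One_nat_def)
  have 3: "layer a d (Suc b) \<cdot> layer (Suc a) g b = Idm a \<odot> (Gen d \<odot> Idm 1 \<cdot> Idm 1 \<odot> Gen g) \<odot> Idm b"
    using d g by (auto simp: layer_def tens_id_comp tens_assoc One_nat_def)
  have low: "Idm a \<odot> lower \<odot> Idm b
      = layer a Split b \<cdot> layer a Merge b \<boxplus> layer a Cup b \<cdot> layer a Cap b"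
    by (simp add: lower_def layer_def tens_id_comp tens_add_left tens_add_right)
  show ?thesis
    using R d g low unfolding 1 2 3
    by (elim disjE) (force simp: cup_cap split_merge split_merge_right split_merge_left split_cap_right
        split_cap_left split_cap cup_merge_left cup_merge_right cup_merge cup_cap_left cup_cap_right
        tens_Zero)+
qed

section \<open>Reduction to scalars\<close>

text \<open>The normal form to be reached: only cups and splits above \<open>proj k\<close>, with no
  merge or cap left.\<close>

inductive upword :: "nat \<Rightarrow> 'k::field mor \<Rightarrow> bool" for k where
  base: "upword k (proj k)"
| up: "\<lbrakk>upword k w; g = Cup \<or> g = Split; Cod w = a + so3_src g + b\<rbrakk> \<Longrightarrow> upword k (layer a g b \<cdot> w)"

text \<open>Linear combinations of such words. The zero of the right type starts the sum because
  addition is meaningful only within one Hom-space.\<close>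

inductive upspan :: "nat \<Rightarrow> 'k::field mor \<Rightarrow> bool" for k where
  zero: "upspan k (Zero k n)"
| word: "\<lbrakk>upspan k v; upword k w; Cod w = Cod v\<rbrakk> \<Longrightarrow> upspan k (mscale a w \<boxplus> v)"

lemma upword_typed: "upword k w \<Longrightarrow> ok w \<and> Dom w = k"
  by (induction rule: upword.induct) auto

lemma upspan_typed: "upspan k v \<Longrightarrow> ok v \<and> Dom v = k"
  by (induction rule: upspan.induct) (auto dest: upword_typed)

lemma upspan_upword: "upword k w \<Longrightarrow> upspan k w"
  using upspan.word[OF upspan.zero[of k "Cod w"], of w 1] upword_typed[of k w] by simp

lemma upspan_add: "upspan k v \<Longrightarrow> upspan k v' \<Longrightarrow> Cod v = Cod v' \<Longrightarrow> upspan k (v \<boxplus> v')"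
proof (induction arbitrary: v' rule: upspan.induct)
  case (zero n) then show ?case using upspan_typed[of k v'] by simp
next
  case (word v w a) then show ?case by (auto simp: add_assoc intro: upspan.word)
qed

lemma upspan_scale: "upspan k v \<Longrightarrow> upspan k (mscale a v)"
  by (induction rule: upspan.induct) (auto simp: scale_add scale_scale intro: upspan.intros)

lemma upspan_comp:
  assumes "\<And>w. upword k w \<Longrightarrow> Cod w = Dom f \<Longrightarrow> upspan k (f \<cdot> w)" and f: "ok f"
  shows "upspan k v \<Longrightarrow> Cod v = Dom f \<Longrightarrow> upspan k (f \<cdot> v)"
proof (induction rule: upspan.induct)
  case (zero n) then show ?case using f by (simp add: comp_Zero upspan.zero)
next
  case (word v w a)
  then have "upspan k (mscale a (f \<cdot> w) \<boxplus> f \<cdot> v)"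
    using assms(1)[of w] by (intro upspan_add upspan_scale) auto
  then show ?case by (simp add: comp_add_right)
qed

lemma upspan_up:
  "\<lbrakk>upspan k v; g = Cup \<or> g = Split; Cod v = a + so3_src g + b\<rbrakk> \<Longrightarrow> upspan k (layer a g b \<cdot> v)"
  by (rule upspan_comp) (auto intro: upspan_upword upword.up)

text \<open>The cap or merge travels down the word. It is absorbed in an overlap, is replaced by
  merges and caps acting on a shorter word, or reaches \<open>proj k\<close> and gives zero by
  \<open>proj_down\<close>. So the induction runs over the word, for all positions at once.\<close>

lemma upword_down:
  "upword k w \<Longrightarrow> Cod w = a + 2 + b \<Longrightarrow> d = Cap \<or> d = Merge \<Longrightarrow> upspan k (layer a d b \<cdot> w)"
proof (induction arbitrary: a b d rule: upword.induct)
  case base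
  then have k: "k = a + 2 + b" by simp
  show ?case unfolding k proj_down[OF base.prems(2)] by (rule upspan.zero)
next
  case (up w g a' b')
  have src: "so3_src d = 2" and tgt: "so3_tgt g = 2" using up.prems up.hyps by auto
  have ok: "ok w" and dom: "Dom w = k" using upword_typed[OF up.hyps(1)] by auto
  have down: "upspan k (layer i h j \<cdot> w)" if "i + 2 + j = Cod w" "h = Cap \<or> h = Merge" for i j h
    using up.IH[of i j h] that by simp
  have sum: "a + b = a' + b'" using up.prems(1) tgt by simp
  \<comment> \<open>In the first two cases \<open>t\<close> counts the strands between the two
    generators; the third collects the overlaps.\<close>
  consider t where "a' = a + 2 + t" "b = t + 2 + b'" | t where "a = a' + 2 + t" "b' = t + 2 + b"
    | "a' = a \<and> b' = b \<or> a' = Suc a \<and> b = Suc b' \<or> a = Suc a' \<and> b' = Suc b"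
  proof -
    have "(\<exists>t. a' = a + 2 + t) \<or> (\<exists>t. a = a' + 2 + t) \<or> a' = a \<or> a' = Suc a \<or> a = Suc a'"
      by presburger
    then show thesis using that sum by auto
  qed
  then show ?case
  proof cases
    case (1 t)
    have "layer a d b \<cdot> layer a' g b' \<cdot> w
        = layer (a + so3_tgt d + t) g b' \<cdot> layer a d (t + so3_src g + b') \<cdot> w"
      unfolding 1 using layer_exchange_far_left[OF src tgt, THEN comp_extend] by (simp add: comp_assoc)
    then show ?thesis
      using up.hyps(2,3) 1 src up.prems(2) by (auto intro!: upspan_up down)
  next
    case (2 t)
    have "layer a d b \<cdot> layer a' g b' \<cdot> w
        = layer a' g (t + so3_tgt d + b) \<cdot> layer (a' + so3_src g + t) d b \<cdot> w"
      unfolding 2 using layer_exchange_far_right[OF src tgt, THEN comp_extend] by (simp add: comp_assoc)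
    then show ?thesis
      using up.hyps(2,3) 2 src up.prems(2) by (auto intro!: upspan_up down)
  next
    case 3
    define R where "R = (layer a d b :: 'a mor) \<cdot> layer a' g b'"
    have R: "ok R" "Dom R = Cod w"
      using sum src tgt up.hyps(3) by (simp_all add: R_def)
    have "R = Idm (Dom R) \<or> R = Zero (Dom R) (Cod R) \<or>
        (\<exists>a b. R = layer a Split b \<cdot> layer a Merge b \<boxplus> layer a Cup b \<cdot> layer a Cap b)"
      \<comment> \<open>The minima are the numbers of strands to the left and right of both
        generators, whichever of the three overlaps occurs.\<close>
      by (rule layer_exchange_near[OF up.prems(2) up.hyps(2), where a = "min a a'" and b = "min b b'"])
        (use 3 in \<open>auto simp: R_def\<close>)
    then have "upspan k (R \<cdot> w)"
    proof (elim disjE exE)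
      assume "R = Idm (Dom R)"
      then have "R \<cdot> w = w" using R by (metis comp_id_left)
      then show ?thesis using upspan_upword[OF up.hyps(1)] by simp
    next
      assume "R = Zero (Dom R) (Cod R)"
      then have "R \<cdot> w = Zero k (Cod R)" using R ok dom by (metis comp_Zero(1))
      then show ?thesis by (simp add: upspan.zero)
    next
      fix i j assume R': "R = layer i Split j \<cdot> layer i Merge j \<boxplus> layer i Cup j \<cdot> layer i Cap j"
      then have "i + 2 + j = Cod w" using R by simp
      then show ?thesis unfolding R'
        by (auto simp: comp_add_left comp_assoc intro!: upspan_add upspan_up down)
    qed
    then show ?thesis by (simp add: R_def comp_assoc)
  qed
qed

lemma upspan_layer:
  "\<lbrakk>upspan k v; Cod v = a + so3_src g + b\<rbrakk> \<Longrightarrow> upspan k (layer a g b \<cdot> v)"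
proof (cases "g = Cup \<or> g = Split")
  case False
  then have g: "g = Cap \<or> g = Merge" using so3_gen.exhaust by blast
  assume "upspan k v" "Cod v = a + so3_src g + b"
  then show ?thesis
    by (intro upspan_comp[where f = "layer a g b" and v = v] upword_down[OF _ _ g]) (use g in auto)
qed (auto intro: upspan_up)

text \<open>The surrounding identities are part of the induction: a tensor product is the composite
  of its factors padded on the right and on the left, so padded generators are exactly
  layers.\<close>

lemma upspan_expr:
  "so3_wf f \<Longrightarrow> upspan k v \<Longrightarrow> Cod v = a + src so3_src f + b \<Longrightarrow>
    upspan k (Idm a \<odot> abs_mor f \<odot> Idm b \<cdot> v)"
proof (induction f arbitrary: a b v)
  case (EId n)
  then show ?case by (simp add: Idm.abs_eq[symmetric] add.assoc)
next
  case (EGen x)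
  then show ?case using upspan_layer[of k v a x b] by (simp add: Gen.abs_eq[symmetric] layer_def)
next
  case (EComp g f)
  then have "upspan k (Idm a \<odot> abs_mor g \<odot> Idm b \<cdot> Idm a \<odot> abs_mor f \<odot> Idm b \<cdot> v)"
    by (simp add: Cod.abs_eq)
  then show ?case
    using EComp.prems
    by (simp add: mcomp.abs_eq[symmetric] tens_id_comp comp_assoc Cod.abs_eq Dom.abs_eq)
next
  case (ETensor f g)
  have "upspan k (Idm a \<odot> abs_mor f \<odot> Idm (tgt so3_tgt g + b)
      \<cdot> Idm (a + src so3_src f) \<odot> abs_mor g \<odot> Idm b \<cdot> v)"
    using ETensor.prems by (intro ETensor.IH) (simp_all add: Cod.abs_eq)
  moreover have "Idm a \<odot> abs_mor f \<odot> Idm (tgt so3_tgt g + b)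
      \<cdot> Idm (a + src so3_src f) \<odot> abs_mor g \<odot> Idm b = Idm a \<odot> (abs_mor f \<odot> abs_mor g) \<odot> Idm b"
  proof -
    have "Idm a \<odot> (abs_mor f \<odot> Idm (tgt so3_tgt g + b) \<cdot> Idm (src so3_src f) \<odot> abs_mor g \<odot> Idm b)
        = Idm a \<odot> abs_mor f \<odot> abs_mor g \<odot> Idm b"
      by (subst slide(2)) (simp_all add: Dom.abs_eq Cod.abs_eq)
    then show ?thesis
      by (simp add: tens_id_comp(1) tens_assoc Dom.abs_eq Cod.abs_eq)
  qed
  ultimately show ?case
    by (simp add: mtens.abs_eq[symmetric] comp_assoc[symmetric])
next
  case (EZero m n)
  then show ?case
    using upspan_typed[OF EZero.prems(2)]
    by (simp add: Zero.abs_eq[symmetric] tens_Zero comp_Zero upspan.zero)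
next
  case (EAdd f g)
  then have "upspan k (Idm a \<odot> abs_mor f \<odot> Idm b \<cdot> v \<boxplus> Idm a \<odot> abs_mor g \<odot> Idm b \<cdot> v)"
    by (intro upspan_add) (simp_all add: Cod.abs_eq)
  then show ?case
    by (simp add: madd.abs_eq[symmetric] tens_add_left tens_add_right comp_add_left)
next
  case (EScale x f)
  then show ?case by (simp add: mscale.abs_eq[symmetric] upspan_scale)
qed

lemma upspan_left:
  assumes "ok f" "upspan k v" "Cod v = Dom f"
  shows "upspan k (f \<cdot> v)"
proof -
  obtain e where e: "f = abs_mor e" by (induction f rule: mor.abs_induct) blast
  show ?thesis
    using upspan_expr[of e k v 0 0] assms by (simp add: e ok.abs_eq Dom.abs_eq)
qed

text \<open>By \<open>proj_up\<close> every word with a cup or split on top is killed, so only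
  multiples of the bare word \<open>proj k\<close> survive.\<close>

lemma proj_upspan:
  "upspan k v \<Longrightarrow> \<exists>a. proj (Cod v) \<cdot> v = (if Cod v = k then mscale a (proj k \<cdot> proj k) else Zero k (Cod v))"
proof (induction rule: upspan.induct)
  case (zero n)
  show ?case by (intro exI[of _ 0]) (simp add: comp_Zero scale_zero)
next
  case (word v w a)
  note typed = upspan_typed[OF word.hyps(1)] upword_typed[OF word.hyps(2)]
  have "\<exists>b. proj (Cod w) \<cdot> w = (if Cod w = k then mscale b (proj k \<cdot> proj k) else Zero k (Cod w))"
    using word.hyps(2)
  proof cases
    case base then show ?thesis by (intro exI[of _ 1]) simp
  next
    case (up w' g a b)
    have cod: "Cod w = a + 2 + b" using up by auto
    have "proj (Cod w) \<cdot> w = Zero k (Cod w)"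
      unfolding cod unfolding up(1) proj_up[OF up(3), THEN comp_extend]
      using upword_typed[OF up(2)] up(4) by (simp add: comp_Zero)
    then show ?thesis by (intro exI[of _ 0]) (simp add: scale_zero)
  qed
  then obtain b where "proj (Cod w) \<cdot> w = (if Cod w = k then mscale b (proj k \<cdot> proj k) else Zero k (Cod w))" by blast
  moreover obtain b' where "proj (Cod v) \<cdot> v = (if Cod v = k then mscale b' (proj k \<cdot> proj k) else Zero k (Cod v))"
    using word.IH by blast
  ultimately show ?case
    using word.hyps(3)
    by (intro exI[of _ "a * b + b'"]) (simp add: comp_add_right scale_scale add_scale)
qed

text \<open>A Schur lemma obtained from the relations alone, without passing to crystals.\<close>

lemma proj_sandwich:
  assumes "ok f" "Dom f = k" "Cod f = l"
  shows "\<exists>a. proj l \<cdot> f \<cdot> proj k = (if k = l then mscale a (proj k \<cdot> proj k) else Zero k l)"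
  using proj_upspan[OF upspan_left[OF assms(1) upspan_upword[OF upword.base[of k]]]] assms by auto

section \<open>Decomposition of the identity\<close>

text \<open>Sums of morphisms that factor through some \<open>proj k\<close>.\<close>

inductive proj_span :: "'k::field mor \<Rightarrow> bool" where
  zero: "proj_span (Zero m n)"
| sandwich: "\<lbrakk>proj_span f; ok g; ok h; Dom h = Dom f; Cod g = Cod f; Dom g = k; Cod h = k\<rbrakk>
    \<Longrightarrow> proj_span (g \<cdot> proj k \<cdot> h \<boxplus> f)"

lemma proj_span_ok: "proj_span f \<Longrightarrow> ok f"
  by (induction rule: proj_span.induct) auto

lemma proj_span_add:
  "proj_span f \<Longrightarrow> proj_span f' \<Longrightarrow> Dom f = Dom f' \<Longrightarrow> Cod f = Cod f' \<Longrightarrow> proj_span (f \<boxplus> f')"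
  by (induction rule: proj_span.induct) (auto simp: add_assoc intro: proj_span.sandwich)

lemma proj_span_comp:
  "proj_span f \<Longrightarrow> ok g \<Longrightarrow> ok h \<Longrightarrow> Dom g = Cod f \<Longrightarrow> Cod h = Dom f \<Longrightarrow> proj_span (g \<cdot> f \<cdot> h)"
proof (induction rule: proj_span.induct)
  case (zero m n) then show ?case by (simp add: comp_Zero proj_span.zero)
next
  case (sandwich f g' h' k)
  then have "proj_span ((g \<cdot> g') \<cdot> proj k \<cdot> (h' \<cdot> h) \<boxplus> g \<cdot> f \<cdot> h)"
    by (intro proj_span.sandwich) auto
  then show ?case by (simp add: comp_add_left comp_add_right comp_assoc)
qed

lemma proj_span_proj: "\<lbrakk>ok g; ok h; Dom g = k; Cod h = k\<rbrakk> \<Longrightarrow> proj_span (g \<cdot> proj k \<cdot> h)"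
  using proj_span.sandwich[OF proj_span.zero[of "Dom h" "Cod g"], of g h k] by simp

text \<open>Insert \<open>upper\<close> plus \<open>lower\<close>, which is the identity on a pair.
  The \<open>upper\<close> part extends the projection by one strand; the \<open>lower\<close> part
  factors through one or two strands fewer and is covered by the outer induction.\<close>

lemma proj_span_id: "proj_span (Idm n :: 'k::field mor)"
proof (induction n rule: less_induct)
  case (less n)
  have factor: "proj_span (g \<cdot> h)" if "ok g" "ok h" "Dom g = Cod h" "Cod h < n" for g h :: "'k mor"
    using proj_span_comp[OF less[OF that(4)] that(1,2)] that(3) by simp
  show ?case
  proof (cases n)
    case 0
    then show ?thesis using proj_span_proj[of "Idm 0" "Idm 0" 0] by simp
  next
    case (Suc N)
    \<comment> \<open>For \<open>b = 0\<close> this is the identity of \<open>n\<close> strands, for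
      \<open>a = 0\<close> it is \<open>proj n\<close>. The induction lowers \<open>a\<close> by
      trading a free strand for one more factor \<open>upper\<close>.\<close>
    have "proj_span (Idm a \<odot> proj (Suc b) :: 'k mor)" if "a + b = N" for a b
      using that
    proof (induction a arbitrary: b)
      case 0
      then show ?case using proj_span_proj[of "Idm n" "Idm n" n] by (simp add: Suc)
    next
      case (Suc a)
      have n: "n = Suc a + Suc b" using \<open>n = Suc N\<close> Suc.prems by simp
      define P :: "'k mor" where "P = Idm (Suc a) \<odot> proj (Suc b)"
      have P: "ok P" "Dom P = n" "Cod P = n" by (simp_all add: P_def n)
      have "P \<cdot> Idm a \<odot> upper \<odot> Idm b = Idm a \<odot> proj (Suc (Suc b))"
        by (simp add: P_def tens_id_comp One_nat_def)
      then have "proj_span (P \<cdot> Idm a \<odot> upper \<odot> Idm b)"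
        using Suc.IH[of "Suc b"] Suc.prems by simp
      moreover have "proj_span (P \<cdot> Idm a \<odot> lower \<odot> Idm b)"
      proof -
        have "P \<cdot> Idm a \<odot> lower \<odot> Idm b
            = (P \<cdot> layer a Split b) \<cdot> layer a Merge b \<boxplus> (P \<cdot> layer a Cup b) \<cdot> layer a Cap b"
          by (simp add: lower_def layer_def tens_id_comp tens_add_left tens_add_right comp_add_right comp_assoc)
        moreover have "proj_span ((P \<cdot> layer a Split b) \<cdot> layer a Merge b)"
          "proj_span ((P \<cdot> layer a Cup b) \<cdot> layer a Cap b)"
          using P n by (auto intro!: factor)
        ultimately show ?thesis using P by (auto intro: proj_span_add)
      qed
      ultimately have "proj_span (P \<cdot> Idm a \<odot> (upper \<boxplus> lower) \<odot> Idm b)"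
        using P n by (auto simp: tens_add_left tens_add_right comp_add_right intro: proj_span_add)
      moreover have "upper \<boxplus> lower = (Idm 2 :: 'k mor)"
        by (simp add: upper_def add_assoc add_inverse)
      ultimately show ?case using P n by (simp add: P_def)
    qed
    from this[of N 0] show ?thesis using Suc by (simp add: One_nat_def)
  qed
qed

declare One_nat_def [simp]

section \<open>The fundamental subcategory\<close>

definition tpow :: "nat \<Rightarrow> crys_obj" where "tpow n = replicate n [2]"

lemma tpow_add: "tpow (m + n) = tpow m @ tpow n"
  by (simp add: tpow_def replicate_add)

lemma tpow_0 [simp]: "tpow 0 = []" and length_tpow [simp]: "length (tpow n) = n"
  by (simp_all add: tpow_def)

lemma SO3_Crys_linear_monoidal:
  "linear_monoidal_category (SO3_Crys :: (crys_obj, 'k::field crys_mor, 'k) monoidal_data)"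
  unfolding SO3_Crys_def
  by (rule linear_monoidal_category.full_subcategory_linear_monoidal[OF sl2_Crys_linear_monoidal]) auto

lemma tensor_power_SO3: "tensor_power SO3_Crys B1 n = tpow n"
  by (induction n) (auto simp: SO3_Crys_def B1_def tpow_def)

lemma Fund_simps [simp]:
  "Obj (Fund_SO3_Crys :: (crys_obj, 'k::field crys_mor, 'k) monoidal_data) = range tpow" "Hom Fund_SO3_Crys = Hom sl2_Crys"
  "Ident Fund_SO3_Crys = Ident sl2_Crys" "Compose Fund_SO3_Crys = Compose sl2_Crys"
  "Unit Fund_SO3_Crys = []" "TensorObj Fund_SO3_Crys X Y = X @ Y"
  "TensorMor Fund_SO3_Crys = TensorMor sl2_Crys" "ZeroMor Fund_SO3_Crys = ZeroMor sl2_Crys"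
  "AddMor Fund_SO3_Crys = AddMor sl2_Crys" "ScaleMor Fund_SO3_Crys = ScaleMor sl2_Crys"
proof -
  have "range (tensor_power (SO3_Crys :: (crys_obj, 'k crys_mor, 'k) monoidal_data) B1) = range tpow"
    by (intro image_cong HOL.refl tensor_power_SO3)
  moreover have "range tpow \<subseteq> Obj SO3_Crys"
    by (auto simp: SO3_Crys_def tpow_def hw_crystal_def)
  ultimately show "Obj (Fund_SO3_Crys :: (crys_obj, 'k crys_mor, 'k) monoidal_data) = range tpow"
    by (auto simp: Fund_SO3_Crys_def)
qed (simp_all add: Fund_SO3_Crys_def SO3_Crys_def)

lemma Fund_linear_monoidal:
  "linear_monoidal_category (Fund_SO3_Crys :: (crys_obj, 'k::field crys_mor, 'k) monoidal_data)"
  unfolding Fund_SO3_Crys_def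
proof (rule linear_monoidal_category.full_subcategory_linear_monoidal[OF SO3_Crys_linear_monoidal], goal_cases)
  case 1
  show ?case by (rule image_eqI[of _ _ 0]) simp_all
next
  case (2 X Y)
  then obtain m n where "X = tpow m" "Y = tpow n" by (auto simp: tensor_power_SO3)
  then show ?case
    by (intro image_eqI[of _ _ "m + n"]) (simp_all add: tensor_power_SO3 tpow_add, simp add: SO3_Crys_def)
qed

lemma tensor_power_Fund: "tensor_power Fund_SO3_Crys B1 n = tpow n"
  by (induction n) (auto simp: B1_def tpow_def)

section \<open>Tensor powers of the three-element crystal\<close>

abbreviation B1_crystal :: "(nat \<times> nat) crystal" where
  "B1_crystal \<equiv> sum_crystal [hw_crystal 2]"

definition tcrys :: "nat \<Rightarrow> crys_elem crystal" where "tcrys n = obj_crystal (tpow n)"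

lemma tcrys_word: "tcrys n = word_crystal (replicate n B1_crystal)"
  by (simp add: tcrys_def obj_crystal_def tpow_def)

lemma tcrys_sl2: "sl2_crystal (tcrys n)"
  unfolding tcrys_def by (rule obj_crystal_sl2)

lemma B1_crystal_sl2: "sl2_crystal B1_crystal"
  by (rule sum_crystal_sl2) (auto simp: hw_crystal_sl2)

lemma B1_crystal_elems: "elems B1_crystal = {(0, 0), (0, 1), (0, 2)}"
  by (auto simp: sum_crystal_def hw_crystal_def)

lemma B1_crystal_ops:
  "wt B1_crystal (0, j) = 2 - 2 * int j"
  "e_op B1_crystal (0, j) = (if 0 < j \<and> j \<le> 2 then Some (0, j - 1) else None)"
  "f_op B1_crystal (0, j) = (if j < 2 then Some (0, j + 1) else None)"
  by (auto simp: sum_crystal_def hw_crystal_def)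

lemma B1_crystal_eps_phi:
  assumes "j \<le> 2"
  shows "eps B1_crystal (0, j) = j" "phi B1_crystal (0, j) = 2 - j"
proof -
  interpret sl2_crystal B1_crystal by (rule B1_crystal_sl2)
  have mem: "(0, j) \<in> elems B1_crystal" using assms by (auto simp: B1_crystal_elems)
  show "eps B1_crystal (0, j) = j"
    using eps_unique[of snd "(0, j)"] mem
    by (fastforce simp: B1_crystal_elems B1_crystal_ops split: if_splits)
  show "phi B1_crystal (0, j) = 2 - j"
    using phi_unique[of "\<lambda>b. 2 - snd b" "(0, j)"] mem
    by (fastforce simp: B1_crystal_elems B1_crystal_ops split: if_splits)
qed

lemma elems_tcrys:
  "elems (tcrys 0) = {[]}"
  "elems (tcrys (Suc n)) = {(0, j) # b | j b. j \<le> 2 \<and> b \<in> elems (tcrys n)}"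
proof -
  have "elems B1_crystal = {(0, j) | j. j \<le> 2}" by (auto simp: sum_crystal_def hw_crystal_def)
  then show "elems (tcrys 0) = {[]}"
    "elems (tcrys (Suc n)) = {(0, j) # b | j b. j \<le> 2 \<and> b \<in> elems (tcrys n)}"
    unfolding tcrys_word replicate_Suc replicate_0 word_crystal_Cons_simps(1) by auto
qed

lemma tcrys_Cons:
  assumes "j \<le> 2" "b \<in> elems (tcrys n)"
  shows "wt (tcrys (Suc n)) ((0, j) # b) = 2 - 2 * int j + wt (tcrys n) b"
    and "e_op (tcrys (Suc n)) ((0, j) # b) =
      (if 2 - j \<ge> eps (tcrys n) b then (if 0 < j then Some ((0, j - 1) # b) else None)
       else map_option (Cons (0, j)) (e_op (tcrys n) b))"
    and "f_op (tcrys (Suc n)) ((0, j) # b) =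
      (if 2 - j > eps (tcrys n) b then (if j < 2 then Some ((0, j + 1) # b) else None)
       else map_option (Cons (0, j)) (f_op (tcrys n) b))"
    and "eps (tcrys (Suc n)) ((0, j) # b) = j + (eps (tcrys n) b - (2 - j))"
    and "phi (tcrys (Suc n)) ((0, j) # b) = phi (tcrys n) b + (2 - j - eps (tcrys n) b)"
proof -
  have j: "(0, j) \<in> elems B1_crystal" using assms(1) by (auto simp: sum_crystal_def hw_crystal_def)
  have "sl2_crystal B" if "B \<in> set (B1_crystal # replicate n B1_crystal)" for B
    using that B1_crystal_sl2 by (auto split: if_splits)
  note eps_phi = word_crystal_eps_phi_Cons[OF this j assms(2)[unfolded tcrys_word]]
  note simps = B1_crystal_ops B1_crystal_eps_phi[OF assms(1)]
  show "wt (tcrys (Suc n)) ((0, j) # b) = 2 - 2 * int j + wt (tcrys n) b"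
    by (simp add: tcrys_word simps)
  show "e_op (tcrys (Suc n)) ((0, j) # b) =
      (if 2 - j \<ge> eps (tcrys n) b then (if 0 < j then Some ((0, j - 1) # b) else None)
       else map_option (Cons (0, j)) (e_op (tcrys n) b))"
    using assms(1) by (simp add: tcrys_word simps)
  show "f_op (tcrys (Suc n)) ((0, j) # b) =
      (if 2 - j > eps (tcrys n) b then (if j < 2 then Some ((0, j + 1) # b) else None)
       else map_option (Cons (0, j)) (f_op (tcrys n) b))"
    by (simp add: tcrys_word simps)
  show "eps (tcrys (Suc n)) ((0, j) # b) = j + (eps (tcrys n) b - (2 - j))"
    "phi (tcrys (Suc n)) ((0, j) # b) = phi (tcrys n) b + (2 - j - eps (tcrys n) b)"
    using eps_phi by (simp_all add: tcrys_word simps)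
qed

lemma tcrys_Nil: "wt (tcrys 0) [] = 0" "e_op (tcrys 0) [] = None" "f_op (tcrys 0) [] = None"
  "eps (tcrys 0) [] = 0" "phi (tcrys 0) [] = 0"
  using sl2_crystal.eps_None[OF tcrys_sl2, of 0 "[]"] sl2_crystal.phi_None[OF tcrys_sl2, of 0 "[]"]
  by (simp_all add: tcrys_word)

text \<open>With \<open>(0, j)\<close> written as \<open>j\<close>, the word 02 is the trivial
  component of the tensor square, and 01, 11, 12 is the copy of \<open>B(2 \<omega>\<^sub>1)\<close>
  in the order of \<open>f\<close>. The cap and the merge project onto these components, the cup and
  the split include them.\<close>

fun gen_map :: "so3_gen \<Rightarrow> crys_elem \<Rightarrow> crys_elem option" where
  "gen_map Cap b = (if b = [(0, 0), (0, 2)] then Some [] else None)"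
| "gen_map Cup b = (if b = [] then Some [(0, 0), (0, 2)] else None)"
| "gen_map Merge b =
    (if b = [(0, 0), (0, 1)] then Some [(0, 0)] else
     if b = [(0, 1), (0, 1)] then Some [(0, 1)] else
     if b = [(0, 1), (0, 2)] then Some [(0, 2)] else None)"
| "gen_map Split b =
    (if b = [(0, 0)] then Some [(0, 0), (0, 1)] else
     if b = [(0, 1)] then Some [(0, 1), (0, 1)] else
     if b = [(0, 2)] then Some [(0, 1), (0, 2)] else None)"

definition pmat :: "('b \<Rightarrow> 'c option) \<Rightarrow> 'b \<Rightarrow> 'c \<Rightarrow> 'k::field" where
  "pmat \<psi> b c = (if \<psi> b = Some c then 1 else 0)"

lemma tcrys_elems:
  "b \<in> elems (tcrys 0) \<longleftrightarrow> b = []"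
  "b \<in> elems (tcrys 1) \<longleftrightarrow> b \<in> {[(0, 0)], [(0, 1)], [(0, 2)]}"
  "b \<in> elems (tcrys 2) \<longleftrightarrow> b \<in> {[(0, 0), (0, 0)], [(0, 0), (0, 1)], [(0, 0), (0, 2)],
    [(0, 1), (0, 0)], [(0, 1), (0, 1)], [(0, 1), (0, 2)], [(0, 2), (0, 0)], [(0, 2), (0, 1)], [(0, 2), (0, 2)]}"
  by (auto simp: elems_tcrys numeral_2_eq_2 le_Suc_eq)

lemma tcrys_1_ops:
  assumes "j \<le> 2"
  shows "wt (tcrys 1) [(0, j)] = 2 - 2 * int j"
    and "e_op (tcrys 1) [(0, j)] = (if 0 < j then Some [(0, j - 1)] else None)"
    and "f_op (tcrys 1) [(0, j)] = (if j < 2 then Some [(0, j + 1)] else None)"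
    and "eps (tcrys 1) [(0, j)] = j"
  using assms tcrys_Cons[of j "[]" 0] by (auto simp: tcrys_Nil elems_tcrys)

lemma tcrys_2_ops:
  assumes "i \<le> 2" "j \<le> 2"
  shows "wt (tcrys 2) [(0, i), (0, j)] = 4 - 2 * int i - 2 * int j"
    and "e_op (tcrys 2) [(0, i), (0, j)] =
      (if i + j \<le> 2 then (if 0 < i then Some [(0, i - 1), (0, j)] else None) else Some [(0, i), (0, j - 1)])"
    and "f_op (tcrys 2) [(0, i), (0, j)] =
      (if i + j < 2 then Some [(0, i + 1), (0, j)] else if j < 2 then Some [(0, i), (0, j + 1)] else None)"
  using assms tcrys_Cons[of i "[(0, j)]" 1] tcrys_1_ops[OF assms(2)]
  by (auto simp: elems_tcrys numeral_2_eq_2 split: if_splits)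

text \<open>Finite checks for the cap and the merge; the cup and the split have the transposed
  matrices.\<close>

lemma gen_map_intertwiner:
  "intertwiner (tcrys (so3_src g)) (tcrys (so3_tgt g)) (pmat (gen_map g) :: _ \<Rightarrow> _ \<Rightarrow> 'k::field)"
proof -
  let ?M = "\<lambda>g. pmat (gen_map g) :: _ \<Rightarrow> _ \<Rightarrow> 'k"
  have cap: "intertwiner (tcrys 2) (tcrys 0) (?M Cap)"
    unfolding intertwiner_def
    by (intro conjI allI impI ballI; (unfold tcrys_elems)?;
        auto simp: pmat_def tcrys_2_ops tcrys_Nil split: if_splits)
  have merge: "intertwiner (tcrys 2) (tcrys 1) (?M Merge)"
    unfolding intertwiner_def
    by (intro conjI allI impI ballI; (unfold tcrys_elems)?;
        auto simp: pmat_def tcrys_2_ops tcrys_1_ops tcrys_1_ops[unfolded One_nat_def] split: if_splits)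
  have "intertwiner (tcrys 0) (tcrys 2) (?M Cup)"
  proof -
    have "gen_map Cup b = Some c \<longleftrightarrow> gen_map Cap c = Some b" for b c by auto
    then show ?thesis using intertwiner_transpose[OF cap] by (simp add: pmat_def[abs_def] del: gen_map.simps)
  qed
  moreover have "intertwiner (tcrys 1) (tcrys 2) (?M Split)"
  proof -
    have "gen_map Split b = Some c \<longleftrightarrow> gen_map Merge c = Some b" for b c by auto
    then show ?thesis using intertwiner_transpose[OF merge] by (simp add: pmat_def[abs_def] del: gen_map.simps)
  qed
  ultimately show ?thesis using cap merge by (cases g) simp_all
qed

section \<open>Interpretation of the generators\<close>

definition gen_mor :: "so3_gen \<Rightarrow> 'k::field crys_mor" where
  "gen_mor g = (tpow (so3_src g), tpow (so3_tgt g), pmat (gen_map g))"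

abbreviation ev :: "('k::field, so3_gen) expr \<Rightarrow> 'k crys_mor" where
  "ev \<equiv> interp Fund_SO3_Crys B1 gen_mor so3_src so3_tgt"

interpretation Fund: linear_monoidal_category
  "Fund_SO3_Crys :: (crys_obj, 'k::field crys_mor, 'k) monoidal_data"
  by (rule Fund_linear_monoidal)

lemma B1_Obj: "B1 \<in> Obj Fund_SO3_Crys"
  by (auto simp: B1_def tpow_def intro!: image_eqI[of _ _ 1])

lemma gen_mor_hom:
  "gen_mor g \<in> Hom Fund_SO3_Crys (tensor_power Fund_SO3_Crys B1 (so3_src g)) (tensor_power Fund_SO3_Crys B1 (so3_tgt g))"
  using gen_map_intertwiner[of g] by (simp add: tensor_power_Fund gen_mor_def sl2_Crys_Hom tcrys_def)

lemma ev_hom: "so3_wf f \<Longrightarrow> ev f \<in> Hom sl2_Crys (tpow (src so3_src f)) (tpow (tgt so3_tgt f))"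
  using Fund.interp_hom[OF B1_Obj gen_mor_hom, where f = f] by (simp add: tensor_power_Fund)

text \<open>
  Apart from scalars, the sides of the relations act by partial maps on the basis, which reduces
  the relations to finite checks.
\<close>

fun pmap :: "('k, so3_gen) expr \<Rightarrow> crys_elem \<Rightarrow> crys_elem option" where
  "pmap (EId n) b = (if b \<in> elems (tcrys n) then Some b else None)"
| "pmap (EGen g) b = gen_map g b"
| "pmap (g \<bullet> f) b = Option.bind (pmap f b) (pmap g)"
| "pmap (f \<otimes> g) b = Option.bind (pmap f (take (src so3_src f) b))
     (\<lambda>c. map_option ((@) c) (pmap g (drop (src so3_src f) b)))"
| "pmap (EZero m n) b = None"
| "pmap (f \<oplus> g) b = (case pmap f b of None \<Rightarrow> pmap g b | Some c \<Rightarrow> Some c)"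
| "pmap (EScale a f) b = None"

text \<open>Scalings are excluded and sums must have disjoint supports, so that the matrix stays
  that of a partial map. The only sum in the relations, \<open>lower\<close>, meets this
  condition.\<close>

fun monomial :: "('k, so3_gen) expr \<Rightarrow> bool" where
  "monomial (g \<bullet> f) \<longleftrightarrow> monomial g \<and> monomial f"
| "monomial (f \<otimes> g) \<longleftrightarrow> monomial f \<and> monomial g"
| "monomial (f \<oplus> g) \<longleftrightarrow> monomial f \<and> monomial g \<and> (\<forall>b. pmap f b = None \<or> pmap g b = None)"
| "monomial (EScale a f) \<longleftrightarrow> False"
| "monomial _ \<longleftrightarrow> True"

lemma length_tcrys: "b \<in> elems (tcrys n) \<Longrightarrow> length b = n"
  using length_obj_crystal[of b "tpow n"] by (simp add: tcrys_def)

lemma finite_tcrys [simp]: "finite (elems (tcrys n))"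
  by (simp add: tcrys_def)

lemma in_tcrys_add:
  "b \<in> elems (tcrys (m + n)) \<longleftrightarrow> take m b \<in> elems (tcrys m) \<and> drop m b \<in> elems (tcrys n)"
  using in_obj_crystal_append[of b "tpow m" "tpow n"] by (simp add: tcrys_def tpow_add)

lemma gen_map_Some:
  "gen_map g b = Some c \<Longrightarrow> b \<in> elems (tcrys (so3_src g)) \<and> c \<in> elems (tcrys (so3_tgt g))"
  by (cases g) (auto simp: tcrys_elems tcrys_elems[unfolded One_nat_def] split: if_splits)

lemma pmap_Some:
  "so3_wf e \<Longrightarrow> pmap e b = Some c \<Longrightarrow>
    b \<in> elems (tcrys (src so3_src e)) \<and> c \<in> elems (tcrys (tgt so3_tgt e))"
proof (induction e arbitrary: b c)
  case (EComp g f)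
  then show ?case by (fastforce simp: bind_eq_Some_conv)
next
  case (ETensor f g)
  from ETensor.prems(2) obtain c1 c2 where c: "c = c1 @ c2" "pmap f (take (src so3_src f) b) = Some c1"
    "pmap g (drop (src so3_src f) b) = Some c2"
    by (auto simp: bind_eq_Some_conv)
  then have "take (src so3_src f) b \<in> elems (tcrys (src so3_src f))" "c1 \<in> elems (tcrys (tgt so3_tgt f))"
    "drop (src so3_src f) b \<in> elems (tcrys (src so3_src g))" "c2 \<in> elems (tcrys (tgt so3_tgt g))"
    using ETensor by auto
  then show ?case using length_tcrys[of c1] by (simp add: in_tcrys_add c(1))
next
  case (EGen g)
  then show ?case using gen_map_Some by (auto simp del: gen_map.simps)
qed (auto split: if_splits option.splits)

lemma ev_pmap:
  fixes e :: "('k::field, so3_gen) expr"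
  shows "so3_wf e \<Longrightarrow> monomial e \<Longrightarrow> ev e = (tpow (src so3_src e), tpow (tgt so3_tgt e), pmat (pmap e))"
proof (induction e)
  case (EId n)
  then show ?case by (auto simp: tensor_power_Fund tcrys_def pmat_def fun_eq_iff)
next
  case (EGen g)
  have "pmap (EGen g) = gen_map g" by (simp add: fun_eq_iff del: gen_map.simps)
  then show ?case by (simp add: gen_mor_def)
next
  case (EComp g f)
  have "(\<Sum>c\<in>elems (tcrys (src so3_src g)). pmat (pmap f) b c * pmat (pmap g) c d)
      = (pmat (\<lambda>b. Option.bind (pmap f b) (pmap g)) b d :: 'k)" for b d
  proof (cases "pmap f b")
    case (Some c)
    then have "c \<in> elems (tcrys (src so3_src g))" using pmap_Some[of f b c] EComp.prems by auto
    moreover have "(\<Sum>c\<in>elems (tcrys (src so3_src g)). pmat (pmap f) b c * pmat (pmap g) c d)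
        = (\<Sum>c'\<in>elems (tcrys (src so3_src g)). if c' = c then pmat (pmap g) c d else 0)"
      using Some by (intro sum.cong) (auto simp: pmat_def)
    ultimately show ?thesis using Some by (simp add: pmat_def)
  qed (simp add: pmat_def)
  then show ?case using EComp by (simp add: fun_eq_iff tcrys_def)
next
  case (ETensor f g)
  have "pmat (pmap f) (take (src so3_src f) b) (take (tgt so3_tgt f) c)
      * pmat (pmap g) (drop (src so3_src f) b) (drop (tgt so3_tgt f) c) = (pmat (pmap (f \<otimes> g)) b c :: 'k)" for b c
  proof (cases "pmap f (take (src so3_src f) b)")
    case (Some c1)
    then have "length c1 = tgt so3_tgt f"
      using pmap_Some[of f _ c1] ETensor.prems length_tcrys by fastforce
    then have "c1 = take (tgt so3_tgt f) c \<and> c2 = drop (tgt so3_tgt f) c \<longleftrightarrow> c1 @ c2 = c" for c2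
      by auto
    then show ?thesis using Some by (cases "pmap g (drop (src so3_src f) b)") (auto simp: pmat_def)
  qed (simp add: pmat_def)
  then show ?case using ETensor by (simp add: fun_eq_iff tpow_add del: pmap.simps)
next
  case (EZero m n)
  then show ?case by (simp add: tensor_power_Fund pmat_def fun_eq_iff)
next
  case (EAdd f g)
  then have disj: "pmap f b = None \<or> pmap g b = None" for b by simp
  have "pmat (pmap f) b c + pmat (pmap g) b c = (pmat (pmap (f \<oplus> g)) b c :: 'k)" for b c
    using disj[of b] by (auto simp: pmat_def split: option.splits)
  then show ?case using EAdd by (simp add: fun_eq_iff del: pmap.simps)
next
  case (EScale a f)
  then show ?case by simp
qed

lemma ev_eqI:
  assumes "so3_wf f" "so3_wf g" "monomial f" "monomial g" "src so3_src f = src so3_src g"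
    "tgt so3_tgt f = tgt so3_tgt g" "\<forall>b\<in>elems (tcrys (src so3_src f)). pmap f b = pmap g b"
  shows "ev f = ev g"
proof -
  have "pmap f b = pmap g b" for b
    using assms pmap_Some[of f b] pmap_Some[of g b] by (cases "pmap f b"; cases "pmap g b") auto
  then have "pmap f = pmap g" by blast
  then show ?thesis using assms by (simp add: ev_pmap)
qed

lemma ball_tcrys:
  "(\<forall>b\<in>elems (tcrys 0). P b) \<longleftrightarrow> P []"
  "(\<forall>b\<in>elems (tcrys (Suc n)). P b) \<longleftrightarrow>
    (\<forall>b\<in>elems (tcrys n). P ((0, 0) # b) \<and> P ((0, 1) # b) \<and> P ((0, 2) # b))"
  by (auto simp: elems_tcrys le_Suc_eq numeral_2_eq_2)

lemma Cons_in_tcrys: "a # b \<in> elems (tcrys (Suc n)) \<longleftrightarrow> fst a = 0 \<and> snd a \<le> 2 \<and> b \<in> elems (tcrys n)"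
  by (cases a) (auto simp: elems_tcrys)

lemma Nil_in_tcrys: "[] \<in> elems (tcrys 0)"
  by (simp add: elems_tcrys)

text \<open>Each relation and each reflection compares two partial maps on at most 27 words.\<close>

lemma ev_base_relations:
  "\<forall>(f, g)\<in>so3_base_relations. ev f = ev g \<and> ev (reflect f) = ev (reflect g)"
  unfolding so3_base_relations_def Let_def
  by (intro ballI; elim insertE emptyE; hypsubst; simp only: prod.case reflect.simps gen_reflect.simps;
      intro conjI; rule ev_eqI; simp add: ball_tcrys Cons_in_tcrys Nil_in_tcrys numeral_2_eq_2)

lemma ev_cong: "so3_eq f g \<Longrightarrow> ev f = ev g"
  by (rule Fund.interp_cong[OF B1_Obj gen_mor_hom])
    (use ev_base_relations in \<open>auto simp: so3_relations_def\<close>)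

section \<open>Matrices of morphisms\<close>

text \<open>The representative is arbitrary; for a well-formed morphism \<open>ev_cong\<close> makes
  the matrix independent of it.\<close>

definition mat :: "'k::field mor \<Rightarrow> crys_elem \<Rightarrow> crys_elem \<Rightarrow> 'k" where
  "mat f = snd (snd (ev (rep_mor f)))"

lemma mor_cases:
  obtains e where "f = abs_mor e"
  by (induction f rule: mor.abs_induct) blast

lemma ev_mat: "so3_wf e \<Longrightarrow> ev e = (tpow (src so3_src e), tpow (tgt so3_tgt e), mat (abs_mor e))"
proof -
  assume e: "so3_wf e"
  have "so3_equiv (rep_mor (abs_mor e)) e"
    by (rule Quotient_rep_abs[OF Quotient_mor]) (use e in \<open>simp add: so3_equiv_iff expr_eq.refl\<close>)
  then have "ev (rep_mor (abs_mor e)) = ev e"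
    using e so3_equiv_iff[of "rep_mor (abs_mor e)" e] so3_equiv_wf ev_cong by blast
  moreover obtain M where "ev e = (tpow (src so3_src e), tpow (tgt so3_tgt e), M)"
    using ev_hom[OF e] by (auto simp: sl2_Crys_Hom)
  ultimately show ?thesis by (simp add: mat_def)
qed

lemma mat_intertwiner:
  assumes "ok f"
  shows "intertwiner (tcrys (Dom f)) (tcrys (Cod f)) (mat f)"
proof (cases f rule: mor_cases)
  case (1 e)
  then have "so3_wf e" using assms by (simp add: ok.abs_eq)
  from ev_hom[OF this] show ?thesis
    unfolding ev_mat[OF \<open>so3_wf e\<close>] 1 by (simp add: sl2_Crys_Hom Dom.abs_eq Cod.abs_eq tcrys_def)
qed

definition diag :: "nat \<Rightarrow> (crys_elem \<Rightarrow> bool) \<Rightarrow> crys_elem \<Rightarrow> crys_elem \<Rightarrow> 'k::field" where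
  "diag n P b c = (if b \<in> elems (tcrys n) \<and> c = b \<and> P b then 1 else 0)"

lemma mat_Idm: "mat (Idm n) = (diag n (\<lambda>_. True) :: _ \<Rightarrow> _ \<Rightarrow> 'k::field)"
  using ev_mat[of "EId n :: ('k, so3_gen) expr"]
  by (simp add: Idm.abs_eq[symmetric] tensor_power_Fund diag_def fun_eq_iff tcrys_def)

lemma mat_comp:
  assumes "ok g" "ok f" "Dom g = Cod f"
  shows "mat (g \<cdot> f) b d = (\<Sum>c\<in>elems (tcrys (Cod f)). mat f b c * mat g c d)"
proof (cases f rule: mor_cases)
  case f: (1 e)
  show ?thesis
  proof (cases g rule: mor_cases)
    case (1 e')
    then show ?thesis
      using assms f ev_mat[of "e' \<bullet> e"] ev_mat[of e] ev_mat[of e']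
      by (simp add: ok.abs_eq Dom.abs_eq Cod.abs_eq mcomp.abs_eq tcrys_def fun_eq_iff)
  qed
qed

lemma mat_tens:
  assumes "ok f" "ok g"
  shows "mat (f \<odot> g) b c = mat f (take (Dom f) b) (take (Cod f) c) * mat g (drop (Dom f) b) (drop (Cod f) c)"
proof (cases f rule: mor_cases)
  case f: (1 e)
  show ?thesis
  proof (cases g rule: mor_cases)
    case (1 e')
    then show ?thesis
      using assms f ev_mat[of "e \<otimes> e'"] ev_mat[of e] ev_mat[of e']
      by (simp add: ok.abs_eq Dom.abs_eq Cod.abs_eq mtens.abs_eq fun_eq_iff)
  qed
qed

lemma mat_add:
  assumes "ok (f \<boxplus> g)"
  shows "mat (f \<boxplus> g) b c = mat f b c + mat g b c"
proof (cases f rule: mor_cases)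
  case f: (1 e)
  show ?thesis
  proof (cases g rule: mor_cases)
    case (1 e')
    then show ?thesis
      using assms f ev_mat[of "e \<oplus> e'"] ev_mat[of e] ev_mat[of e']
      by (simp add: ok.abs_eq Dom.abs_eq Cod.abs_eq madd.abs_eq fun_eq_iff)
  qed
qed

lemma mat_scale:
  assumes "ok f"
  shows "mat (mscale a f) b c = a * mat f b c"
proof (cases f rule: mor_cases)
  case (1 e)
  then show ?thesis
    using assms ev_mat[of "EScale a e"] ev_mat[of e]
    by (simp add: ok.abs_eq mscale.abs_eq fun_eq_iff)
qed

lemma mat_Zero: "mat (Zero m n) b c = (0::'k::field)"
  using ev_mat[of "EZero m n :: ('k, so3_gen) expr"] by (simp add: Zero.abs_eq[symmetric] tensor_power_Fund fun_eq_iff)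

lemma mat_pmap:
  "so3_wf e \<Longrightarrow> monomial e \<Longrightarrow> mat (abs_mor e) = pmat (pmap e)"
  using ev_mat[of e] ev_pmap[of e] by simp

section \<open>The matrices of the projections\<close>

lemma diag_tens:
  assumes "ok f" "ok g" "mat f = diag m P" "mat g = diag n Q" "Dom f = m" "Cod f = m"
  shows "mat (f \<odot> g) = diag (m + n) (\<lambda>b. P (take m b) \<and> Q (drop m b))"
proof -
  have "take m c = take m b \<and> drop m c = drop m b \<longleftrightarrow> c = b" for b c :: crys_elem
    by (metis append_take_drop_id)
  then show ?thesis
    using assms by (auto simp: fun_eq_iff mat_tens diag_def in_tcrys_add)
qed

lemma sum_diag_left:
  "(\<Sum>c\<in>elems (tcrys n). diag n P b c * v c) = (if b \<in> elems (tcrys n) \<and> P b then v b else 0)"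
proof (cases "b \<in> elems (tcrys n) \<and> P b")
  case True
  have "(\<Sum>c\<in>elems (tcrys n). diag n P b c * v c) = (\<Sum>c\<in>elems (tcrys n). if c = b then v c else 0)"
    using True by (intro sum.cong) (auto simp: diag_def)
  then show ?thesis using True by simp
qed (auto simp: diag_def)

lemma sum_diag_right:
  "(\<Sum>c\<in>elems (tcrys n). v c * diag n P c d) = (if d \<in> elems (tcrys n) \<and> P d then v d else 0)"
proof -
  have "(\<Sum>c\<in>elems (tcrys n). v c * diag n P c d)
      = (\<Sum>c\<in>elems (tcrys n). if c = d then (if P d then v d else 0) else 0)"
    by (intro sum.cong) (auto simp: diag_def)
  then show ?thesis by simp
qed

lemma diag_comp:
  assumes "ok f" "ok g" "mat f = diag n P" "mat g = diag n Q" "Cod f = n" "Dom g = n"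
  shows "mat (g \<cdot> f) = diag n (\<lambda>b. P b \<and> Q b)"
  using assms by (auto simp: fun_eq_iff mat_comp sum_diag_left) (auto simp: diag_def)

definition upper_pair :: "crys_elem \<Rightarrow> bool" where
  "upper_pair b \<longleftrightarrow> gen_map Merge b = None \<and> gen_map Cap b = None"

lemma mat_upper: "mat upper = diag 2 upper_pair"
proof -
  let ?e = "(EGen Split \<bullet> EGen Merge) \<oplus> (EGen Cup \<bullet> EGen Cap) :: ('a, so3_gen) expr"
  have low: "lower = abs_mor ?e"
    unfolding lower_def by (simp add: Gen.abs_eq mcomp.abs_eq madd.abs_eq)
  \<comment> \<open>The split inverts the merge on its support and the cup inverts the cap, so
    \<open>lower\<close> acts as the identity where one of merge and cap is defined and as zero
    elsewhere.\<close>
  have "mat lower b c = (if c = b \<and> \<not> upper_pair b then 1 else 0 :: 'a)" for b c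
    unfolding low by (subst mat_pmap) (auto simp: pmat_def upper_pair_def)
  moreover have "upper_pair b" if "b \<notin> elems (tcrys 2)" for b
    using that gen_map_Some[of Merge b] gen_map_Some[of Cap b] unfolding upper_pair_def
    by (cases "gen_map Merge b"; cases "gen_map Cap b") auto
  ultimately show ?thesis
    by (auto simp: upper_def fun_eq_iff mat_add mat_scale mat_Idm diag_def)
qed

text \<open>With \<open>(0, j)\<close> written as \<open>j\<close>, the good words in
  \<open>tcrys n\<close> consist of 2s, then at most one 1, then 0s. There are \<open>2n + 1\<close>
  of them, the size of the top component.\<close>

fun good :: "crys_elem \<Rightarrow> bool" where
  "good (a # b # r) \<longleftrightarrow> upper_pair [a, b] \<and> good (b # r)"
| "good _ \<longleftrightarrow> True"

lemma diag_cong: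
  "(\<And>b. b \<in> elems (tcrys n) \<Longrightarrow> P b = Q b) \<Longrightarrow> diag n P = diag n Q"
  by (auto simp: diag_def fun_eq_iff)

lemma mat_proj: "mat (proj n :: 'k::field mor) = diag n good"
proof (induction n rule: proj.induct)
  case 1
  show ?case unfolding proj.simps mat_Idm by (rule diag_cong) (simp add: elems_tcrys)
next
  case 2
  show ?case unfolding proj.simps mat_Idm One_nat_def
    by (rule diag_cong) (auto simp: elems_tcrys)
next
  case (3 n)
  have "mat (Idm 1 \<odot> proj (Suc n) :: 'k mor) = diag (1 + Suc n) (\<lambda>b. True \<and> good (drop 1 b))"
    by (rule diag_tens[OF _ _ mat_Idm 3]) simp_all
  moreover have "mat (upper \<odot> Idm n :: 'k mor) = diag (2 + n) (\<lambda>b. upper_pair (take 2 b) \<and> True)"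
    by (rule diag_tens[OF _ _ mat_upper mat_Idm]) simp_all
  ultimately have "mat (proj (Suc (Suc n)) :: 'k mor) = diag (Suc (Suc n)) (\<lambda>b. upper_pair (take 2 b) \<and> good (drop 1 b))"
    by (subst proj.simps, subst diag_comp) auto
  also have "\<dots> = diag (Suc (Suc n)) good"
    by (rule diag_cong) (auto simp: elems_tcrys numeral_2_eq_2)
  finally show ?case .
qed

section \<open>Highest weight elements\<close>

abbreviation highest :: "nat \<Rightarrow> crys_elem" where "highest n \<equiv> replicate n (0, 0)"

lemma highest_ops:
  "highest n \<in> elems (tcrys n) \<and> wt (tcrys n) (highest n) = 2 * int n \<and>
    e_op (tcrys n) (highest n) = None \<and> eps (tcrys n) (highest n) = 0"
proof (induction n)
  case 0
  show ?case by (simp add: elems_tcrys tcrys_Nil)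
next
  case (Suc n)
  then show ?case using tcrys_Cons[of 0 "highest n" n] by (auto simp: Cons_in_tcrys)
qed

lemma good_highest: "good (highest n)"
proof (induction n rule: proj.induct)
  case (3 n)
  then show ?case by (simp add: upper_pair_def)
qed simp_all

lemma good_zero: "good ((0, 0) # b) \<Longrightarrow> b \<in> elems (tcrys n) \<Longrightarrow> b = highest n"
proof (induction n arbitrary: b)
  case 0
  then show ?case by (simp add: elems_tcrys)
next
  case (Suc n)
  then obtain j r where b: "b = (0, j) # r" "j \<le> 2" "r \<in> elems (tcrys n)" by (auto simp: elems_tcrys)
  have "j = 0" using Suc.prems(1) b(2) by (auto simp: b(1) upper_pair_def le_Suc_eq numeral_2_eq_2 split: if_splits)
  then show ?case using Suc b by simp
qed

text \<open>If \<open>e\<close> is undefined on a word, its first letter is 0; in a good word only 0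
  can follow 0. So the top component has a single highest weight element.\<close>

lemma good_highest_weight:
  assumes "b \<in> elems (tcrys n)" "e_op (tcrys n) b = None" "good b"
  shows "b = highest n"
proof (cases n)
  case 0
  then show ?thesis using assms by (simp add: elems_tcrys)
next
  case (Suc k)
  then obtain j r where b: "b = (0, j) # r" "j \<le> 2" "r \<in> elems (tcrys k)"
    using assms by (auto simp: elems_tcrys)
  have "j = 0"
    using assms(2) sl2_crystal.eps_None[OF tcrys_sl2, of k r]
    unfolding Suc b(1) tcrys_Cons(2)[OF b(2,3)] by (auto split: if_splits)
  then show ?thesis using assms(3) good_zero[of r k] b Suc by simp
qed

section \<open>Faithfulness\<close>

lemma mat_comp_zero:
  assumes "ok g" "ok f" "Dom g = Cod f" "(\<forall>b c. mat f b c = 0) \<or> (\<forall>b c. mat g b c = 0)"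
  shows "mat (g \<cdot> f) b d = 0"
  using assms by (auto simp: mat_comp intro: sum.neutral)

text \<open>The scalar from \<open>proj_sandwich\<close> is read off at the entry of
  \<open>highest k\<close>, where the square of \<open>proj k\<close> has entry 1.\<close>

lemma proj_sandwich_zero:
  fixes f :: "'k::field mor"
  assumes f: "ok f" and zero: "\<forall>b c. mat f b c = 0"
  shows "proj (Cod f) \<cdot> f \<cdot> proj (Dom f) = Zero (Dom f) (Cod f)"
proof -
  define k where "k = Dom f"
  obtain a where a: "proj (Cod f) \<cdot> f \<cdot> proj k = (if k = Cod f then mscale a (proj k \<cdot> proj k) else Zero k (Cod f))"
    using proj_sandwich[OF f, of k "Cod f"] by (auto simp: k_def)
  show ?thesis
  proof (cases "k = Cod f")
    case True
    have "mat (proj k \<cdot> f \<cdot> proj k) (highest k) (highest k) = 0"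
      using f zero True by (intro mat_comp_zero) (auto simp: mat_comp_zero k_def)
    moreover have "mat (proj k \<cdot> proj k :: 'k mor) = diag k (\<lambda>b. good b \<and> good b)"
      by (rule diag_comp[OF _ _ mat_proj mat_proj]) simp_all
    ultimately have "a = 0"
      using a True highest_ops[of k] good_highest[of k] by (simp add: mat_scale diag_def)
    then show ?thesis using a True by (simp add: scale_zero k_def)
  qed (use a in \<open>simp add: k_def\<close>)
qed

text \<open>First half of a two-sided expansion: \<open>y\<close> becomes the identity of the
  domain, and \<open>g\<close> is absorbed into \<open>f\<close>, whose matrix stays zero.
  \<open>proj_span_comp_zero\<close> does the same on the other side.\<close>

lemma proj_comp_zero:
  "proj_span y \<Longrightarrow> ok f \<Longrightarrow> \<forall>b c. mat f b c = 0 \<Longrightarrow> Cod y = Dom f \<Longrightarrow>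
    proj (Cod f) \<cdot> f \<cdot> y = Zero (Dom y) (Cod f)"
proof (induction rule: proj_span.induct)
  case (zero m n)
  then show ?case by (simp add: comp_Zero)
next
  case (sandwich y g h k)
  have "proj (Cod (f \<cdot> g)) \<cdot> (f \<cdot> g) \<cdot> proj (Dom (f \<cdot> g)) = Zero (Dom (f \<cdot> g)) (Cod (f \<cdot> g))"
    using sandwich by (intro proj_sandwich_zero) (auto simp: mat_comp_zero)
  then have "(proj (Cod f) \<cdot> f \<cdot> g \<cdot> proj k) \<cdot> h = Zero (Dom h) (Cod f)"
    using sandwich by (simp add: comp_assoc comp_Zero)
  then show ?case using sandwich by (simp add: comp_add_right comp_assoc)
qed

lemma proj_span_comp_zero:
  "proj_span x \<Longrightarrow> ok f \<Longrightarrow> \<forall>b c. mat f b c = 0 \<Longrightarrow> Dom x = Cod f \<Longrightarrow> x \<cdot> f = Zero (Dom f) (Cod x)"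
proof (induction rule: proj_span.induct)
  case (zero m n)
  then show ?case by (simp add: comp_Zero)
next
  case (sandwich x g h k)
  have "proj k \<cdot> h \<cdot> f = Zero (Dom f) k"
    using proj_comp_zero[OF proj_span_id[of "Dom f"], of "h \<cdot> f"] sandwich by (simp add: mat_comp_zero)
  then show ?case using sandwich by (simp add: comp_add_left comp_assoc comp_Zero)
qed

lemma mat_inject:
  assumes f: "ok f" and g: "ok g" and "Dom f = Dom g" "Cod f = Cod g" and eq: "mat f = mat g"
  shows "f = g"
proof -
  define h where "h = f \<boxplus> mscale (- 1) g"
  have h: "ok h" "Dom h = Dom g" "Cod h = Cod g" using assms by (simp_all add: h_def)
  then have "\<forall>b c. mat h b c = 0" using eq g by (simp add: h_def mat_add mat_scale)
  then have "h = Zero (Dom g) (Cod g)"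
    using proj_span_comp_zero[OF proj_span_id[of "Cod h"], of h] h by simp
  then have "h \<boxplus> g = g" by simp
  moreover have "h \<boxplus> g = f"
    using assms by (simp add: h_def add_assoc add_inverse)
  ultimately show ?thesis by simp
qed

section \<open>Fullness\<close>

definition mm :: "nat \<Rightarrow> (crys_elem \<Rightarrow> crys_elem \<Rightarrow> 'k::field) \<Rightarrow> (crys_elem \<Rightarrow> crys_elem \<Rightarrow> 'k) \<Rightarrow>
    crys_elem \<Rightarrow> crys_elem \<Rightarrow> 'k" where
  "mm n N M = (\<lambda>b d. \<Sum>c\<in>elems (tcrys n). M b c * N c d)"

lemma mat_mm: "\<lbrakk>ok g; ok f; Dom g = Cod f\<rbrakk> \<Longrightarrow> mat (g \<cdot> f) = mm (Cod f) (mat g) (mat f)"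
  by (simp add: mm_def mat_comp fun_eq_iff)

lemma mm_assoc: "mm m (mm n L N) M = mm n L (mm m N M)"
  unfolding mm_def
  by (auto simp: fun_eq_iff sum_distrib_left sum_distrib_right mult.assoc intro: sum.swap)

lemma mm_add:
  "mm n (\<lambda>b c. N b c + N' b c) M = (\<lambda>b c. mm n N M b c + mm n N' M b c)"
  "mm n N (\<lambda>b c. M b c + M' b c) = (\<lambda>b c. mm n N M b c + mm n N M' b c)"
  by (simp_all add: mm_def fun_eq_iff distrib_left distrib_right sum.distrib)

lemma mm_zero: "mm n (\<lambda>b c. 0) M = (\<lambda>b c. 0)" "mm n N (\<lambda>b c. 0) = (\<lambda>b c. 0)"
  by (simp_all add: mm_def)

lemma mm_id:
  assumes "intertwiner (tcrys m) (tcrys n) M"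
  shows "mm n (diag n (\<lambda>_. True)) M = M" "mm m M (diag m (\<lambda>_. True)) = M"
  using intertwiner_supp[OF assms] by (auto simp: mm_def fun_eq_iff sum_diag_left sum_diag_right)

lemma mm_intertwiner:
  "\<lbrakk>intertwiner (tcrys m) (tcrys n) M; intertwiner (tcrys n) (tcrys p) N\<rbrakk>
    \<Longrightarrow> intertwiner (tcrys m) (tcrys p) (mm n N M)"
  unfolding mm_def by (rule intertwiner_compose[OF tcrys_sl2])

definition realized :: "nat \<Rightarrow> nat \<Rightarrow> (crys_elem \<Rightarrow> crys_elem \<Rightarrow> 'k::field) \<Rightarrow> bool" where
  "realized m n M \<longleftrightarrow> (\<exists>f. ok f \<and> Dom f = m \<and> Cod f = n \<and> mat f = M)"

lemma realized_mat: "ok f \<Longrightarrow> realized (Dom f) (Cod f) (mat f)"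
  unfolding realized_def by blast

lemma realized_mm: "realized m n M \<Longrightarrow> realized n p N \<Longrightarrow> realized m p (mm n N M)"
  unfolding realized_def by (metis Cod_simps(3) Dom_simps(3) mat_mm ok_simps(3))

lemma realized_zero: "realized m n (\<lambda>b c. 0)"
  unfolding realized_def by (intro exI[of _ "Zero m n"]) (simp add: mat_Zero fun_eq_iff)

lemma realized_add: "realized m n M \<Longrightarrow> realized m n N \<Longrightarrow> realized m n (\<lambda>b c. M b c + N b c)"
proof -
  assume "realized m n M" "realized m n N"
  then obtain f g where "ok f" "Dom f = m" "Cod f = n" "mat f = M" "ok g" "Dom g = m" "Cod g = n" "mat g = N"
    unfolding realized_def by blast
  then show ?thesis
    unfolding realized_def by (intro exI[of _ "f \<boxplus> g"]) (auto simp: mat_add fun_eq_iff)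
qed

text \<open>The matrix side of \<open>proj_sandwich\<close>. The sandwiched matrix has entries only
  between good words, and in rows of highest weight only between the words \<open>highest k\<close>
  and \<open>highest l\<close>, so it is a multiple of a single projection.\<close>

lemma realized_sandwich:
  fixes M :: "crys_elem \<Rightarrow> crys_elem \<Rightarrow> 'k::field"
  assumes M: "intertwiner (tcrys k) (tcrys l) M"
  shows "realized k l (mm l (diag l good) (mm k M (diag k good)))"
proof -
  define N where "N = mm l (diag l good) (mm k M (diag k good))"
  have P: "intertwiner (tcrys n) (tcrys n) (diag n good :: _ \<Rightarrow> _ \<Rightarrow> 'k)" for n
    using mat_intertwiner[of "proj n :: 'k mor"] by (simp add: mat_proj)
  have N: "intertwiner (tcrys k) (tcrys l) N"
    unfolding N_def by (intro mm_intertwiner[OF _ P] mm_intertwiner[OF P] M)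
  have N_entry: "N b d = (if b \<in> elems (tcrys k) \<and> good b \<and> d \<in> elems (tcrys l) \<and> good d then M b d else 0)" for b d
    by (simp add: N_def mm_def sum_diag_left sum_diag_right)
  define a where "a = M (highest k) (highest k)"
  define f :: "'k mor" where "f = (if k = l then mscale a (proj k) else Zero k l)"
  have f: "ok f" "Dom f = k" "Cod f = l" by (auto simp: f_def)
  have "N = mat f"
  proof (rule intertwiner_eqI[OF tcrys_sl2 N])
    show "intertwiner (tcrys k) (tcrys l) (mat f)" using mat_intertwiner[OF f(1)] f by simp
    fix b d assume bd: "b \<in> elems (tcrys k)" "d \<in> elems (tcrys l)" "e_op (tcrys k) b = None"
    \<comment> \<open>Equal \<open>eps\<close> makes \<open>d\<close> a highest weight element, and
      equal weights \<open>2k\<close> and \<open>2l\<close> force \<open>k = l\<close>.\<close>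
    have diag: "d = highest l \<and> k = l" if "M (highest k) d \<noteq> 0" "good d"
    proof -
      have "eps (tcrys l) d = 0"
        using intertwiner_eps[OF tcrys_sl2 tcrys_sl2 M that(1)] highest_ops[of k] by simp
      then have "e_op (tcrys l) d = None"
        using sl2_crystal.eps_eq_0_iff[OF tcrys_sl2 bd(2)] by simp
      then have d: "d = highest l" using good_highest_weight[OF bd(2)] that by simp
      then show ?thesis
        using intertwinerD(3)[OF M that(1)] highest_ops[of k] highest_ops[of l] by simp
    qed
    show "N b d = mat f b d"
    proof (cases "good b")
      case True
      then have b: "b = highest k" using good_highest_weight bd by blast
      show ?thesis
      proof (cases "M (highest k) d \<noteq> 0 \<and> good d")
        case True
        then have "d = highest l" "k = l" using diag by blast+
        then show ?thesis
          using bd good_highest[of k] by (simp add: b N_entry f_def mat_scale mat_proj diag_def a_def)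
      next
        case False
        then have "N b d = 0" by (auto simp: b N_entry)
        moreover have "mat f b d = 0"
          using False good_highest[of k] by (auto simp: b f_def mat_scale mat_proj mat_Zero diag_def a_def)
        ultimately show ?thesis by simp
      qed
    qed (auto simp: N_entry f_def mat_scale mat_proj mat_Zero diag_def)
  qed
  then show ?thesis using realized_mat[OF f(1)] f by (simp add: N_def)
qed

text \<open>With \<open>x\<close> the identity of the codomain this removes the left projection from
  \<open>realized_sandwich\<close>: \<open>h\<close> is absorbed into \<open>M\<close>, and
  \<open>g\<close> is already realized. \<open>realized_right\<close> then removes the right
  one.\<close>

lemma realized_left:
  "proj_span x \<Longrightarrow> intertwiner (tcrys k) (tcrys (Dom x)) M \<Longrightarrow>
    realized k (Cod x) (mm (Dom x) (mat x) (mm k M (diag k good)))"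
proof (induction rule: proj_span.induct)
  case (zero m n)
  have "mat (Zero m n) = (\<lambda>b c. 0 :: 'a)" by (simp add: mat_Zero fun_eq_iff)
  then show ?case by (simp add: mm_zero realized_zero)
next
  case (sandwich x g h j)
  have ok: "ok (g \<cdot> proj j \<cdot> h \<boxplus> x)" using sandwich proj_span_ok by auto
  have h: "intertwiner (tcrys (Dom x)) (tcrys j) (mat h)"
    using mat_intertwiner[of h] sandwich by simp
  have "mat (g \<cdot> proj j \<cdot> h \<boxplus> x) = (\<lambda>b c. mm j (mat g) (mm j (diag j good) (mat h)) b c + mat x b c)"
    using sandwich ok by (simp add: fun_eq_iff mat_add mat_mm mat_proj)
  moreover have "mm (Dom x) (mm j (mat g) (mm j (diag j good) (mat h))) (mm k M (diag k good))
      = mm j (mat g) (mm j (diag j good) (mm k (mm (Dom x) (mat h) M) (diag k good)))"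
    by (simp only: mm_assoc)
  moreover have "realized k (Cod g) (mm j (mat g) (mm j (diag j good) (mm k (mm (Dom x) (mat h) M) (diag k good))))"
    using sandwich realized_mat[of g] by (intro realized_mm[OF realized_sandwich] mm_intertwiner[OF _ h]) auto
  ultimately show ?case
    using sandwich by (auto simp: mm_add intro: realized_add)
qed

lemma realized_proj:
  fixes M :: "crys_elem \<Rightarrow> crys_elem \<Rightarrow> 'k::field"
  assumes M: "intertwiner (tcrys k) (tcrys l) M"
  shows "realized k l (mm k M (diag k good))"
proof -
  have "intertwiner (tcrys k) (tcrys l) (mm k M (mat (proj k)))"
    using mat_intertwiner[of "proj k :: 'k mor"] by (intro mm_intertwiner[OF _ M]) simp
  then show ?thesis
    using realized_left[OF proj_span_id[of l], of k M] M by (simp add: mat_Idm mat_proj mm_id)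
qed

lemma realized_right:
  "proj_span y \<Longrightarrow> intertwiner (tcrys (Cod y)) (tcrys l) M \<Longrightarrow> realized (Dom y) l (mm (Cod y) M (mat y))"
proof (induction rule: proj_span.induct)
  case (zero m n)
  have "mat (Zero m n) = (\<lambda>b c. 0 :: 'a)" by (simp add: mat_Zero fun_eq_iff)
  then show ?case by (simp add: mm_zero realized_zero)
next
  case (sandwich y g h k)
  have ok: "ok (g \<cdot> proj k \<cdot> h \<boxplus> y)" using sandwich proj_span_ok by auto
  have g: "intertwiner (tcrys k) (tcrys (Cod y)) (mat g)"
    using mat_intertwiner[of g] sandwich by simp
  have "mat (g \<cdot> proj k \<cdot> h \<boxplus> y) = (\<lambda>b c. mm k (mat g) (mm k (diag k good) (mat h)) b c + mat y b c)"
    using sandwich ok by (simp add: fun_eq_iff mat_add mat_mm mat_proj)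
  moreover have "mm (Cod y) M (mm k (mat g) (mm k (diag k good) (mat h)))
      = mm k (mm k (mm (Cod y) M (mat g)) (diag k good)) (mat h)"
    by (simp only: mm_assoc)
  moreover have "realized (Dom h) l (mm k (mm k (mm (Cod y) M (mat g)) (diag k good)) (mat h))"
    using sandwich realized_mat[of h] by (intro realized_mm[OF _ realized_proj] mm_intertwiner[OF g]) auto
  ultimately show ?case
    using sandwich by (auto simp: mm_add intro: realized_add)
qed

lemma mat_surj: "intertwiner (tcrys m) (tcrys n) M \<Longrightarrow> realized m n M"
  using realized_right[OF proj_span_id[of m], of n M] by (simp add: mat_Idm mm_id)

section \<open>The isomorphism\<close>

text \<open>Any representative would do, by \<open>ev_cong\<close>; the choice yields one function
  on classes of all types.\<close>

definition realization :: "('k::field, so3_gen) expr set \<Rightarrow> 'k crys_mor" where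
  "realization Q = ev (SOME e. e \<in> Q)"

abbreviation so3_class :: "('k::field, so3_gen) expr \<Rightarrow> ('k, so3_gen) expr set" where
  "so3_class \<equiv> expr_class so3_src so3_tgt so3_relations"

lemma realization_class:
  assumes "so3_wf e"
  shows "realization (so3_class e) = ev e"
proof -
  have "(SOME e'. e' \<in> so3_class e) \<in> so3_class e"
    by (rule someI[of _ e]) (simp add: assms expr_class_def expr_eq.refl)
  then show ?thesis
    unfolding realization_def expr_class_def using ev_cong by fastforce
qed

lemma ev_inject:
  assumes "so3_wf e" "so3_wf e'" "src so3_src e = src so3_src e'" "tgt so3_tgt e = tgt so3_tgt e'" "ev e = ev e'"
  shows "so3_class e = so3_class e'"
proof -
  have "abs_mor e = abs_mor e'"
    using assms ev_mat[of e] ev_mat[of e']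
    by (intro mat_inject) (auto simp: ok.abs_eq Dom.abs_eq Cod.abs_eq)
  then have "so3_equiv e e'" by (simp add: mor.abs_eq_iff)
  then show ?thesis using assms(1) by (simp add: so3_equiv_iff expr_class_eqI)
qed

lemma ev_surj:
  assumes "\<mu> \<in> Hom sl2_Crys (tpow m) (tpow n)"
  obtains e where "so3_wf e" "src so3_src e = m" "tgt so3_tgt e = n" "ev e = \<mu>"
proof -
  obtain M where M: "\<mu> = (tpow m, tpow n, M)" "intertwiner (tcrys m) (tcrys n) M"
    using assms by (auto simp: sl2_Crys_Hom tcrys_def)
  obtain f where f: "ok f" "Dom f = m" "Cod f = n" "mat f = M"
    using mat_surj[OF M(2)] unfolding realized_def by blast
  obtain e where e: "f = abs_mor e" by (rule mor_cases)
  show thesis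
    by (rule that[of e]) (use f M ev_mat[of e] in \<open>auto simp: e ok.abs_eq Dom.abs_eq Cod.abs_eq\<close>)
qed

lemma tpow_inj: "inj tpow"
  by (metis injI length_tpow)

lemma presented_isomorphism:
  "linear_monoidal_isomorphism (SO3_presented :: (nat, ('k::field, so3_gen) expr set, 'k) monoidal_data)
     Fund_SO3_Crys tpow realization"
proof -
  have Hom: "\<exists>e. f = so3_class e \<and> so3_wf e \<and> src so3_src e = m \<and> tgt so3_tgt e = n"
    if "f \<in> Hom SO3_presented m n" for f :: "('k, so3_gen) expr set" and m n
    using that by (auto simp: SO3_presented_def presented_category_Hom)
  have bij: "bij_betw realization (Hom SO3_presented m n) (Hom sl2_Crys (tpow m) (tpow n) :: 'k crys_mor set)" for m n
    unfolding bij_betw_def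
  proof
    show "inj_on realization (Hom SO3_presented m n :: ('k, so3_gen) expr set set)"
    proof (rule inj_onI)
      fix f g :: "('k, so3_gen) expr set"
      assume "f \<in> Hom SO3_presented m n" "g \<in> Hom SO3_presented m n" and eq: "realization f = realization g"
      then obtain e e' where "f = so3_class e \<and> so3_wf e \<and> src so3_src e = m \<and> tgt so3_tgt e = n"
        "g = so3_class e' \<and> so3_wf e' \<and> src so3_src e' = m \<and> tgt so3_tgt e' = n"
        using Hom by meson
      then show "f = g"
        using ev_inject[of e e'] eq by (simp add: realization_class)
    qed
    show "realization ` Hom SO3_presented m n = (Hom sl2_Crys (tpow m) (tpow n) :: 'k crys_mor set)"
    proof (intro equalityI subsetI)
      fix \<mu> :: "'k crys_mor" assume "\<mu> \<in> realization ` Hom SO3_presented m n"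
      then show "\<mu> \<in> Hom sl2_Crys (tpow m) (tpow n)"
        using ev_hom by (fastforce dest!: Hom simp: realization_class)
    next
      fix \<mu> :: "'k crys_mor" assume "\<mu> \<in> Hom sl2_Crys (tpow m) (tpow n)"
      then obtain e where e: "so3_wf e" "src so3_src e = m" "tgt so3_tgt e = n" "ev e = \<mu>"
        by (rule ev_surj)
      then have "\<mu> = realization (so3_class e)" by (simp add: realization_class)
      moreover have "so3_class e \<in> Hom SO3_presented m n"
        using e by (auto simp: SO3_presented_def presented_category_Hom)
      ultimately show "\<mu> \<in> realization ` Hom SO3_presented m n" by blast
    qed
  qed
  show ?thesis
    unfolding linear_monoidal_isomorphism_def
  proof (intro conjI ballI allI, goal_cases)
    case 1
    show ?case using tpow_inj by (simp add: SO3_presented_def bij_betw_def)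
  next
    case (2 m n)
    show ?case using bij[of m n] by simp
  next
    case (3 n)
    show ?case by (simp add: SO3_presented_def realization_class tensor_power_Fund)
  next
    case (4 m n p f g)
    then show ?case
      by (auto dest!: Hom simp: realization_class) (simp add: SO3_presented_def realization_class)
  next
    case 5
    show ?case by (simp add: SO3_presented_def)
  next
    case (6 m n)
    show ?case by (simp add: SO3_presented_def tpow_add)
  next
    case (7 m n m' n' f g)
    then show ?case
      by (auto dest!: Hom simp: realization_class) (simp add: SO3_presented_def realization_class)
  next
    case (8 m n)
    show ?case by (simp add: SO3_presented_def realization_class tensor_power_Fund)
  next
    case (9 m n f g)
    then show ?case
      by (auto dest!: Hom simp: realization_class) (simp add: SO3_presented_def realization_class)
  next
    case (10 m n f a)
    then show ?case
      by (auto dest!: Hom simp: realization_class) (simp add: SO3_presented_def realization_class)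
  qed
qed

theorem proposition4p4p1:
  "linear_monoidal_isomorphic
     (Fund_SO3_Crys :: (crys_obj, 'k::field crys_mor, 'k) monoidal_data)
     (SO3_presented :: (nat, ('k, so3_gen) expr set, 'k) monoidal_data)"
proof (rule linear_monoidal_isomorphic_sym)
  show "linear_monoidal_isomorphic
     (SO3_presented :: (nat, ('k, so3_gen) expr set, 'k) monoidal_data)
     (Fund_SO3_Crys :: (crys_obj, 'k crys_mor, 'k) monoidal_data)"
    unfolding linear_monoidal_isomorphic_def
    using presented_isomorphism presented_category_linear_monoidal Fund_linear_monoidal
    by (auto simp: SO3_presented_def)
qed

end
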